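(* There exist positive absolute constants $C_1,C_2$ such that for every holomorphic function $b$ on $\mathbb{D}^2$, with $d\mu_b:=|\partial_{zw}b(z,w)|^2\,dA(z)\,dA(w)$ and $$N(b):=[\mu_b]_{CM}+\|b\|_{H^\infty}^2+\sup_{w\in\mathbb{D}}\big[|\partial_zb(\cdot,w)|^2dA(\cdot)\big]_{CM(\mathcal{D}(\mathbb{D}))}+\sup_{z\in\mathbb{D}}\big[|\partial_wb(z,\cdot)|^2dA(\cdot)\big]_{CM(\mathcal{D}(\mathbb{D}))},$$ one has $$C_1N(b)\le\|M_b\|^2_{\mathcal{B}(\mathcal{D}(\mathbb{D}^2))}\le C_2N(b).$$ (Each quantity is allowed to be $+\infty$.)
   Context: $\mathbb{D}$ is the open unit disc, $dA$ is area measure on $\mathbb{D}$. $\mathcal{D}(\mathbb{D})$ is the space of holomorphic $f(z)=\sum_{n\ge0}a_nz^n$ on $\mathbb{D}$ with $\|f\|^2_{\mathcal{D}(\mathbb{D})}=\sum_{n\ge0}(n+1)|a_n|^2<\infty$. $\mathcal{D}(\mathbb{D}^2)$ is the space of holomorphic $f(z,w)=\sum_{m,n\ge0}a_{mn}z^mw^n$ on $\mathbb{D}^2$ with $\|f\|^2_{\mathcal{D}(\mathbb{D}^2)}=\sum_{m,n\ge0}|a_{mn}|^2(m+1)(n+1)<\infty$. For a positive Borel measure $\mu$ on $\mathbb{D}^2$, $[\mu]_{CM}\in[0,\infty]$ is the smallest constant $C$ with $\int_{\mathbb{D}^2}|f|^2d\mu\le C\|f\|^2_{\mathcal{D}(\mathbb{D}^2)}$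 for all $f\in\mathcal{D}(\mathbb{D}^2)$ (i.e. the squared norm of the embedding $\mathcal{D}(\mathbb{D}^2)\to L^2(\mu)$). For a positive Borel measure $\nu$ on $\mathbb{D}$, $[\nu]_{CM(\mathcal{D}(\mathbb{D}))}$ is the smallest $C$ with $\int_{\mathbb{D}}|f|^2d\nu\le C\|f\|^2_{\mathcal{D}(\mathbb{D})}$ for all $f\in\mathcal{D}(\mathbb{D})$. $\|b\|_{H^\infty}=\sup_{\mathbb{D}^2}|b|$. $M_b:f\mapsto bf$ is the multiplication operator, and $\|M_b\|_{\mathcal{B}(\mathcal{D}(\mathbb{D}^2))}$ is its operator norm on $\mathcal{D}(\mathbb{D}^2)$ ($+\infty$ if $M_b$ does not map $\mathcal{D}(\mathbb{D}^2)$ boundedly into itself). *)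

theory Defs
  imports "HOL-Complex_Analysis.Complex_Analysis"
begin

text \<open>
  Functions on the disc and on the bidisc are total functions; no notion below depends on their
  values outside the domain.
\<close>

abbreviation disc :: "complex set" where
  "disc \<equiv> ball 0 1"

abbreviation bidisc :: "(complex \<times> complex) set" where
  "bidisc \<equiv> disc \<times> disc"

text \<open>Complex Frechet differentiability at every point (meant for open sets).\<close>

definition holomorphic2_on :: "(complex \<times> complex \<Rightarrow> complex) \<Rightarrow> (complex \<times> complex) set \<Rightarrow> bool"
    (infixl "holomorphic2'_on" 50) where
  "f holomorphic2_on S \<longleftrightarrow>
     (\<forall>p\<in>S. \<exists>c d. (f has_derivative (\<lambda>(h, k). c * h + d * k)) (at p within S))"

definition partial_z :: "(complex \<times> complex \<Rightarrow> complex) \<Rightarrow> complex \<times> complex \<Rightarrow> complex" where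
  "partial_z f = (\<lambda>(z, w). deriv (\<lambda>u. f (u, w)) z)"

definition partial_w :: "(complex \<times> complex \<Rightarrow> complex) \<Rightarrow> complex \<times> complex \<Rightarrow> complex" where
  "partial_w f = (\<lambda>(z, w). deriv (\<lambda>u. f (z, u)) w)"

definition partial_zw :: "(complex \<times> complex \<Rightarrow> complex) \<Rightarrow> complex \<times> complex \<Rightarrow> complex" where
  "partial_zw f = partial_z (partial_w f)"


section \<open>Dirichlet spaces\<close>

text \<open>
  A holomorphic function has exactly one coefficient family as below. In two variables the
  double series is summed unconditionally.
\<close>

definition coeffs1 :: "(complex \<Rightarrow> complex) \<Rightarrow> nat \<Rightarrow> complex" where
  "coeffs1 f = (THE a. \<forall>z\<in>disc. (\<lambda>n. a n * z ^ n) sums f z)"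

definition dirichlet1 :: "(complex \<Rightarrow> complex) set" where
  "dirichlet1 = {f. f holomorphic_on disc \<and>
     (\<lambda>n. (real n + 1) * (cmod (coeffs1 f n))\<^sup>2) summable_on UNIV}"

definition dirichlet1_norm :: "(complex \<Rightarrow> complex) \<Rightarrow> real" where
  "dirichlet1_norm f = sqrt (\<Sum>\<^sub>\<infinity>n. (real n + 1) * (cmod (coeffs1 f n))\<^sup>2)"

definition coeffs2 :: "(complex \<times> complex \<Rightarrow> complex) \<Rightarrow> nat \<times> nat \<Rightarrow> complex" where
  "coeffs2 f = (THE a. \<forall>(z, w)\<in>bidisc. ((\<lambda>(m, n). a (m, n) * z ^ m * w ^ n) has_sum f (z, w)) UNIV)"

definition dirichlet2 :: "(complex \<times> complex \<Rightarrow> complex) set" where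
  "dirichlet2 = {f. f holomorphic2_on bidisc \<and>
     (\<lambda>(m, n). (cmod (coeffs2 f (m, n)))\<^sup>2 * (real m + 1) * (real n + 1)) summable_on UNIV}"

definition dirichlet2_norm :: "(complex \<times> complex \<Rightarrow> complex) \<Rightarrow> real" where
  "dirichlet2_norm f =
     sqrt (\<Sum>\<^sub>\<infinity>(m, n). (cmod (coeffs2 f (m, n)))\<^sup>2 * (real m + 1) * (real n + 1))"


section \<open>Carleson measures\<close>

text \<open>Unnormalised area measure, as a measure whose space is the disc.\<close>

definition area_disc :: "complex measure" where
  "area_disc = restrict_space lborel disc"

definition CM1 :: "complex measure \<Rightarrow> ennreal" where
  "CM1 \<nu> = Inf {C. \<forall>f\<in>dirichlet1.
     (\<integral>\<^sup>+z. ennreal ((cmod (f z))\<^sup>2) \<partial>\<nu>) \<le> C * ennreal ((dirichlet1_norm f)\<^sup>2)}"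

definition CM2 :: "(complex \<times> complex) measure \<Rightarrow> ennreal" where
  "CM2 \<mu> = Inf {C. \<forall>f\<in>dirichlet2.
     (\<integral>\<^sup>+p. ennreal ((cmod (f p))\<^sup>2) \<partial>\<mu>) \<le> C * ennreal ((dirichlet2_norm f)\<^sup>2)}"

definition mixed_measure :: "(complex \<times> complex \<Rightarrow> complex) \<Rightarrow> (complex \<times> complex) measure" where
  "mixed_measure b =
     density (area_disc \<Otimes>\<^sub>M area_disc) (\<lambda>p. ennreal ((cmod (partial_zw b p))\<^sup>2))"

definition slice_measure_z :: "(complex \<times> complex \<Rightarrow> complex) \<Rightarrow> complex \<Rightarrow> complex measure" where
  "slice_measure_z b w = density area_disc (\<lambda>z. ennreal ((cmod (partial_z b (z, w)))\<^sup>2))"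

definition slice_measure_w :: "(complex \<times> complex \<Rightarrow> complex) \<Rightarrow> complex \<Rightarrow> complex measure" where
  "slice_measure_w b z = density area_disc (\<lambda>w. ennreal ((cmod (partial_w b (z, w)))\<^sup>2))"


section \<open>Multipliers\<close>

definition Hinf_norm :: "(complex \<times> complex \<Rightarrow> complex) \<Rightarrow> ennreal" where
  "Hinf_norm b = (SUP p\<in>bidisc. ennreal (cmod (b p)))"

definition mult_op ::
    "(complex \<times> complex \<Rightarrow> complex) \<Rightarrow> (complex \<times> complex \<Rightarrow> complex) \<Rightarrow> complex \<times> complex \<Rightarrow> complex" where
  "mult_op b f = (\<lambda>p. b p * f p)"

text \<open>The infimum over the empty set is \<open>\<infinity>\<close>: this covers operators that are unbounded or do not
  map the space into itself.\<close>

definition dirichlet2_opnorm ::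
    "((complex \<times> complex \<Rightarrow> complex) \<Rightarrow> complex \<times> complex \<Rightarrow> complex) \<Rightarrow> ennreal" where
  "dirichlet2_opnorm T = Inf {ennreal C | C. 0 \<le> C \<and>
     (\<forall>f\<in>dirichlet2. T f \<in> dirichlet2 \<and> dirichlet2_norm (T f) \<le> C * dirichlet2_norm f)}"

definition multiplier_quantity :: "(complex \<times> complex \<Rightarrow> complex) \<Rightarrow> ennreal" where
  "multiplier_quantity b =
     CM2 (mixed_measure b) + (Hinf_norm b)\<^sup>2
     + (SUP w\<in>disc. CM1 (slice_measure_z b w))
     + (SUP z\<in>disc. CM1 (slice_measure_w b z))"

end

theory Submission
  imports Defs "HOL-Real_Asymp.Real_Asymp"
begin

text \<open>
  Up to constants, the square of the norm of \<open>f\<close> in the Dirichlet space of the bidisc is the sum of the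
  squared one-variable norms of the two slices \<open>f(\<cdot>, 0)\<close> and \<open>f(0, \<cdot>)\<close> and of the area integral of
  \<open>|\<partial>\<^sub>z\<^sub>w f|\<^sup>2\<close> over the bidisc, because \<open>m + 2 \<le> 2 (m + 1)\<close>. In this form no integral over the torus
  occurs, and every multiplier estimate reduces to the Leibniz rule
  \<open>\<partial>\<^sub>z\<^sub>w (b f) = b \<partial>\<^sub>z\<^sub>w f + \<partial>\<^sub>z b \<partial>\<^sub>w f + \<partial>\<^sub>w b \<partial>\<^sub>z f + \<partial>\<^sub>z\<^sub>w b f\<close>.

  The first term on the right is controlled by the supremum of \<open>|b|\<close> and the last one by the Carleson
  constant of the mixed measure. For the second one, fix \<open>w\<close>: the slice measure \<open>|\<partial>\<^sub>z b(\<cdot>, w)|\<^sup>2 dA\<close>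
  embeds the one-variable Dirichlet space, so the integral over \<open>z\<close> is at most a constant times the
  squared Dirichlet norm of \<open>\<partial>\<^sub>w f(\<cdot>, w)\<close>; the integral of these norms over \<open>w\<close> is at most \<open>\<pi>\<close> times
  the squared norm of \<open>f\<close>, by Parseval (\<open>mixed_term_w_le\<close>). The third term is symmetric. Together with
  the one-variable analogue of the argument on the two slices (\<open>dsum1_mult_le\<close>) this bounds the
  multiplier norm (\<open>multiplier_bound_if_bounds\<close>).

  Conversely, let \<open>b\<close> be a multiplier. Test it on products \<open>g(z) k(w)\<close>, where \<open>k\<close> is the reproducing
  kernel of the one-variable space at a point \<open>w\<^sub>0\<close>. Evaluation in the second variable at \<open>w\<^sub>0\<close> costs a
  factor \<open>k(w\<^sub>0)\<close> in squared norm, which is exactly what the norm and the value of \<open>k\<close> compensate; so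
  each slice \<open>b(\<cdot>, w\<^sub>0)\<close> is a multiplier in one variable with the same bound
  (\<open>slice_multiplier_bound\<close>). A second use of the kernel bounds \<open>|b|\<close> (\<open>multiplier_bound_imp_bounded\<close>),
  the one-variable Leibniz rule then bounds the slice measures (\<open>nn_integral_deriv_mult_le\<close>), and
  finally the two-variable Leibniz rule, solved for \<open>\<partial>\<^sub>z\<^sub>w b f\<close>, bounds the mixed measure
  (\<open>mixed_derivative_bound_if_multiplier_bound\<close>).

  Two analytic facts underlie this. A holomorphic function on the bidisc is the sum of an absolutely
  convergent double power series (\<open>holomorphic2_imp_pseries2\<close>), which makes the coefficients of
  the norms available. And the monomials are orthogonal for area measure on the disc
  (\<open>area_Parseval\<close>), which follows from the rotation invariance of area by averaging over roots of
  unity.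
\<close>

section \<open>Power series in one and two variables\<close>

definition pseries1 :: "(nat \<Rightarrow> complex) \<Rightarrow> (complex \<Rightarrow> complex) \<Rightarrow> bool" where
  "pseries1 c g \<longleftrightarrow> (\<forall>z\<in>disc. (\<lambda>n. c n * z ^ n) sums g z)"

definition pseries2 :: "(nat \<times> nat \<Rightarrow> complex) \<Rightarrow> (complex \<times> complex \<Rightarrow> complex) \<Rightarrow> bool" where
  "pseries2 a f \<longleftrightarrow>
     (\<forall>(z, w)\<in>bidisc. ((\<lambda>(m, n). a (m, n) * z ^ m * w ^ n) has_sum f (z, w)) UNIV)"

text \<open>
  The coefficients of the slice \<open>f(\<cdot>, w)\<close> of the sum \<open>f\<close> of a double power series. As functions of
  \<open>w\<close> they are again power series, so that facts in one variable can be used in each variable in turn.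
  The coefficients of \<open>f(z, \<cdot>)\<close> are the ones of the transposed family.
\<close>

definition slice_coeff :: "(nat \<times> nat \<Rightarrow> complex) \<Rightarrow> complex \<Rightarrow> nat \<Rightarrow> complex" where
  "slice_coeff a w m = (\<Sum>n. a (m, n) * w ^ n)"

lemma pseries1_sums: "pseries1 c g \<Longrightarrow> cmod z < 1 \<Longrightarrow> (\<lambda>n. c n * z ^ n) sums g z"
  by (simp add: pseries1_def)

lemma pseries1_abs_summable:
  assumes "pseries1 c g" "cmod z < 1"
  shows "summable (\<lambda>n. norm (c n * z ^ n))"
proof -
  obtain r where r: "cmod z < r" "r < 1" using assms(2) dense by blast
  have "r > 0" using r(1) norm_ge_zero le_less_trans by blast
  show ?thesis
  proof (rule powser_insidea[where x = "of_real r"])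
    show "summable (\<lambda>n. c n * complex_of_real r ^ n)"
      using pseries1_sums[OF assms(1), of "of_real r"] r \<open>r > 0\<close> by (auto intro: sums_summable)
    show "cmod z < cmod (complex_of_real r)" using r \<open>r > 0\<close> by simp
  qed
qed

text \<open>
  The difference of the two families sums to the zero function, whereas a power series that vanishes
  at the origin and has a nonzero coefficient of positive order has no other zero nearby.
\<close>

lemma pseries1_unique:
  assumes "pseries1 c g" "pseries1 d g"
  shows "c = d"
proof (rule ccontr)
  assume "c \<noteq> d"
  then obtain m where m: "c m - d m \<noteq> 0" by force
  have s: "(\<lambda>n. (c n - d n) * (z - 0) ^ n) sums 0" if "norm (z - 0) < 1" for z
    using sums_diff[OF pseries1_sums[OF assms(1), of z] pseries1_sums[OF assms(2), of z]] that
    by (simp add: left_diff_distrib)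
  have "m \<noteq> 0"
  proof
    assume "m = 0"
    have "(\<lambda>n. (c n - d n) * 0 ^ n) sums 0" using s[of 0] by simp
    then have "0 = c 0 - d 0" by (rule sums_unique2[OF _ powser_sums_zero])
    then show False using m \<open>m = 0\<close> by simp
  qed
  then obtain s where s: "0 < s" "\<And>z. z \<in> cball 0 s - {0::complex} \<Longrightarrow> (0::complex) \<noteq> 0"
    using powser_0_nonzero[of 1 0 "\<lambda>n. c n - d n" "\<lambda>_. 0" m] s m by auto
  have "complex_of_real s \<in> cball 0 s - {0::complex}" using s(1) by simp
  then show False using s(2) by blast
qed

lemma pseries1_coeffs1: "pseries1 c g \<Longrightarrow> coeffs1 g = c"
  unfolding coeffs1_def
  by (rule the_equality) (auto intro: pseries1_unique simp: pseries1_def[symmetric])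

lemma pseries1_has_deriv:
  assumes "pseries1 c g" "cmod z < 1"
  shows "(g has_field_derivative (\<Sum>n. diffs c n * z ^ n)) (at z)"
proof -
  have "((\<lambda>z. \<Sum>n. c n * z ^ n) has_field_derivative (\<Sum>n. diffs c n * z ^ n)) (at z)"
    by (rule termdiffs_strong'[OF _ assms(2)])
       (use pseries1_sums[OF assms(1)] in \<open>auto intro: sums_summable\<close>)
  moreover have "(\<Sum>n. c n * z ^ n) = g z" if "z \<in> disc" for z
    using pseries1_sums[OF assms(1), of z] that by (simp add: sums_iff)
  ultimately show ?thesis
    using has_field_derivative_transform_within_open[of "\<lambda>z. \<Sum>n. c n * z ^ n" _ z disc g] assms(2)
    by auto
qed

lemma pseries1_holomorphic: "pseries1 c g \<Longrightarrow> g holomorphic_on disc"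
  by (auto simp: holomorphic_on_open intro!: exI pseries1_has_deriv)

lemma pseries1_deriv:
  assumes "pseries1 c g"
  shows "pseries1 (\<lambda>n. of_nat (Suc n) * c (Suc n)) (deriv g)"
  unfolding pseries1_def
proof
  fix z :: complex assume z: "z \<in> disc"
  have "summable (\<lambda>n. diffs c n * z ^ n)"
    by (rule termdiff_converges[where K = 1])
       (use z pseries1_sums[OF assms] in \<open>auto intro: sums_summable\<close>)
  moreover have "deriv g z = (\<Sum>n. diffs c n * z ^ n)"
    using pseries1_has_deriv[OF assms, of z] z by (auto intro: DERIV_imp_deriv)
  ultimately show "(\<lambda>n. of_nat (Suc n) * c (Suc n) * z ^ n) sums deriv g z"
    by (simp add: diffs_def sums_iff)
qed

lemma pseries1_exists:
  assumes "g holomorphic_on disc"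
  shows "pseries1 (\<lambda>n. (deriv ^^ n) g 0 / fact n) g"
  unfolding pseries1_def using holomorphic_power_series[OF assms] by fastforce

lemma pseries1_at_0: "pseries1 c g \<Longrightarrow> g 0 = c 0"
  using pseries1_sums[of c g 0] powser_sums_zero[of c] sums_unique2 by fastforce

lemma pseries2_has_sum:
  "pseries2 a f \<Longrightarrow> cmod z < 1 \<Longrightarrow> cmod w < 1 \<Longrightarrow>
    ((\<lambda>(m, n). a (m, n) * z ^ m * w ^ n) has_sum f (z, w)) UNIV"
  by (auto simp: pseries2_def)

lemma pseries2_abs_summable:
  assumes "pseries2 a f" "cmod z < 1" "cmod w < 1"
  shows "(\<lambda>(m, n). norm (a (m, n)) * norm z ^ m * norm w ^ n) summable_on UNIV"
proof -
  have "(\<lambda>x. norm ((\<lambda>(m, n). a (m, n) * z ^ m * w ^ n) x)) summable_on UNIV"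
    using pseries2_has_sum[OF assms] summable_on_iff_abs_summable_on_complex has_sum_imp_summable
    by blast
  then show ?thesis by (simp add: case_prod_unfold norm_mult norm_power)
qed

lemma pseries2_swap:
  assumes "pseries2 a f"
  shows "pseries2 (a \<circ> prod.swap) (f \<circ> prod.swap)"
  unfolding pseries2_def
proof clarify
  fix z w :: complex assume *: "z \<in> disc" "w \<in> disc"
  have "((\<lambda>x. (\<lambda>(m, n). a (m, n) * w ^ m * z ^ n) (prod.swap x)) has_sum f (w, z)) UNIV"
    using pseries2_has_sum[OF assms, of w z] * has_sum_reindex_bij_betw[OF bij_swap] by force
  then show "((\<lambda>(m, n). (a \<circ> prod.swap) (m, n) * z ^ m * w ^ n) has_sum (f \<circ> prod.swap) (z, w)) UNIV"
    by (simp add: case_prod_unfold prod.swap_def mult.commute mult.left_commute)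
qed

lemma pseries2_slice_coeff_summable:
  assumes "pseries2 a f" "cmod w < 1"
  shows "(\<lambda>n. a (m, n) * w ^ n) summable_on UNIV"
proof -
  \<comment> \<open>Any nonzero \<open>z\<close> serves; the factor \<open>(1/2)\<^sup>m\<close> is constant in the row \<open>m\<close>.\<close>
  have "(\<lambda>(m, n). a (m, n) * (1/2) ^ m * w ^ n) summable_on UNIV"
    using pseries2_has_sum[OF assms(1) _ assms(2), of "1/2"] has_sum_imp_summable by fastforce
  then have "(\<lambda>(m, n). a (m, n) * (1/2) ^ m * w ^ n) summable_on (Pair m ` UNIV)"
    by (rule summable_on_subset_banach) auto
  then have "(\<lambda>n. (1/2) ^ m * (a (m, n) * w ^ n)) summable_on UNIV"
    by (subst (asm) summable_on_reindex) (auto simp: inj_on_def o_def ac_simps)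
  then show ?thesis by (subst (asm) summable_on_cmult_right') auto
qed

lemma pseries2_slice_coeff_has_sum:
  assumes "pseries2 a f" "cmod w < 1"
  shows "((\<lambda>n. a (m, n) * w ^ n) has_sum slice_coeff a w m) UNIV"
proof -
  obtain S where S: "((\<lambda>n. a (m, n) * w ^ n) has_sum S) UNIV"
    using pseries2_slice_coeff_summable[OF assms, of m] summable_on_def by blast
  then have "slice_coeff a w m = S"
    unfolding slice_coeff_def by (rule sums_unique[symmetric, OF has_sum_imp_sums])
  then show ?thesis using S by simp
qed

lemma pseries1_slice_coeff:
  assumes "pseries2 a f"
  shows "pseries1 (\<lambda>n. a (m, n)) (\<lambda>w. slice_coeff a w m)"
  unfolding pseries1_def by (auto intro!: has_sum_imp_sums pseries2_slice_coeff_has_sum[OF assms])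

lemma pseries2_slices_has_sum:
  assumes "pseries2 a f" "cmod z < 1" "cmod w < 1"
  shows "((\<lambda>m. slice_coeff a w m * z ^ m) has_sum f (z, w)) UNIV"
proof (rule has_sum_SigmaD)
  show "((\<lambda>(m, n). a (m, n) * z ^ m * w ^ n) has_sum f (z, w)) (UNIV \<times> UNIV)"
    using pseries2_has_sum[OF assms] by simp
  show "((\<lambda>n. (\<lambda>(m, n). a (m, n) * z ^ m * w ^ n) (m, n)) has_sum slice_coeff a w m * z ^ m) UNIV" for m
    using has_sum_cmult_left[OF pseries2_slice_coeff_has_sum[OF assms(1,3), of m], of "z ^ m"]
    by (simp add: ac_simps)
qed

lemma pseries1_slice_z:
  assumes "pseries2 a f" "cmod w < 1"
  shows "pseries1 (slice_coeff a w) (\<lambda>z. f (z, w))"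
  unfolding pseries1_def by (auto intro!: has_sum_imp_sums pseries2_slices_has_sum[OF assms(1) _ assms(2)])

lemma pseries1_slice_w:
  assumes "pseries2 a f" "cmod z < 1"
  shows "pseries1 (slice_coeff (a \<circ> prod.swap) z) (\<lambda>w. f (z, w))"
  using pseries1_slice_z[OF pseries2_swap[OF assms(1)] assms(2)] by simp

text \<open>
  The one-variable uniqueness is applied twice: to the slices at fixed \<open>w\<close>, and then to their
  coefficients as functions of \<open>w\<close>.
\<close>

lemma pseries2_unique:
  assumes "pseries2 a f" "pseries2 b f"
  shows "a = b"
proof -
  have "slice_coeff a w m = slice_coeff b w m" if "w \<in> disc" for w m
    using pseries1_unique[OF pseries1_slice_z[OF assms(1), of w] pseries1_slice_z[OF assms(2), of w]]
      that by simp
  then have "pseries1 (\<lambda>n. b (m, n)) (\<lambda>w. slice_coeff a w m)" for m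
    using pseries1_slice_coeff[OF assms(2), of m] by (simp add: pseries1_def)
  then have "(\<lambda>n. a (m, n)) = (\<lambda>n. b (m, n))" for m
    using pseries1_unique[OF pseries1_slice_coeff[OF assms(1)]] by blast
  then show ?thesis by (auto simp: fun_eq_iff)
qed

lemma pseries2_coeffs2: "pseries2 a f \<Longrightarrow> coeffs2 f = a"
  unfolding coeffs2_def pseries2_def[symmetric]
  by (rule the_equality) (auto intro: pseries2_unique)

text \<open>
  Slices can be differentiated term by term. What needs an argument is that the differentiated
  double series is summed unconditionally: it is dominated by the original series at a point
  with slightly larger \<open>|z|\<close>.
\<close>

lemma pseries2_partial_z:
  assumes "pseries2 a f"
  shows "pseries2 (\<lambda>(m, n). of_nat (Suc m) * a (Suc m, n)) (partial_z f)"
proof -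
  have "((\<lambda>(m, n). of_nat (Suc m) * a (Suc m, n) * z ^ m * w ^ n) has_sum partial_z f (z, w)) UNIV"
    if z: "cmod z < 1" and w: "cmod w < 1" for z w
  proof -
  obtain r where r: "cmod z < r" "r < 1" using z dense by blast
  have r0: "r > 0" using r(1) norm_ge_zero le_less_trans by blast
  have "(\<lambda>n. of_nat n * (cmod z / r) ^ n) \<longlonglongrightarrow> 0"
    by (rule powser_times_n_limit_0) (use r r0 in \<open>auto simp: norm_divide\<close>)
  then have "Bseq (\<lambda>n. of_nat n * (cmod z / r) ^ n)" using convergentI Bseq_eq_bounded convergent_imp_Bseq by blast
  then obtain K where K: "K > 0" "\<And>n. norm (of_nat n * (cmod z / r) ^ n) \<le> K" unfolding Bseq_def by auto
  have key: "real n * cmod z ^ n \<le> K * r ^ n" for n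
    using K(2)[of n] r0 by (simp add: power_divide field_simps)
  have "(\<lambda>(m, n). norm (a (m, n)) * norm (of_real r :: complex) ^ m * norm w ^ n) summable_on UNIV"
    by (rule pseries2_abs_summable[OF assms]) (use r r0 w in auto)
  then have "(\<lambda>(m, n). K * (norm (a (m, n)) * r ^ m * norm w ^ n)) summable_on UNIV"
    using summable_on_cmult_right[of _ UNIV K] r0 by (fastforce simp: case_prod_unfold)
  then have "(\<lambda>x. norm ((\<lambda>(m, n). of_nat m * a (m, n) * z ^ m * w ^ n) x)) summable_on UNIV"
  proof (rule Infinite_Sum.abs_summable_on_comparison_test')
    fix x :: "nat \<times> nat" obtain m n where x: "x = (m, n)" by force
    have "norm (a (m, n)) * norm w ^ n * (real m * cmod z ^ m) \<le> norm (a (m, n)) * norm w ^ n * (K * r ^ m)"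
      by (intro mult_left_mono key) auto
    then show "norm ((\<lambda>(m, n). of_nat m * a (m, n) * z ^ m * w ^ n) x)
        \<le> (\<lambda>(m, n). K * (norm (a (m, n)) * r ^ m * norm w ^ n)) x"
      by (simp add: x norm_mult norm_power ac_simps)
  qed
  then have sum1: "(\<lambda>(m, n). of_nat m * a (m, n) * z ^ m * w ^ n) summable_on UNIV"
    by (rule abs_summable_summable)
  have "(\<lambda>(m, n). of_nat (Suc m) * a (Suc m, n) * z ^ m * w ^ n) summable_on UNIV"
  proof (cases "z = 0")
    case True
    have "(\<lambda>n. of_nat (Suc 0) * a (Suc 0, n) * w ^ n) summable_on UNIV"
      using pseries2_slice_coeff_summable[OF assms w, of 1] by simp
    then have "(\<lambda>(m, n). of_nat (Suc m) * a (Suc m, n) * z ^ m * w ^ n) summable_on (Pair 0 ` UNIV)"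
      by (subst summable_on_reindex) (auto simp: inj_on_def o_def)
    then show ?thesis
      by (rule summable_on_cong_neutral[THEN iffD1, rotated -1]) (auto simp: True)
  next
    case False
    have "(\<lambda>(m, n). of_nat m * a (m, n) * z ^ m * w ^ n) summable_on ((\<lambda>(m, n). (Suc m, n)) ` UNIV)"
      by (rule summable_on_subset_banach[OF sum1]) auto
    then have "(\<lambda>x. z * (\<lambda>(m, n). of_nat (Suc m) * a (Suc m, n) * z ^ m * w ^ n) x) summable_on UNIV"
      by (subst (asm) summable_on_reindex) (auto simp: inj_on_def o_def case_prod_unfold ac_simps)
    then show ?thesis by (subst (asm) summable_on_cmult_right') (auto simp: False)
  qed
  then obtain S where S: "((\<lambda>(m, n). of_nat (Suc m) * a (Suc m, n) * z ^ m * w ^ n) has_sum S) UNIV"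
    using summable_on_def by blast
  have "((\<lambda>m. of_nat (Suc m) * slice_coeff a w (Suc m) * z ^ m) has_sum S) UNIV"
  proof (rule has_sum_SigmaD)
    show "((\<lambda>(m, n). of_nat (Suc m) * a (Suc m, n) * z ^ m * w ^ n) has_sum S) (UNIV \<times> UNIV)"
      using S by simp
    show "((\<lambda>n. (\<lambda>(m, n). of_nat (Suc m) * a (Suc m, n) * z ^ m * w ^ n) (m, n)) has_sum
        of_nat (Suc m) * slice_coeff a w (Suc m) * z ^ m) UNIV" for m
      using has_sum_cmult_left[OF pseries2_slice_coeff_has_sum[OF assms(1) w, of "Suc m"], of "of_nat (Suc m) * z ^ m"]
      by (simp add: ac_simps)
  qed
  then have "(\<lambda>m. of_nat (Suc m) * slice_coeff a w (Suc m) * z ^ m) sums S" by (rule has_sum_imp_sums)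
  moreover have "(\<lambda>m. of_nat (Suc m) * slice_coeff a w (Suc m) * z ^ m) sums deriv (\<lambda>z. f (z, w)) z"
    by (rule pseries1_sums[OF pseries1_deriv[OF pseries1_slice_z[OF assms w]] z])
  ultimately have "S = deriv (\<lambda>z. f (z, w)) z" by (rule sums_unique2)
  then show ?thesis using S by (simp add: partial_z_def)
  qed
  then show ?thesis by (auto simp: pseries2_def)
qed

text \<open>
  This carries facts about \<open>\<partial>\<^sub>z\<close> over to \<open>\<partial>\<^sub>w\<close>.
\<close>

lemma partial_w_swap: "partial_w f = partial_z (f \<circ> prod.swap) \<circ> prod.swap"
  by (auto simp: partial_w_def partial_z_def fun_eq_iff)

lemma pseries2_partial_w:
  assumes "pseries2 a f"
  shows "pseries2 (\<lambda>(m, n). of_nat (Suc n) * a (m, Suc n)) (partial_w f)"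
  using pseries2_swap[OF pseries2_partial_z[OF pseries2_swap[OF assms]]]
  by (simp add: partial_w_swap o_def case_prod_unfold)

lemma pseries2_partial_zw:
  assumes "pseries2 a f"
  shows "pseries2 (\<lambda>(m, n). of_nat (Suc m) * of_nat (Suc n) * a (Suc m, Suc n)) (partial_zw f)"
  using pseries2_partial_z[OF pseries2_partial_w[OF assms]]
  by (simp add: partial_zw_def o_def case_prod_unfold ac_simps)

section \<open>Holomorphic functions on the bidisc are double power series\<close>

lemma holomorphic2_has_derivative:
  assumes "f holomorphic2_on bidisc" "z \<in> disc" "w \<in> disc"
  obtains c d where "(f has_derivative (\<lambda>(h, k). c * h + d * k)) (at (z, w))"
proof -
  have "open bidisc" by (intro open_Times) auto
  then have "at (z, w) within bidisc = at (z, w)"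
    using assms(2,3) by (intro at_within_open) auto
  moreover obtain c d where "(f has_derivative (\<lambda>(h, k). c * h + d * k)) (at (z, w) within bidisc)"
    using assms unfolding holomorphic2_on_def by blast
  ultimately show ?thesis using that by simp
qed

lemma holomorphic2_continuous_on:
  assumes "f holomorphic2_on bidisc"
  shows "continuous_on bidisc f"
  unfolding continuous_on_eq_continuous_within
proof
  fix p assume "p \<in> bidisc"
  then obtain c d where "(f has_derivative (\<lambda>(h, k). c * h + d * k)) (at p within bidisc)"
    using assms unfolding holomorphic2_on_def by blast
  then show "continuous (at p within bidisc) f" by (rule has_derivative_continuous)
qed

lemma holomorphic2_slice_z:
  assumes "f holomorphic2_on bidisc" "w \<in> disc"
  shows "(\<lambda>z. f (z, w)) holomorphic_on disc"
proof (rule holomorphic_onI)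
  fix z assume z: "z \<in> disc"
  obtain c d where "(f has_derivative (\<lambda>(h, k). c * h + d * k)) (at (z, w))"
    using holomorphic2_has_derivative[OF assms(1) z assms(2)] .
  moreover have "((\<lambda>z. (z, w)) has_derivative (\<lambda>h. (h, 0))) (at z)"
    by (intro has_derivative_Pair has_derivative_ident has_derivative_const)
  ultimately have "((\<lambda>z. f (z, w)) has_derivative (\<lambda>h. (\<lambda>(h, k). c * h + d * k) (h, 0))) (at z)"
    by (rule has_derivative_compose[rotated])
  then have "((\<lambda>z. f (z, w)) has_field_derivative c) (at z)"
    by (simp add: has_field_derivative_def mult_commute_abs)
  then show "(\<lambda>z. f (z, w)) field_differentiable at z within disc"
    using field_differentiable_at_within field_differentiable_def by blast
qed

lemma holomorphic2_swap:
  assumes "f holomorphic2_on bidisc"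
  shows "(f \<circ> prod.swap) holomorphic2_on bidisc"
  unfolding holomorphic2_on_def
proof clarify
  fix z w :: complex assume "z \<in> disc" "w \<in> disc"
  then obtain c d where f: "(f has_derivative (\<lambda>(h, k). c * h + d * k)) (at (w, z))"
    using holomorphic2_has_derivative[OF assms] by blast
  have "(prod.swap has_derivative prod.swap) (at (z, w) within bidisc)"
    unfolding prod.swap_def[abs_def]
    by (intro has_derivative_Pair has_derivative_fst has_derivative_snd has_derivative_ident)
  then have "((\<lambda>x. f (prod.swap x)) has_derivative (\<lambda>x. (\<lambda>(h, k). c * h + d * k) (prod.swap x))) (at (z, w) within bidisc)"
    by (rule has_derivative_compose) (use f in simp)
  then show "\<exists>c d. (f \<circ> prod.swap has_derivative (\<lambda>(h, k). c * h + d * k)) (at (z, w) within bidisc)"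
    by (intro exI[of _ d] exI[of _ c]) (simp add: o_def case_prod_unfold add.commute)
qed

lemma holomorphic2_slice_w:
  assumes "f holomorphic2_on bidisc" "z \<in> disc"
  shows "(\<lambda>w. f (z, w)) holomorphic_on disc"
  using holomorphic2_slice_z[OF holomorphic2_swap[OF assms(1)] assms(2)] by simp

lemma holomorphic2_mult:
  assumes "f holomorphic2_on S" "g holomorphic2_on S"
  shows "(\<lambda>p. f p * g p) holomorphic2_on S"
  unfolding holomorphic2_on_def
proof
  fix p assume p: "p \<in> S"
  obtain c d where f: "(f has_derivative (\<lambda>(h, k). c * h + d * k)) (at p within S)"
    using assms(1) p unfolding holomorphic2_on_def by blast
  obtain c' d' where g: "(g has_derivative (\<lambda>(h, k). c' * h + d' * k)) (at p within S)"
    using assms(2) p unfolding holomorphic2_on_def by blast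
  show "\<exists>c d. ((\<lambda>p. f p * g p) has_derivative (\<lambda>(h, k). c * h + d * k)) (at p within S)"
    by (rule exI[of _ "f p * c' + c * g p"], rule exI[of _ "f p * d' + d * g p"])
       (rule has_derivative_eq_rhs[OF has_derivative_mult[OF f g]], auto simp: fun_eq_iff algebra_simps)
qed

lemma holomorphic2_fst:
  assumes "g holomorphic_on disc"
  shows "(\<lambda>p. g (fst p)) holomorphic2_on bidisc"
  unfolding holomorphic2_on_def
proof clarify
  fix z w :: complex assume z: "z \<in> disc" "w \<in> disc"
  have "(g has_derivative (*) (deriv g z)) (at (fst (z, w)))"
    using holomorphic_derivI[OF assms open_ball z(1)] by (simp add: has_field_derivative_def)
  then have "((\<lambda>p. g (fst p)) has_derivative (\<lambda>p. deriv g z * fst p)) (at (z, w) within bidisc)"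
    by (rule has_derivative_compose[OF has_derivative_fst[OF has_derivative_ident]])
  then show "\<exists>c d. ((\<lambda>p. g (fst p)) has_derivative (\<lambda>(h, k). c * h + d * k)) (at (z, w) within bidisc)"
    by (intro exI[of _ "deriv g z"] exI[of _ 0]) (simp add: case_prod_unfold)
qed

lemma holomorphic2_snd:
  assumes "g holomorphic_on disc"
  shows "(\<lambda>p. g (snd p)) holomorphic2_on bidisc"
  using holomorphic2_swap[OF holomorphic2_fst[OF assms]] by (simp add: o_def)

text \<open>
  Up to a constant, the integral is a Taylor coefficient of \<open>f(\<cdot>, w)\<close>. It depends continuously
  on \<open>w\<close>, and by the Cauchy formula for \<open>f(u, \<cdot>)\<close> and an exchange of the two contour integrals it
  equals the Cauchy integral of its own values on a circle, hence is holomorphic.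
\<close>

lemma Cauchy_coefficient_holomorphic:
  assumes cont: "continuous_on bidisc f"
    and hol: "\<And>z. z \<in> disc \<Longrightarrow> (\<lambda>w. f (z, w)) holomorphic_on disc"
    and r: "0 < r" "r < 1"
  shows "(\<lambda>w. contour_integral (circlepath 0 r) (\<lambda>u. f (u, w) / u ^ m)) holomorphic_on disc"
proof (rule holomorphic_onI)
  fix w0 :: complex assume "w0 \<in> disc"
  then have "cmod w0 < 1" by simp
  then obtain s where s: "cmod w0 < s" "s < 1" using dense by blast
  have s0: "s > 0" using s(1) norm_ge_zero le_less_trans by blast
  define A where "A w = contour_integral (circlepath 0 r) (\<lambda>u. f (u, w) / u ^ m)" for w
  have circ: "circlepath 0 r t \<in> disc" "circlepath 0 r t \<noteq> 0" for t
    using r by (auto simp: circlepath norm_mult)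
  have int: "(\<lambda>u. f (u, v) / u ^ m) contour_integrable_on circlepath 0 r" if "v \<in> disc" for v
    by (rule contour_integrable_continuous_circlepath)
       (use r that in \<open>auto intro!: continuous_intros continuous_on_compose2[OF cont]\<close>)
  have contA: "continuous_on disc A"
    unfolding A_def contour_integral_integral interval_cbox
  proof (rule integral_continuous_on_param)
    have "continuous_on (disc \<times> cbox 0 1) (\<lambda>x. f (circlepath 0 r (snd x), fst x))"
      by (rule continuous_on_compose2[OF cont])
         (use circ in \<open>auto intro!: continuous_intros simp: circlepath\<close>)
    then show "continuous_on (disc \<times> cbox 0 1) (\<lambda>(w, t). f (circlepath 0 r t, w) / circlepath 0 r t ^ m *
        vector_derivative (circlepath 0 r) (at t))"
      using circ(2) unfolding case_prod_unfold vector_derivative_circlepath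
      by (intro continuous_intros) (auto simp: circlepath intro!: continuous_intros)
  qed
  have contA': "continuous_on (path_image (circlepath 0 s)) A"
    by (rule continuous_on_subset[OF contA]) (use s s0 in auto)
  have "((\<lambda>u. A u / (u - w) ^ 1) has_contour_integral 2 * of_real pi * \<i> * A w) (circlepath 0 s)"
    if w: "w \<in> ball 0 s" for w
  proof -
    have nw: "u \<noteq> w" if "u \<in> path_image (circlepath 0 s)" for u
      using that w s0 by auto
    have "continuous_on (path_image (circlepath 0 s)) (\<lambda>u. A u / (u - w))"
      using contA' nw by (intro continuous_intros) auto
    then have "(\<lambda>u. A u / (u - w)) contour_integrable_on circlepath 0 s"
      using s0 by (intro contour_integrable_continuous_circlepath) auto
    moreover have "contour_integral (circlepath 0 s) (\<lambda>u. A u / (u - w)) = 2 * of_real pi * \<i> * A w"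
    proof -
      have "contour_integral (circlepath 0 s) (\<lambda>u. A u / (u - w))
          = contour_integral (circlepath 0 s) (\<lambda>v. contour_integral (circlepath 0 r) (\<lambda>u. f (u, v) / u ^ m / (v - w)))"
      proof (rule contour_integral_cong)
        fix v assume "v \<in> path_image (circlepath 0 s)"
        then have "v \<in> disc" using s s0 by auto
        then have "((\<lambda>u. f (u, v) / u ^ m / (v - w)) has_contour_integral A v / (v - w)) (circlepath 0 r)"
          unfolding A_def by (intro has_contour_integral_div has_contour_integral_integral int)
        then show "A v / (v - w) = contour_integral (circlepath 0 r) (\<lambda>u. f (u, v) / u ^ m / (v - w))"
          by (simp add: contour_integral_unique)
      qed simp
      also have "\<dots> = contour_integral (circlepath 0 r) (\<lambda>u. contour_integral (circlepath 0 s) (\<lambda>v. f (u, v) / u ^ m / (v - w)))"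
      proof (rule contour_integral_swap)
        have "continuous_on (path_image (circlepath 0 s) \<times> path_image (circlepath 0 r)) (\<lambda>p. f (snd p, fst p))"
          by (rule continuous_on_compose2[OF cont]) (use r s s0 in \<open>auto intro!: continuous_intros\<close>)
        then show "continuous_on (path_image (circlepath 0 s) \<times> path_image (circlepath 0 r))
            (\<lambda>(v, u). f (u, v) / u ^ m / (v - w))"
          unfolding case_prod_unfold using nw r by (intro continuous_intros) auto
      qed (auto simp: vector_derivative_circlepath intro!: continuous_intros)
      also have "\<dots> = contour_integral (circlepath 0 r) (\<lambda>u. 2 * of_real pi * \<i> * (f (u, w) / u ^ m))"
      proof (rule contour_integral_cong)
        fix u assume "u \<in> path_image (circlepath 0 r)"
        then have u: "u \<in> disc" using r by auto
        have "((\<lambda>v. f (u, v) / (v - w)) has_contour_integral 2 * of_real pi * \<i> * f (u, w)) (circlepath 0 s)"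
          by (rule Cauchy_integral_circlepath_simple[OF holomorphic_on_subset[OF hol[OF u]]])
             (use s w in auto)
        then have "((\<lambda>v. f (u, v) / (v - w) / u ^ m) has_contour_integral 2 * of_real pi * \<i> * f (u, w) / u ^ m) (circlepath 0 s)"
          by (rule has_contour_integral_div)
        then show "contour_integral (circlepath 0 s) (\<lambda>v. f (u, v) / u ^ m / (v - w)) = 2 * of_real pi * \<i> * (f (u, w) / u ^ m)"
          by (simp add: contour_integral_unique field_simps)
      qed simp
      also have "\<dots> = 2 * of_real pi * \<i> * A w"
        unfolding A_def
        by (rule contour_integral_unique, rule has_contour_integral_lmul, rule has_contour_integral_integral,
            rule int)
          (use w s in auto)
      finally show ?thesis .
    qed
    ultimately show ?thesis using has_contour_integral_integral by fastforce
  qed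
  from Cauchy_next_derivative_circlepath(2)[OF contA' this, of w0]
  obtain D where "((\<lambda>w. 2 * of_real pi * \<i> * A w) has_field_derivative D) (at w0)" using s by auto
  then have "((\<lambda>w. 2 * of_real pi * \<i> * A w / (2 * of_real pi * \<i>)) has_field_derivative D / (2 * of_real pi * \<i>)) (at w0)"
    by (rule DERIV_cdivide)
  then have "A field_differentiable at w0"
    by (auto simp: field_differentiable_def)
  then show "(\<lambda>w. contour_integral (circlepath 0 r) (\<lambda>u. f (u, w) / u ^ m)) field_differentiable at w0 within disc"
    unfolding A_def[symmetric] by (rule field_differentiable_at_within)
qed

lemma geometric_double_summable_on:
  fixes x y :: real
  assumes "0 \<le> x" "x < 1" "0 \<le> y" "y < 1"
  shows "(\<lambda>(m, n). x ^ m * y ^ n) summable_on UNIV"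
proof -
  have g: "((\<lambda>n. t ^ n) has_sum (1 / (1 - t))) UNIV" if "0 \<le> t" "t < 1" for t :: real
    by (rule sums_nonneg_imp_has_sum) (use geometric_sums[of t] that in auto)
  have "(\<lambda>(m, n). x ^ m * y ^ n) summable_on UNIV \<times> UNIV"
  proof (rule summable_on_SigmaI)
    show "((\<lambda>n. (\<lambda>(m, n). x ^ m * y ^ n) (m, n)) has_sum x ^ m * (1 / (1 - y))) UNIV" for m
      using has_sum_cmult_right[OF g[OF assms(3,4)], of "x ^ m"] by simp
    show "(\<lambda>m. x ^ m * (1 / (1 - y))) summable_on UNIV"
      using has_sum_cmult_left[OF g[OF assms(1,2)]] has_sum_imp_summable by blast
  qed (use assms in auto)
  then show ?thesis by simp
qed

text \<open>
  Expand \<open>f(\<cdot>, w)\<close> in \<open>z\<close> and then each Taylor coefficient, a holomorphic function of \<open>w\<close>, in \<open>w\<close>.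
  Two Cauchy estimates on a compact bidisc of radii \<open>r\<close> and \<open>s\<close> give \<open>|a\<^sub>m\<^sub>n| \<le> B / (r\<^sup>m s\<^sup>n)\<close>, so the
  iterated sum is an unconditional double sum.
\<close>

lemma holomorphic2_imp_pseries2:
  assumes f: "f holomorphic2_on bidisc"
  obtains a where "pseries2 a f"
proof -
  have cont: "continuous_on bidisc f" by (rule holomorphic2_continuous_on[OF f])
  define A where "A m w = (deriv ^^ m) (\<lambda>z. f (z, w)) 0 / fact m" for m w
  have holA: "A m holomorphic_on disc" for m
  proof -
    have "(\<lambda>w. contour_integral (circlepath 0 (1/2)) (\<lambda>u. f (u, w) / u ^ Suc m)
        * (fact m / (2 * pi * \<i>)) / fact m) holomorphic_on disc"
    proof (intro holomorphic_on_divide holomorphic_on_mult holomorphic_on_const)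
      show "(\<lambda>w. contour_integral (circlepath 0 (1/2)) (\<lambda>u. f (u, w) / u ^ Suc m)) holomorphic_on disc"
        by (rule Cauchy_coefficient_holomorphic[OF cont holomorphic2_slice_w[OF f]]) auto
    qed auto
    moreover have "contour_integral (circlepath 0 (1/2)) (\<lambda>u. f (u, w) / u ^ Suc m)
        * (fact m / (2 * pi * \<i>)) / fact m = A m w" if "w \<in> disc" for w
    proof -
      have h: "(\<lambda>z. f (z, w)) holomorphic_on cball 0 (1/2)"
        by (rule holomorphic_on_subset[OF holomorphic2_slice_z[OF f that]]) auto
      have "((\<lambda>u. f (u, w) / (u - 0) ^ Suc m) has_contour_integral
          (2 * pi * \<i>) / fact m * (deriv ^^ m) (\<lambda>z. f (z, w)) 0) (circlepath 0 (1/2))"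
        by (rule Cauchy_has_contour_integral_higher_derivative_circlepath)
           (simp_all add: holomorphic_on_imp_continuous_on[OF h] holomorphic_on_subset[OF h])
      then show ?thesis by (simp add: contour_integral_unique A_def)
    qed
    ultimately show ?thesis by (rule holomorphic_transform)
  qed
  define a where "a = (\<lambda>(m, n). (deriv ^^ n) (A m) 0 / fact n)"
  have A1: "pseries1 (\<lambda>m. A m w) (\<lambda>z. f (z, w))" if "w \<in> disc" for w
    using pseries1_exists[OF holomorphic2_slice_z[OF f that]] by (simp add: A_def)
  have A2: "pseries1 (\<lambda>n. a (m, n)) (A m)" for m
    using pseries1_exists[OF holA] by (simp add: a_def)
  have bound: "\<exists>B. \<forall>m n. cmod (a (m, n)) \<le> B / r ^ m / s ^ n" if "0 < r" "r < 1" "0 < s" "s < 1" for r s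
  proof -
    have "compact (f ` (cball 0 r \<times> cball 0 s))"
      by (intro compact_continuous_image compact_Times compact_cball continuous_on_subset[OF cont])
         (use that in auto)
    then have "bounded (f ` (cball 0 r \<times> cball 0 s))" by (rule compact_imp_bounded)
    then obtain B where "\<forall>y\<in>f ` (cball 0 r \<times> cball 0 s). cmod y \<le> B"
      unfolding bounded_iff ..
    then have B: "cmod (f x) \<le> B" if "x \<in> cball 0 r \<times> cball 0 s" for x
      using that by blast
    have b1: "cmod (A m w) \<le> B / r ^ m" if w: "w \<in> cball 0 s" for m w
    proof -
      have wd: "w \<in> disc" using w \<open>s < 1\<close> by auto
      have h: "(\<lambda>z. f (z, w)) holomorphic_on cball 0 r"
        by (rule holomorphic_on_subset[OF holomorphic2_slice_z[OF f wd]]) (use that \<open>r < 1\<close> in auto)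
      have "cmod ((deriv ^^ m) (\<lambda>z. f (z, w)) 0) \<le> fact m * B / r ^ m"
        by (rule Cauchy_inequality)
           (use B w \<open>0 < r\<close> in \<open>simp_all add: holomorphic_on_imp_continuous_on[OF h] holomorphic_on_subset[OF h]\<close>)
      then show ?thesis by (simp add: A_def norm_divide field_simps)
    qed
    have "cmod (a (m, n)) \<le> B / r ^ m / s ^ n" for m n
    proof -
      have h: "A m holomorphic_on cball 0 s"
        by (rule holomorphic_on_subset[OF holA]) (use \<open>s < 1\<close> in auto)
      have "cmod ((deriv ^^ n) (A m) 0) \<le> fact n * (B / r ^ m) / s ^ n"
        by (rule Cauchy_inequality)
           (use b1 \<open>0 < s\<close> in \<open>simp_all add: holomorphic_on_imp_continuous_on[OF h] holomorphic_on_subset[OF h]\<close>)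
      then show ?thesis by (simp add: a_def norm_divide field_simps)
    qed
    then show ?thesis by blast
  qed
  have "pseries2 a f"
    unfolding pseries2_def
  proof clarify
    fix z w :: complex assume zw: "z \<in> disc" "w \<in> disc"
    obtain r where r: "cmod z < r" "r < 1" using zw dense[of "cmod z" 1] by auto
    obtain s where s: "cmod w < s" "s < 1" using zw dense[of "cmod w" 1] by auto
    have r0: "r > 0" and s0: "s > 0" using r(1) s(1) norm_ge_zero le_less_trans by blast+
    obtain B where B: "\<And>m n. cmod (a (m, n)) \<le> B / r ^ m / s ^ n" using bound[OF r0 r(2) s0 s(2)] by blast
    have "(\<lambda>(m, n). (cmod z / r) ^ m * (cmod w / s) ^ n) summable_on UNIV"
      by (rule geometric_double_summable_on) (use r s r0 s0 in auto)
    then have "(\<lambda>x. B * (\<lambda>(m, n). (cmod z / r) ^ m * (cmod w / s) ^ n) x) summable_on UNIV"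
      by (rule summable_on_cmult_right)
    then have "(\<lambda>x. norm ((\<lambda>(m, n). a (m, n) * z ^ m * w ^ n) x)) summable_on UNIV"
    proof (rule Infinite_Sum.abs_summable_on_comparison_test')
      fix x :: "nat \<times> nat" obtain m n where x: "x = (m, n)" by force
      have "cmod (a (m, n)) * (cmod z ^ m * cmod w ^ n) \<le> B / r ^ m / s ^ n * (cmod z ^ m * cmod w ^ n)"
        by (intro mult_right_mono B) auto
      then show "norm ((\<lambda>(m, n). a (m, n) * z ^ m * w ^ n) x) \<le> B * (\<lambda>(m, n). (cmod z / r) ^ m * (cmod w / s) ^ n) x"
        by (simp add: x norm_mult norm_power power_divide ac_simps)
    qed
    then have "(\<lambda>(m, n). a (m, n) * z ^ m * w ^ n) summable_on UNIV" by (rule abs_summable_summable)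
    then obtain S where S: "((\<lambda>(m, n). a (m, n) * z ^ m * w ^ n) has_sum S) UNIV" using summable_on_def by blast
    have "((\<lambda>m. A m w * z ^ m) has_sum S) UNIV"
    proof (rule has_sum_SigmaD)
      show "((\<lambda>(m, n). a (m, n) * z ^ m * w ^ n) has_sum S) (UNIV \<times> UNIV)" using S by simp
      fix m
      have "((\<lambda>n. a (m, n) * w ^ n) has_sum A m w) UNIV"
        by (rule norm_summable_imp_has_sum[OF pseries1_abs_summable[OF A2] pseries1_sums[OF A2]])
           (use zw in auto)
      from has_sum_cmult_left[OF this, of "z ^ m"]
      show "((\<lambda>n. (\<lambda>(m, n). a (m, n) * z ^ m * w ^ n) (m, n)) has_sum A m w * z ^ m) UNIV"
        by (simp add: ac_simps)
    qed
    then have "(\<lambda>m. A m w * z ^ m) sums S" by (rule has_sum_imp_sums)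
    then have "S = f (z, w)" using sums_unique2 pseries1_sums[OF A1[OF zw(2)], of z] zw by auto
    then show "((\<lambda>(m, n). a (m, n) * z ^ m * w ^ n) has_sum f (z, w)) UNIV" using S by simp
  qed
  then show ?thesis by (rule that)
qed

section \<open>Area measure on the disc\<close>

lemma space_area_disc [simp]: "space area_disc = disc"
  by (simp add: area_disc_def space_restrict_space)

lemma measurable_area_disc: "f \<in> measurable borel N \<Longrightarrow> f \<in> measurable area_disc N"
  unfolding area_disc_def by (intro measurable_restrict_space1) simp

lemma nn_integral_area_disc:
  "(\<integral>\<^sup>+z. f z \<partial>area_disc) = (\<integral>\<^sup>+z. f z * indicator disc z \<partial>lborel)"
  unfolding area_disc_def by (subst nn_integral_restrict_space) auto

lemma emeasure_lborel_ball_complex: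
  "0 \<le> r \<Longrightarrow> emeasure lborel (ball (0 :: complex) r) = ennreal (pi * r\<^sup>2)"
  "0 \<le> r \<Longrightarrow> emeasure lborel (cball (0 :: complex) r) = ennreal (pi * r\<^sup>2)"
  by (simp_all add: emeasure_ball emeasure_cball eval_unit_ball_vol)

lemma finite_measure_area_disc: "finite_measure area_disc"
proof
  have "emeasure area_disc disc = emeasure lborel disc"
    unfolding area_disc_def by (intro emeasure_restrict_space) auto
  then show "emeasure area_disc (space area_disc) \<noteq> \<infinity>"
    by (simp add: emeasure_lborel_ball_complex)
qed

interpretation area_disc: finite_measure area_disc by (rule finite_measure_area_disc)

interpretation area_pair: pair_sigma_finite area_disc area_disc ..

lemma borel_measurable_Complex [measurable (raw)]:
  fixes f g :: "'a \<Rightarrow> real"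
  assumes [measurable]: "f \<in> borel_measurable M" "g \<in> borel_measurable M"
  shows "(\<lambda>x. Complex (f x) (g x)) \<in> borel_measurable M"
  unfolding Complex_eq by measurable

lemma lborel_complex:
  "(lborel :: complex measure) = distr (lborel \<Otimes>\<^sub>M lborel) borel (\<lambda>(x, y). Complex x y)"
proof (rule lborel_eqI)
  fix l u :: complex assume lu: "\<And>b. b \<in> Basis \<Longrightarrow> l \<bullet> b \<le> u \<bullet> b"
  have le: "Re l \<le> Re u" "Im l \<le> Im u" using lu[of 1] lu[of \<i>] by (auto simp: Basis_complex_def)
  have m: "(\<lambda>(x, y). Complex x y) \<in> borel_measurable (lborel \<Otimes>\<^sub>M lborel)"
    by measurable
  have "emeasure (distr (lborel \<Otimes>\<^sub>M lborel) borel (\<lambda>(x, y). Complex x y)) (box l u)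
      = emeasure (lborel \<Otimes>\<^sub>M lborel) ({Re l<..<Re u} \<times> {Im l<..<Im u})"
    by (subst emeasure_distr[OF m]) (auto intro!: arg_cong[where f = "emeasure _"] simp: in_box_complex_iff space_pair_measure)
  also have "\<dots> = ennreal (Re u - Re l) * ennreal (Im u - Im l)"
    using le by (simp add: lborel.emeasure_pair_measure_Times)
  also have "\<dots> = ennreal (\<Prod>b\<in>Basis. (u - l) \<bullet> b)"
    using le by (simp add: Basis_complex_def ennreal_mult)
  finally show "emeasure (distr (lborel \<Otimes>\<^sub>M lborel) borel (\<lambda>(x, y). Complex x y)) (box l u)
      = ennreal (\<Prod>b\<in>Basis. (u - l) \<bullet> b)" .
qed simp

lemma nn_integral_lborel_complex:
  assumes h: "h \<in> borel_measurable (borel :: complex measure)"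
  shows "(\<integral>\<^sup>+z. h z \<partial>lborel) = (\<integral>\<^sup>+x. \<integral>\<^sup>+y. h (Complex x y) \<partial>lborel \<partial>lborel)"
    and "(\<integral>\<^sup>+z. h z \<partial>lborel) = (\<integral>\<^sup>+y. \<integral>\<^sup>+x. h (Complex x y) \<partial>lborel \<partial>lborel)"
proof -
  have m: "(\<lambda>(x, y). Complex x y) \<in> borel_measurable (lborel \<Otimes>\<^sub>M lborel)"
    by measurable
  have mh: "(\<lambda>(x, y). h (Complex x y)) \<in> borel_measurable (lborel \<Otimes>\<^sub>M lborel)"
    using measurable_comp[OF m h] by (simp add: o_def case_prod_unfold)
  have "(\<integral>\<^sup>+z. h z \<partial>lborel) = (\<integral>\<^sup>+p. (\<lambda>(x, y). h (Complex x y)) p \<partial>(lborel \<Otimes>\<^sub>M lborel))"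
    by (subst lborel_complex, subst nn_integral_distr[OF m]) (simp_all add: h case_prod_unfold)
  also have "\<dots> = (\<integral>\<^sup>+x. \<integral>\<^sup>+y. h (Complex x y) \<partial>lborel \<partial>lborel)"
    using lborel.nn_integral_fst[OF mh] by simp
  finally show 1: "(\<integral>\<^sup>+z. h z \<partial>lborel) = (\<integral>\<^sup>+x. \<integral>\<^sup>+y. h (Complex x y) \<partial>lborel \<partial>lborel)" .
  show "(\<integral>\<^sup>+z. h z \<partial>lborel) = (\<integral>\<^sup>+y. \<integral>\<^sup>+x. h (Complex x y) \<partial>lborel \<partial>lborel)"
    unfolding 1 by (rule lborel_pair.Fubini'[symmetric, OF mh])
qed

lemma nn_integral_shear_Re:
  assumes h: "h \<in> borel_measurable (borel :: complex measure)"
  shows "(\<integral>\<^sup>+z. h (z + of_real (t * Im z)) \<partial>lborel) = (\<integral>\<^sup>+z. h z \<partial>lborel)"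
proof -
  have "(\<integral>\<^sup>+z. h (z + of_real (t * Im z)) \<partial>lborel)
      = (\<integral>\<^sup>+y. \<integral>\<^sup>+x. h (Complex x y + of_real (t * Im (Complex x y))) \<partial>lborel \<partial>lborel)"
    by (rule nn_integral_lborel_complex(2)) (use h in measurable)
  also have "\<dots> = (\<integral>\<^sup>+y. \<integral>\<^sup>+x. h (Complex (t * y + 1 * x) y) \<partial>lborel \<partial>lborel)"
    by (intro nn_integral_cong arg_cong[where f = h]) (simp add: complex_eq_iff)
  also have "\<dots> = (\<integral>\<^sup>+y. \<integral>\<^sup>+x. h (Complex x y) \<partial>lborel \<partial>lborel)"
  proof (rule nn_integral_cong)
    fix y :: real
    have "(\<lambda>x. h (Complex x y)) \<in> borel_measurable borel"
      using h by measurable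
    from nn_integral_real_affine[OF this, of 1 "t * y"]
    show "(\<integral>\<^sup>+x. h (Complex (t * y + 1 * x) y) \<partial>lborel) = (\<integral>\<^sup>+x. h (Complex x y) \<partial>lborel)" by simp
  qed
  also have "\<dots> = (\<integral>\<^sup>+z. h z \<partial>lborel)" by (rule nn_integral_lborel_complex(2)[OF h, symmetric])
  finally show ?thesis .
qed

lemma nn_integral_shear_Im:
  assumes h: "h \<in> borel_measurable (borel :: complex measure)"
  shows "(\<integral>\<^sup>+z. h (z + \<i> * of_real (t * Re z)) \<partial>lborel) = (\<integral>\<^sup>+z. h z \<partial>lborel)"
proof -
  have "(\<integral>\<^sup>+z. h (z + \<i> * of_real (t * Re z)) \<partial>lborel)
      = (\<integral>\<^sup>+x. \<integral>\<^sup>+y. h (Complex x y + \<i> * of_real (t * Re (Complex x y))) \<partial>lborel \<partial>lborel)"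
    by (rule nn_integral_lborel_complex(1)) (use h in measurable)
  also have "\<dots> = (\<integral>\<^sup>+x. \<integral>\<^sup>+y. h (Complex x (t * x + 1 * y)) \<partial>lborel \<partial>lborel)"
    by (intro nn_integral_cong arg_cong[where f = h]) (simp add: complex_eq_iff)
  also have "\<dots> = (\<integral>\<^sup>+x. \<integral>\<^sup>+y. h (Complex x y) \<partial>lborel \<partial>lborel)"
  proof (rule nn_integral_cong)
    fix x :: real
    have "(\<lambda>y. h (Complex x y)) \<in> borel_measurable borel"
      using h by measurable
    from nn_integral_real_affine[OF this, of 1 "t * x"]
    show "(\<integral>\<^sup>+y. h (Complex x (t * x + 1 * y)) \<partial>lborel) = (\<integral>\<^sup>+y. h (Complex x y) \<partial>lborel)" by simp
  qed
  also have "\<dots> = (\<integral>\<^sup>+z. h z \<partial>lborel)" by (rule nn_integral_lborel_complex(1)[OF h, symmetric])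
  finally show ?thesis .
qed

text \<open>
  A rotation other than by a half turn is a product of three shears, and a shear preserves area
  because it translates each line parallel to an axis. The half turn is the square of a
  quarter turn.
\<close>

lemma nn_integral_rotate:
  assumes h: "h \<in> borel_measurable (borel :: complex measure)" and u: "cmod u = 1"
  shows "(\<integral>\<^sup>+z. h (u * z) \<partial>lborel) = (\<integral>\<^sup>+z. h z \<partial>lborel)"
proof -
  have *: "(\<integral>\<^sup>+z. h (u * z) \<partial>lborel) = (\<integral>\<^sup>+z. h z \<partial>lborel)"
    if h: "h \<in> borel_measurable borel" and u: "cmod u = 1" and n: "Re u \<noteq> -1" for h u
  proof -
    define s where "s = Im u"
    \<comment> \<open>The factorisation is \<open>A \<circ> B \<circ> A\<close> with slopes \<open>t = - tan (\<theta> / 2)\<close> and \<open>s = sin \<theta>\<close> for \<open>u = e\<^sup>i\<^sup>\<theta>\<close>.\<close>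
    define t where "t = - s / (1 + Re u)"
    have n': "1 + Re u \<noteq> 0" using n by (auto simp: add_eq_0_iff)
    have "(Re u)\<^sup>2 + s\<^sup>2 = 1" using u unfolding s_def cmod_def by (simp add: real_sqrt_eq_1_iff)
    then have s2: "s * s = (1 - Re u) * (1 + Re u)" by (simp add: algebra_simps power2_eq_square)
    have ts: "1 + t * s = Re u" using n' s2 by (simp add: t_def field_simps)
    have tt: "t * (1 + Re u) = - s" using n' by (simp add: t_def)
    define A where "A z = z + complex_of_real (t * Im z)" for z
    define B where "B z = z + \<i> * complex_of_real (s * Re z)" for z
    have mA: "A \<in> borel_measurable borel" and mB: "B \<in> borel_measurable borel"
      unfolding A_def B_def by measurable
    have uz: "u * z = A (B (A z))" for z
    proof (rule complex_eqI)
      have "Re (A (B (A z))) = Re z * (1 + t * s) + (t * (1 + t * s) + t) * Im z"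
        by (simp add: A_def B_def algebra_simps)
      also have "\<dots> = Re z * Re u + (t * (1 + Re u)) * Im z" unfolding ts by (simp add: algebra_simps)
      also have "\<dots> = Re (u * z)" unfolding tt s_def by simp
      finally show "Re (u * z) = Re (A (B (A z)))" ..
      have "Im (A (B (A z))) = s * Re z + (1 + t * s) * Im z"
        by (simp add: A_def B_def algebra_simps)
      then show "Im (u * z) = Im (A (B (A z)))" unfolding ts by (simp add: s_def)
    qed
    have "(\<integral>\<^sup>+z. h (u * z) \<partial>lborel) = (\<integral>\<^sup>+z. (\<lambda>z. h (A (B z))) (A z) \<partial>lborel)" by (simp add: uz)
    also have "\<dots> = (\<integral>\<^sup>+z. (\<lambda>z. h (A z)) (B z) \<partial>lborel)"
      unfolding A_def[of z for z]
      by (rule nn_integral_shear_Re) (use h mB in measurable)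
    also have "\<dots> = (\<integral>\<^sup>+z. h (A z) \<partial>lborel)"
      unfolding B_def by (rule nn_integral_shear_Im) (use h mA in measurable)
    also have "\<dots> = (\<integral>\<^sup>+z. h z \<partial>lborel)"
      unfolding A_def by (rule nn_integral_shear_Re[OF h])
    finally show ?thesis .
  qed
  show ?thesis
  proof (cases "Re u = -1")
    case False then show ?thesis using *[OF h u] by simp
  next
    case True
    have "(Re u)\<^sup>2 + (Im u)\<^sup>2 = 1" using u unfolding cmod_def by (simp add: real_sqrt_eq_1_iff)
    have m: "(\<lambda>z. h (\<i> * z)) \<in> borel_measurable borel" using h by measurable
    have "u = \<i> * \<i>" using \<open>(Re u)\<^sup>2 + (Im u)\<^sup>2 = 1\<close> True by (simp add: complex_eq_iff)
    then have "(\<integral>\<^sup>+z. h (u * z) \<partial>lborel) = (\<integral>\<^sup>+z. (\<lambda>z. h (\<i> * z)) (\<i> * z) \<partial>lborel)" by (simp add: mult.assoc)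
    also have "\<dots> = (\<integral>\<^sup>+z. h (\<i> * z) \<partial>lborel)" by (rule *) (use m in auto)
    also have "\<dots> = (\<integral>\<^sup>+z. h z \<partial>lborel)" by (rule *) (use h in auto)
    finally show ?thesis .
  qed
qed

lemma nn_integral_area_disc_rotate:
  assumes h: "h \<in> borel_measurable (borel :: complex measure)" and u: "cmod u = 1"
  shows "(\<integral>\<^sup>+z. h (u * z) \<partial>area_disc) = (\<integral>\<^sup>+z. h z \<partial>area_disc)"
proof -
  have "(\<integral>\<^sup>+z. h (u * z) \<partial>area_disc) = (\<integral>\<^sup>+z. (\<lambda>z. h z * indicator disc z) (u * z) \<partial>lborel)"
    unfolding nn_integral_area_disc using u
    by (intro nn_integral_cong) (auto simp: norm_mult split: split_indicator)
  also have "\<dots> = (\<integral>\<^sup>+z. h z * indicator disc z \<partial>lborel)"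
    by (rule nn_integral_rotate[OF _ u]) (intro borel_measurable_times_ennreal h borel_measurable_indicator, simp)
  finally show ?thesis by (simp add: nn_integral_area_disc)
qed

text \<open>
  The disc of radius \<open>r\<close> has area \<open>\<pi> r\<^sup>2\<close>; hence under area measure \<open>|z|\<^sup>2\<close> is uniformly distributed
  on the unit interval, up to the factor \<open>\<pi>\<close>. This takes the place of polar coordinates.
\<close>

lemma distr_area_disc_norm_square:
  "distr area_disc borel (\<lambda>z. (cmod z)\<^sup>2) = density lborel (\<lambda>t. ennreal (pi * indicator {0..1} t))"
    (is "?L = ?R")
proof (rule measure_eqI_lessThan)
  have m: "(\<lambda>z. (cmod z)\<^sup>2) \<in> borel_measurable area_disc"
    by (rule measurable_area_disc) measurable
  have L: "emeasure ?L {x<..} = emeasure lborel {z \<in> disc. x < (cmod z)\<^sup>2}" for x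
  proof -
    have "emeasure ?L {x<..} = emeasure area_disc {z \<in> disc. x < (cmod z)\<^sup>2}"
      using m by (subst emeasure_distr) (auto intro!: arg_cong[where f = "emeasure _"])
    also have "\<dots> = emeasure lborel {z \<in> disc. x < (cmod z)\<^sup>2}"
      unfolding area_disc_def by (rule emeasure_restrict_space) auto
    finally show ?thesis .
  qed
  have R: "emeasure ?R {x<..} = ennreal (if x < 0 then pi else if x \<le> 1 then pi * (1 - x) else 0)" for x
  proof -
    have "emeasure ?R {x<..} = (\<integral>\<^sup>+t. ennreal pi * indicator ({0..1} \<inter> {x<..}) t \<partial>lborel)"
      by (subst emeasure_density) (auto intro!: nn_integral_cong split: split_indicator)
    also have "\<dots> = ennreal pi * emeasure lborel ({0..1} \<inter> {x<..})"
      by (subst nn_integral_cmult) auto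
    also have "{0..1} \<inter> {x<..} = (if x < 0 then {0..1} else if x \<le> 1 then {x<..1} else {})" by auto
    also have "ennreal pi * emeasure lborel (if x < 0 then {0..1} else if x \<le> 1 then {x<..1} else {})
        = ennreal (if x < 0 then pi else if x \<le> 1 then pi * (1 - x) else 0)"
      by (auto simp: ennreal_mult)
    finally show ?thesis .
  qed
  fix x :: real
  show eq: "emeasure ?L {x<..} = emeasure ?R {x<..}"
  proof -
    consider "x < 0" | "0 \<le> x" "x < 1" | "x \<ge> 1" by linarith
    then show ?thesis
    proof cases
      case 1
      then have "x < (cmod z)\<^sup>2" for z using zero_le_power2[of "cmod z"] by linarith
      then have "{z \<in> disc. x < (cmod z)\<^sup>2} = disc" by auto
      then show ?thesis unfolding L R using 1 by (simp add: emeasure_lborel_ball_complex)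
    next
      case 2
      have "x < (cmod z)\<^sup>2 \<longleftrightarrow> sqrt x < cmod z" for z
        using real_sqrt_less_iff[of x "(cmod z)\<^sup>2"] by simp
      then have "{z \<in> disc. x < (cmod z)\<^sup>2} = {z \<in> disc. sqrt x < cmod z}" by simp
      also have "\<dots> = disc - cball 0 (sqrt x)" by auto
      also have "emeasure lborel \<dots> = emeasure lborel disc - emeasure lborel (cball (0 :: complex) (sqrt x))"
      proof (rule emeasure_Diff)
        have "sqrt x < 1" using 2 by simp
        then show "cball (0 :: complex) (sqrt x) \<subseteq> disc" by (simp add: cball_subset_ball_iff)
      qed (use 2 in \<open>auto simp: emeasure_lborel_ball_complex\<close>)
      also have "\<dots> = ennreal (pi * (1 - x))"
        using 2 by (simp add: emeasure_lborel_ball_complex ennreal_minus right_diff_distrib)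
      finally show ?thesis unfolding L R using 2 by (simp del: mem_ball)
    next
      case 3
      have "(cmod z)\<^sup>2 \<le> 1" if "z \<in> disc" for z
        using that by (intro power_le_one) auto
      then have "\<not> x < (cmod z)\<^sup>2" if "z \<in> disc" for z
        using 3 that by (meson order.trans not_less)
      then have e: "{z \<in> disc. x < (cmod z)\<^sup>2} = {}" by blast
      show ?thesis unfolding L R e using 3 by (cases "x = 1") auto
    qed
  qed
  show "emeasure ?L {x<..} < \<infinity>" unfolding eq R by simp
qed simp_all

lemma nn_integral_area_disc_power:
  "(\<integral>\<^sup>+z. ennreal (cmod z ^ (2 * n)) \<partial>area_disc) = ennreal (pi / (real n + 1))"
proof -
  have m: "(\<lambda>z. (cmod z)\<^sup>2) \<in> borel_measurable area_disc"
    by (rule measurable_area_disc) measurable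
  have "(\<integral>\<^sup>+z. ennreal (cmod z ^ (2 * n)) \<partial>area_disc) = (\<integral>\<^sup>+t. ennreal (t ^ n) \<partial>distr area_disc borel (\<lambda>z. (cmod z)\<^sup>2))"
    unfolding power_mult by (rule nn_integral_distr[symmetric, OF m]) measurable
  also have "\<dots> = (\<integral>\<^sup>+t. ennreal (pi * t ^ n) * indicator {0..1} t \<partial>lborel)"
    unfolding distr_area_disc_norm_square
    by (subst nn_integral_density) (auto intro!: nn_integral_cong split: split_indicator simp: ennreal_mult)
  also have "\<dots> = ennreal (pi * 1 ^ Suc n / (real n + 1) - pi * 0 ^ Suc n / (real n + 1))"
  proof (rule nn_integral_FTC_Icc[where F = "\<lambda>t. pi * t ^ Suc n / (real n + 1)"])
    fix t :: real
    have "((\<lambda>t. pi * t ^ Suc n / (real n + 1)) has_real_derivative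
        pi * (real (Suc n) * t ^ n) / (real n + 1)) (at t)"
      using DERIV_cdivide[OF DERIV_cmult[OF DERIV_pow[of "Suc n" t]], of pi "real n + 1" UNIV]
      by (simp only: diff_Suc_1 One_nat_def[symmetric])
    moreover have "pi * (real (Suc n) * t ^ n) / (real n + 1) = pi * t ^ n" by (simp del: of_nat_Suc add: of_nat_Suc[symmetric] add.commute)
    ultimately show "((\<lambda>t. pi * t ^ Suc n / (real n + 1)) has_real_derivative pi * t ^ n) (at t)"
      by simp
  qed auto
  finally show ?thesis by simp
qed

section \<open>Parseval for area measure on the disc\<close>

lemma sum_roots_of_unity_power:
  assumes N: "N > 0" and mn: "m < N" "n < N" and u: "u = cis (2 * pi / real N)"
  shows "(\<Sum>k<N. (u ^ k) ^ m * cnj ((u ^ k) ^ n)) = (if m = n then of_nat N else 0)"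
proof -
  define x where "x = cis (2 * pi * (real m - real n) / real N)"
  have "u ^ m * cnj u ^ n = x"
    unfolding u x_def cis_cnj Complex.DeMoivre cis_mult
    by (rule arg_cong[where f = cis]) (simp add: diff_divide_distrib algebra_simps)
  moreover have "(u ^ k) ^ m * cnj ((u ^ k) ^ n) = (u ^ m * cnj u ^ n) ^ k" for k
    unfolding complex_cnj_power power_mult_distrib power_mult[symmetric] by (simp only: mult.commute)
  ultimately have eq: "(u ^ k) ^ m * cnj ((u ^ k) ^ n) = x ^ k" for k
    by simp
  show ?thesis
  proof (cases "m = n")
    case True
    then show ?thesis unfolding eq by (simp add: x_def)
  next
    case False
    have "x ^ N = cis (2 * pi * (real m - real n))"
      unfolding x_def Complex.DeMoivre using N by simp
    also have "real m - real n = of_int (int m - int n)" by simp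
    also have "cis (2 * pi * of_int (int m - int n)) = 1"
      by (simp add: cis_multiple_2pi Ints_of_int del: of_int_diff)
    finally have xN: "x ^ N = 1" .
    have "x \<noteq> 1"
    proof
      assume "x = 1"
      then have "cos (2 * pi * (real m - real n) / real N) = 1"
        by (metis x_def Re_complex_of_real cis.simps(1) of_real_1)
      then obtain j :: int where "2 * pi * (real m - real n) / real N = real_of_int j * 2 * pi"
        using cos_one_2pi_int by blast
      then have "pi * (real m * 2) = pi * (real n * 2 + real_of_int j * (real N * 2))"
        using N by (simp add: field_simps)
      then have "real m - real n = real_of_int j * real N"
        unfolding mult_cancel_left by simp
      then have "int m - int n = j * int N"
        by (metis (mono_tags, lifting) of_int_diff of_int_eq_iff of_int_mult of_int_of_nat_eq)
      moreover have "\<bar>int m - int n\<bar> < int N" using mn by linarith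
      ultimately show False using False
        by (metis abs_mult abs_of_nat add_0 diff_add_cancel dvd_imp_le_int dvd_triv_right mult_eq_0_iff not_less of_nat_eq_iff zero_less_abs_iff zle_int)
    qed
    then have "(\<Sum>k<N. x ^ k) = 0" using xN by (simp add: sum_gp_strict)
    then show ?thesis unfolding eq using False by simp
  qed
qed

text \<open>
  The average over the \<open>N\<close>-th roots of unity annihilates the mixed products of monomials of different
  degrees below \<open>N\<close>, so for a polynomial of degree below \<open>N\<close> it does what the average over a whole
  circle would do.
\<close>

lemma discrete_Parseval:
  assumes N: "N > 0" and u: "u = cis (2 * pi / real N)"
  shows "(\<Sum>k<N. (cmod (\<Sum>n<N. c n * (u ^ k * z) ^ n))\<^sup>2) = real N * (\<Sum>n<N. (cmod (c n))\<^sup>2 * cmod z ^ (2 * n))"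
proof -
  define v where "v n = c n * z ^ n" for n
  have "complex_of_real (\<Sum>k<N. (cmod (\<Sum>n<N. c n * (u ^ k * z) ^ n))\<^sup>2)
      = (\<Sum>k<N. (\<Sum>m<N. v m * (u ^ k) ^ m) * cnj (\<Sum>n<N. v n * (u ^ k) ^ n))"
    by (simp add: complex_norm_square v_def power_mult_distrib ac_simps del: of_real_power cnj_sum)
  also have "\<dots> = (\<Sum>k<N. \<Sum>m<N. \<Sum>n<N. v m * cnj (v n) * ((u ^ k) ^ m * cnj ((u ^ k) ^ n)))"
    by (simp add: sum_product ac_simps)
  also have "\<dots> = (\<Sum>m<N. \<Sum>n<N. \<Sum>k<N. v m * cnj (v n) * ((u ^ k) ^ m * cnj ((u ^ k) ^ n)))"
    by (subst sum.swap, intro sum.cong refl sum.swap)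
  also have "\<dots> = (\<Sum>m<N. \<Sum>n<N. v m * cnj (v n) * (if m = n then of_nat N else 0))"
    by (intro sum.cong refl) (simp add: sum_distrib_left[symmetric] sum_roots_of_unity_power[OF N _ _ u] del: complex_cnj_power)
  also have "\<dots> = (\<Sum>m<N. v m * cnj (v m) * of_nat N)"
    by (intro sum.cong refl) (simp add: if_distrib[of "\<lambda>x. _ * x"] cong: if_cong)
  also have "\<dots> = complex_of_real (real N * (\<Sum>n<N. (cmod (v n))\<^sup>2))"
    by (simp add: complex_norm_square sum_distrib_left ac_simps del: of_real_power)
  finally show ?thesis
    unfolding of_real_eq_iff
    by (simp add: v_def norm_mult norm_power power_mult_distrib power_mult[symmetric] mult.commute)
qed

text \<open>
  By rotation invariance the integrand may be replaced by its average over the rotations by roots of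
  unity.
\<close>

lemma area_Parseval_polynomial:
  "(\<integral>\<^sup>+z. ennreal ((cmod (\<Sum>n<N. c n * z ^ n))\<^sup>2) * indicator (ball 0 r) z \<partial>area_disc)
    = (\<integral>\<^sup>+z. (\<Sum>n<N. ennreal ((cmod (c n))\<^sup>2 * cmod z ^ (2 * n))) * indicator (ball 0 r) z \<partial>area_disc)"
proof (cases "N = 0")
  case False
  define u where "u = cis (2 * pi / real N)"
  define h where "h z = ennreal ((cmod (\<Sum>n<N. c n * z ^ n))\<^sup>2) * indicator (ball 0 r) z" for z
  have [measurable]: "ball (0 :: complex) r \<in> sets borel" by simp
  have h[measurable]: "h \<in> borel_measurable borel"
    unfolding h_def by measurable
  have nu: "cmod (u ^ k) = 1" for k by (simp add: u_def norm_power)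
  have "of_nat N * (\<integral>\<^sup>+z. h z \<partial>area_disc) = (\<Sum>k<N. \<integral>\<^sup>+z. h (u ^ k * z) \<partial>area_disc)"
    by (simp add: nn_integral_area_disc_rotate[OF h nu])
  also have "\<dots> = (\<integral>\<^sup>+z. (\<Sum>k<N. h (u ^ k * z)) \<partial>area_disc)"
    by (intro nn_integral_sum[symmetric] measurable_area_disc) measurable
  also have "\<dots> = (\<integral>\<^sup>+z. of_nat N * ((\<Sum>n<N. ennreal ((cmod (c n))\<^sup>2 * cmod z ^ (2 * n))) * indicator (ball 0 r) z) \<partial>area_disc)"
  proof (rule nn_integral_cong)
    fix z :: complex
    define S where "S = (\<Sum>n<N. (cmod (c n))\<^sup>2 * cmod z ^ (2 * n))"
    have S: "0 \<le> S" "ennreal S = (\<Sum>n<N. ennreal ((cmod (c n))\<^sup>2 * cmod z ^ (2 * n)))"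
      unfolding S_def by (auto intro!: sum_nonneg sum_ennreal[symmetric])
    have "(\<Sum>k<N. h (u ^ k * z)) = ennreal (\<Sum>k<N. (cmod (\<Sum>n<N. c n * (u ^ k * z) ^ n))\<^sup>2) * indicator (ball 0 r) z"
      by (simp add: h_def sum_distrib_right[symmetric] norm_mult nu indicator_def)
    also have "\<dots> = of_nat N * ((\<Sum>n<N. ennreal ((cmod (c n))\<^sup>2 * cmod z ^ (2 * n))) * indicator (ball 0 r) z)"
      using False unfolding S(2)[symmetric]
      by (subst discrete_Parseval[OF _ u_def], simp, unfold S_def[symmetric])
         (simp add: ennreal_mult S(1) mult.assoc ennreal_of_nat_eq_real_of_nat)
    finally show "(\<Sum>k<N. h (u ^ k * z)) = \<dots>" .
  qed
  also have "\<dots> = of_nat N * (\<integral>\<^sup>+z. (\<Sum>n<N. ennreal ((cmod (c n))\<^sup>2 * cmod z ^ (2 * n))) * indicator (ball 0 r) z \<partial>area_disc)"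
    by (rule nn_integral_cmult, rule measurable_area_disc) measurable
  finally show ?thesis
    using False unfolding ennreal_mult_cancel_left by (auto simp: h_def[abs_def])
qed simp

lemma pseries1_measurable:
  assumes "pseries1 c g"
  shows "g \<in> borel_measurable area_disc"
proof (rule borel_measurable_LIMSEQ_metric)
  show "(\<lambda>z. \<Sum>n<N. c n * z ^ n) \<in> borel_measurable area_disc" for N
    by (rule measurable_area_disc) measurable
  show "(\<lambda>N. \<Sum>n<N. c n * z ^ n) \<longlonglongrightarrow> g z" if "z \<in> space area_disc" for z
    using pseries1_sums[OF assms, of z] that by (simp add: sums_def)
qed

text \<open>
  On a smaller disc the partial sums are uniformly bounded, so dominated convergence applies.
\<close>

lemma area_Parseval_ball:
  assumes g: "pseries1 c g" and r: "0 < r" "r < 1"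
  shows "(\<integral>\<^sup>+z. ennreal ((cmod (g z))\<^sup>2) * indicator (ball 0 r) z \<partial>area_disc)
    = (\<integral>\<^sup>+z. (\<Sum>n. ennreal ((cmod (c n))\<^sup>2 * cmod z ^ (2 * n))) * indicator (ball 0 r) z \<partial>area_disc)"
proof -
  note [measurable] = pseries1_measurable[OF g]
  have ind[measurable]: "indicator (ball 0 r) \<in> borel_measurable area_disc"
    by (intro measurable_area_disc borel_measurable_indicator) simp
  have pol[measurable]: "(\<lambda>z. \<Sum>n<N. c n * z ^ n) \<in> borel_measurable area_disc" for N
    by (rule measurable_area_disc) measurable
  have mon[measurable]: "(\<lambda>z. ennreal ((cmod (c n))\<^sup>2 * cmod z ^ (2 * n))) \<in> borel_measurable area_disc" for n
    by (rule measurable_area_disc) measurable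
  define K where "K = (\<Sum>n. norm (c n * of_real r ^ n))"
  have K: "summable (\<lambda>n. norm (c n * of_real r ^ n))"
    by (rule pseries1_abs_summable[OF g]) (use r in simp)
  have bound: "cmod (\<Sum>n<N. c n * z ^ n) \<le> K" if "z \<in> ball 0 r" for N z
  proof -
    have "cmod (\<Sum>n<N. c n * z ^ n) \<le> (\<Sum>n<N. norm (c n * of_real r ^ n))"
      using that r by (intro sum_norm_le) (auto simp: norm_mult norm_power intro!: mult_left_mono power_mono)
    also have "\<dots> \<le> K" unfolding K_def by (intro sum_le_suminf K) auto
    finally show ?thesis .
  qed
  have "(\<lambda>N. \<integral>\<^sup>+z. ennreal ((cmod (\<Sum>n<N. c n * z ^ n))\<^sup>2) * indicator (ball 0 r) z \<partial>area_disc)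
      \<longlonglongrightarrow> (\<integral>\<^sup>+z. ennreal ((cmod (g z))\<^sup>2) * indicator (ball 0 r) z \<partial>area_disc)"
  proof (rule nn_integral_dominated_convergence[where w = "\<lambda>_. ennreal (K\<^sup>2)"])
    show "AE z in area_disc. ennreal ((cmod (\<Sum>n<N. c n * z ^ n))\<^sup>2) * indicator (ball 0 r) z \<le> ennreal (K\<^sup>2)" for N
      using bound by (intro AE_I2) (auto split: split_indicator intro!: ennreal_leI power_mono)
    show "(\<integral>\<^sup>+z. ennreal (K\<^sup>2) \<partial>area_disc) < \<infinity>"
    proof -
      have "emeasure area_disc disc < \<infinity>" by (simp add: less_top[symmetric])
      then show ?thesis by (simp add: ennreal_mult_less_top)
    qed
    show "AE z in area_disc. (\<lambda>N. ennreal ((cmod (\<Sum>n<N. c n * z ^ n))\<^sup>2) * indicator (ball 0 r) z)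
        \<longlonglongrightarrow> ennreal ((cmod (g z))\<^sup>2) * indicator (ball 0 r) z"
    proof (rule AE_I2)
      fix z assume "z \<in> space area_disc"
      then have "(\<lambda>N. \<Sum>n<N. c n * z ^ n) \<longlonglongrightarrow> g z"
        using pseries1_sums[OF g, of z] by (simp add: sums_def)
      then have "(\<lambda>N. ennreal ((cmod (\<Sum>n<N. c n * z ^ n))\<^sup>2)) \<longlonglongrightarrow> ennreal ((cmod (g z))\<^sup>2)"
        by (intro tendsto_ennrealI tendsto_intros)
      then show "(\<lambda>N. ennreal ((cmod (\<Sum>n<N. c n * z ^ n))\<^sup>2) * indicator (ball 0 r) z)
        \<longlonglongrightarrow> ennreal ((cmod (g z))\<^sup>2) * indicator (ball 0 r) z"
        by (simp split: split_indicator)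
    qed
  qed measurable
  moreover have "(\<lambda>N. \<integral>\<^sup>+z. ennreal ((cmod (\<Sum>n<N. c n * z ^ n))\<^sup>2) * indicator (ball 0 r) z \<partial>area_disc)
      \<longlonglongrightarrow> (\<integral>\<^sup>+z. (\<Sum>n. ennreal ((cmod (c n))\<^sup>2 * cmod z ^ (2 * n))) * indicator (ball 0 r) z \<partial>area_disc)"
  proof -
    have "(\<integral>\<^sup>+z. ennreal ((cmod (\<Sum>n<N. c n * z ^ n))\<^sup>2) * indicator (ball 0 r) z \<partial>area_disc)
        = (\<Sum>n<N. \<integral>\<^sup>+z. ennreal ((cmod (c n))\<^sup>2 * cmod z ^ (2 * n)) * indicator (ball 0 r) z \<partial>area_disc)" for N
      unfolding area_Parseval_polynomial sum_distrib_right by (rule nn_integral_sum) measurable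
    moreover have "(\<integral>\<^sup>+z. (\<Sum>n. ennreal ((cmod (c n))\<^sup>2 * cmod z ^ (2 * n))) * indicator (ball 0 r) z \<partial>area_disc)
        = (\<Sum>n. \<integral>\<^sup>+z. ennreal ((cmod (c n))\<^sup>2 * cmod z ^ (2 * n)) * indicator (ball 0 r) z \<partial>area_disc)"
      unfolding ennreal_suminf_multc[symmetric] by (rule nn_integral_suminf) measurable
    ultimately show ?thesis by (simp add: summable_LIMSEQ)
  qed
  ultimately show ?thesis by (rule LIMSEQ_unique)
qed

lemma nn_integral_area_disc_exhaust:
  assumes [measurable]: "h \<in> borel_measurable area_disc"
  shows "(\<integral>\<^sup>+z. h z \<partial>area_disc) = (SUP k. \<integral>\<^sup>+z. h z * indicator (ball 0 (1 - 1 / (real k + 2))) z \<partial>area_disc)"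
proof -
  define R where "R k = 1 - 1 / (real k + 2)" for k
  have R: "R k \<le> R l" if "k \<le> l" for k l
    using that unfolding R_def by (simp add: field_simps)
  have ind[measurable]: "indicator (ball 0 (R k)) \<in> borel_measurable area_disc" for k
    by (intro measurable_area_disc borel_measurable_indicator) simp
  have "(SUP k. h z * indicator (ball 0 (R k)) z) = h z" if z: "z \<in> disc" for z
  proof (rule antisym)
    show "(SUP k. h z * indicator (ball 0 (R k)) z) \<le> h z"
      by (intro SUP_least) (simp split: split_indicator)
    have "R \<longlonglongrightarrow> 1" unfolding R_def by real_asymp
    then have "eventually (\<lambda>k. cmod z < R k) sequentially"
      using z by (intro order_tendstoD) auto
    then obtain k where "cmod z < R k" by (auto simp: eventually_sequentially)
    then show "h z \<le> (SUP k. h z * indicator (ball 0 (R k)) z)"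
      by (intro SUP_upper2[of k]) auto
  qed
  then have "(\<integral>\<^sup>+z. h z \<partial>area_disc) = (\<integral>\<^sup>+z. (SUP k. h z * indicator (ball 0 (R k)) z) \<partial>area_disc)"
    by (intro nn_integral_cong) simp
  also have "\<dots> = (SUP k. \<integral>\<^sup>+z. h z * indicator (ball 0 (R k)) z \<partial>area_disc)"
  proof (rule nn_integral_monotone_convergence_SUP)
    show "incseq (\<lambda>k z. h z * indicator (ball 0 (R k)) z)"
      using R by (intro incseq_SucI le_funI) (auto split: split_indicator intro: less_le_trans)
  qed measurable
  finally show ?thesis by (simp add: R_def)
qed

lemma area_Parseval:
  assumes g: "pseries1 c g"
  shows "(\<integral>\<^sup>+z. ennreal ((cmod (g z))\<^sup>2) \<partial>area_disc) = (\<Sum>n. ennreal (pi * (cmod (c n))\<^sup>2 / (real n + 1)))"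
proof -
  note [measurable] = pseries1_measurable[OF g]
  have mon[measurable]: "(\<lambda>z. ennreal ((cmod (c n))\<^sup>2 * cmod z ^ (2 * n))) \<in> borel_measurable area_disc" for n
    by (rule measurable_area_disc) measurable
  have pow[measurable]: "(\<lambda>z. ennreal (cmod z ^ (2 * n))) \<in> borel_measurable area_disc" for n
    by (rule measurable_area_disc) measurable
  have "(\<integral>\<^sup>+z. ennreal ((cmod (g z))\<^sup>2) \<partial>area_disc)
      = (SUP k. \<integral>\<^sup>+z. ennreal ((cmod (g z))\<^sup>2) * indicator (ball 0 (1 - 1 / (real k + 2))) z \<partial>area_disc)"
    by (rule nn_integral_area_disc_exhaust) measurable
  also have "\<dots> = (SUP k. \<integral>\<^sup>+z. (\<Sum>n. ennreal ((cmod (c n))\<^sup>2 * cmod z ^ (2 * n)))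
      * indicator (ball 0 (1 - 1 / (real k + 2))) z \<partial>area_disc)"
    by (intro SUP_cong refl area_Parseval_ball[OF g]) (simp_all add: field_simps)
  also have "\<dots> = (\<integral>\<^sup>+z. (\<Sum>n. ennreal ((cmod (c n))\<^sup>2 * cmod z ^ (2 * n))) \<partial>area_disc)"
    by (rule nn_integral_area_disc_exhaust[symmetric]) measurable
  also have "\<dots> = (\<Sum>n. \<integral>\<^sup>+z. ennreal ((cmod (c n))\<^sup>2 * cmod z ^ (2 * n)) \<partial>area_disc)"
    by (rule nn_integral_suminf) measurable
  also have "\<dots> = (\<Sum>n. ennreal (pi * (cmod (c n))\<^sup>2 / (real n + 1)))"
  proof (rule suminf_cong)
    fix n
    have "(\<integral>\<^sup>+z. ennreal ((cmod (c n))\<^sup>2 * cmod z ^ (2 * n)) \<partial>area_disc)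
        = (\<integral>\<^sup>+z. ennreal ((cmod (c n))\<^sup>2) * ennreal (cmod z ^ (2 * n)) \<partial>area_disc)"
      by (simp add: ennreal_mult)
    also have "\<dots> = ennreal ((cmod (c n))\<^sup>2) * ennreal (pi / (real n + 1))"
      by (simp add: nn_integral_cmult[OF pow] nn_integral_area_disc_power)
    also have "\<dots> = ennreal (pi * (cmod (c n))\<^sup>2 / (real n + 1))"
      by (simp add: ennreal_mult[symmetric] mult.commute)
    finally show "(\<integral>\<^sup>+z. ennreal ((cmod (c n))\<^sup>2 * cmod z ^ (2 * n)) \<partial>area_disc)
        = ennreal (pi * (cmod (c n))\<^sup>2 / (real n + 1))" .
  qed
  finally show ?thesis .
qed

section \<open>Dirichlet norms and area integrals\<close>

text \<open>
  The squared Dirichlet norms in terms of the coefficients. Values in the extended nonnegative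
  reals allow the estimates below to be stated for all holomorphic functions, whether or not
  they lie in the space.
\<close>

definition dsum1 :: "(nat \<Rightarrow> complex) \<Rightarrow> ennreal" where
  "dsum1 c = (\<Sum>n. ennreal ((real n + 1) * (cmod (c n))\<^sup>2))"

definition dsum2 :: "(nat \<times> nat \<Rightarrow> complex) \<Rightarrow> ennreal" where
  "dsum2 a = (\<Sum>m. \<Sum>n. ennreal ((cmod (a (m, n)))\<^sup>2 * (real m + 1) * (real n + 1)))"

lemma dirichlet1_iff:
  assumes "pseries1 c g"
  shows "g \<in> dirichlet1 \<longleftrightarrow> dsum1 c \<noteq> top"
proof -
  have "summable (\<lambda>n. (real n + 1) * (cmod (c n))\<^sup>2) \<longleftrightarrow> dsum1 c \<noteq> top"
    unfolding dsum1_def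
    by (auto simp: suminf_ennreal2 intro!: summable_suminf_not_top)
  then show ?thesis
    using assms by (simp add: dirichlet1_def pseries1_coeffs1 pseries1_holomorphic summable_on_UNIV_nonneg_real_iff)
qed

lemma dirichlet1_norm_dsum1:
  assumes "pseries1 c g" "dsum1 c \<noteq> top"
  shows "ennreal ((dirichlet1_norm g)\<^sup>2) = dsum1 c"
proof -
  have s: "summable (\<lambda>n. (real n + 1) * (cmod (c n))\<^sup>2)"
    using assms(2) unfolding dsum1_def by (intro summable_suminf_not_top) auto
  then have "((\<lambda>n. (real n + 1) * (cmod (c n))\<^sup>2) has_sum (\<Sum>n. (real n + 1) * (cmod (c n))\<^sup>2)) UNIV"
    by (intro sums_nonneg_imp_has_sum summable_sums) auto
  then have "(\<Sum>\<^sub>\<infinity>n. (real n + 1) * (cmod (c n))\<^sup>2) = (\<Sum>n. (real n + 1) * (cmod (c n))\<^sup>2)"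
    by (rule infsumI)
  moreover have "0 \<le> (\<Sum>n. (real n + 1) * (cmod (c n))\<^sup>2)" by (intro suminf_nonneg s) auto
  ultimately show ?thesis
    unfolding dirichlet1_norm_def pseries1_coeffs1[OF assms(1)] dsum1_def
    by (simp add: suminf_ennreal2 s)
qed

text \<open>
  Both sides are integrals over the counting measure, and Tonelli's theorem relates the unconditional
  double sum to the iterated one.
\<close>

lemma nonneg_double_sum:
  fixes f :: "nat \<times> nat \<Rightarrow> real"
  assumes nonneg: "\<And>x. 0 \<le> f x"
  shows "f summable_on UNIV \<longleftrightarrow> (\<Sum>m. \<Sum>n. ennreal (f (m, n))) \<noteq> top"
    and "f summable_on UNIV \<Longrightarrow> ennreal (\<Sum>\<^sub>\<infinity>x. f x) = (\<Sum>m. \<Sum>n. ennreal (f (m, n)))"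
proof -
  have eq: "(\<Sum>m. \<Sum>n. ennreal (f (m, n))) = (\<integral>\<^sup>+x. ennreal (f x) \<partial>count_space UNIV)"
    by (simp add: nn_integral_fst_count_space[symmetric] nn_integral_count_space_nat)
  have equiv: "f summable_on UNIV \<longleftrightarrow> Infinite_Set_Sum.abs_summable_on f UNIV"
    by (rule trans[OF summable_on_iff_abs_summable_on_real abs_summable_equivalent])
  then show "f summable_on UNIV \<longleftrightarrow> (\<Sum>m. \<Sum>n. ennreal (f (m, n))) \<noteq> top"
    unfolding eq by (simp add: Infinite_Set_Sum.abs_summable_on_def integrable_iff_bounded nonneg less_top)
  assume "f summable_on UNIV"
  then have "Infinite_Set_Sum.abs_summable_on f UNIV" using equiv by simp
  then show "ennreal (\<Sum>\<^sub>\<infinity>x. f x) = (\<Sum>m. \<Sum>n. ennreal (f (m, n)))"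
    unfolding eq by (simp add: nn_integral_conv_infsetsum infsetsum_infsum nonneg)
qed

lemma dirichlet2_iff:
  assumes "pseries2 a f" "f holomorphic2_on bidisc"
  shows "f \<in> dirichlet2 \<longleftrightarrow> dsum2 a \<noteq> top"
proof -
  define t where "t = (\<lambda>(m, n). (cmod (a (m, n)))\<^sup>2 * (real m + 1) * (real n + 1))"
  have "0 \<le> t x" for x by (cases x) (simp add: t_def)
  from nonneg_double_sum(1)[of t, OF this]
  have "t summable_on UNIV \<longleftrightarrow> dsum2 a \<noteq> top" by (simp add: dsum2_def t_def)
  then show ?thesis
    using assms(2) unfolding dirichlet2_def mem_Collect_eq pseries2_coeffs2[OF assms(1)] t_def by blast
qed

lemma dirichlet2_norm_dsum2:
  assumes "pseries2 a f" "dsum2 a \<noteq> top"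
  shows "ennreal ((dirichlet2_norm f)\<^sup>2) = dsum2 a"
proof -
  define t where "t = (\<lambda>(m, n). (cmod (a (m, n)))\<^sup>2 * (real m + 1) * (real n + 1))"
  have t: "0 \<le> t x" for x by (cases x) (simp add: t_def)
  have d: "dsum2 a = (\<Sum>m. \<Sum>n. ennreal (t (m, n)))" by (simp add: dsum2_def t_def)
  have "dirichlet2_norm f = sqrt (\<Sum>\<^sub>\<infinity>x. t x)"
    unfolding dirichlet2_norm_def pseries2_coeffs2[OF assms(1)] t_def ..
  then have "(dirichlet2_norm f)\<^sup>2 = (\<Sum>\<^sub>\<infinity>x. t x)"
    using t by (simp add: infsum_nonneg)
  then show ?thesis
    using nonneg_double_sum[of t, OF t] assms(2) unfolding d by metis
qed

lemma dirichlet2_norm_nonneg: "0 \<le> dirichlet2_norm f"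
  unfolding dirichlet2_norm_def by (intro real_sqrt_ge_zero infsum_nonneg) (auto simp: case_prod_unfold)

lemma suminf_ennreal_swap:
  fixes f :: "nat \<Rightarrow> nat \<Rightarrow> ennreal"
  shows "(\<Sum>m. \<Sum>n. f m n) = (\<Sum>n. \<Sum>m. f m n)"
proof -
  have "(\<Sum>m. \<integral>\<^sup>+n. f m n \<partial>count_space UNIV) = (\<integral>\<^sup>+n. (\<Sum>m. f m n) \<partial>count_space UNIV)"
    by (rule nn_integral_suminf[symmetric]) simp
  then show ?thesis by (simp add: nn_integral_count_space_nat)
qed

lemma dsum2_swap: "dsum2 (a \<circ> prod.swap) = dsum2 a"
  unfolding dsum2_def by (subst suminf_ennreal_swap) (simp add: ac_simps)

lemma suminf_ennreal_head: "(\<Sum>n. f n :: ennreal) = f 0 + (\<Sum>n. f (Suc n))"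
  using suminf_offset[of f 1] by (simp add: summableI add.commute)

lemma suminf_ennreal_tail_le: "(\<Sum>n. f (Suc n) :: ennreal) \<le> (\<Sum>n. f n)"
  unfolding suminf_ennreal_head[of f] by simp

lemma cmod_of_nat_Suc: "cmod (of_nat (Suc n)) = real n + 1"
  unfolding norm_of_nat by simp

lemma area_energy:
  assumes "pseries1 c g"
  shows "(\<integral>\<^sup>+z. ennreal ((cmod (deriv g z))\<^sup>2) \<partial>area_disc)
    = (\<Sum>n. ennreal (pi * (real n + 1) * (cmod (c (Suc n)))\<^sup>2))"
proof -
  have "pi * (cmod (of_nat (Suc n) * c (Suc n)))\<^sup>2 / (real n + 1) = pi * (real n + 1) * (cmod (c (Suc n)))\<^sup>2" for n
  proof -
    have "cmod (of_nat (Suc n) * c (Suc n)) = (real n + 1) * cmod (c (Suc n))"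
      by (simp only: norm_mult cmod_of_nat_Suc)
    then show ?thesis by (simp add: power_mult_distrib power2_eq_square)
  qed
  then show ?thesis using area_Parseval[OF pseries1_deriv[OF assms]] by simp
qed

lemma area_energy_le_dsum1:
  assumes "pseries1 c g"
  shows "(\<integral>\<^sup>+z. ennreal ((cmod (deriv g z))\<^sup>2) \<partial>area_disc) \<le> ennreal pi * dsum1 c"
proof -
  have "(\<Sum>n. ennreal (pi * (real n + 1) * (cmod (c (Suc n)))\<^sup>2))
      \<le> (\<Sum>n. ennreal pi * ennreal ((real (Suc n) + 1) * (cmod (c (Suc n)))\<^sup>2))"
    by (intro suminf_le summableI) (auto simp: ennreal_mult[symmetric] algebra_simps intro!: ennreal_leI)
  also have "\<dots> \<le> ennreal pi * dsum1 c"
    unfolding ennreal_suminf_cmult dsum1_def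
    by (intro mult_left_mono suminf_ennreal_tail_le[where f = "\<lambda>n. ennreal ((real n + 1) * (cmod (c n))\<^sup>2)"]) simp
  finally show ?thesis unfolding area_energy[OF assms] .
qed

text \<open>
  The factor 2 comes from \<open>n + 2 \<le> 2 (n + 1)\<close>: the area integral of \<open>|g'|\<^sup>2\<close> gives the coefficient of
  index \<open>n + 1\<close> the weight \<open>\<pi> (n + 1)\<close>, the norm gives it \<open>n + 2\<close>.
\<close>

lemma dsum1_le_area_energy:
  assumes "pseries1 c g"
  shows "dsum1 c \<le> ennreal ((cmod (c 0))\<^sup>2)
    + ennreal (2 / pi) * (\<integral>\<^sup>+z. ennreal ((cmod (deriv g z))\<^sup>2) \<partial>area_disc)"
proof -
  have "(\<Sum>n. ennreal ((real (Suc n) + 1) * (cmod (c (Suc n)))\<^sup>2))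
      \<le> (\<Sum>n. ennreal (2 / pi) * ennreal (pi * (real n + 1) * (cmod (c (Suc n)))\<^sup>2))"
  proof (intro suminf_le summableI)
    fix n
    have "(real (Suc n) + 1) * (cmod (c (Suc n)))\<^sup>2 \<le> 2 * (real n + 1) * (cmod (c (Suc n)))\<^sup>2"
      by (intro mult_right_mono) auto
    then have "(real (Suc n) + 1) * (cmod (c (Suc n)))\<^sup>2 \<le> 2 / pi * (pi * (real n + 1) * (cmod (c (Suc n)))\<^sup>2)"
      by (simp add: algebra_simps)
    then show "ennreal ((real (Suc n) + 1) * (cmod (c (Suc n)))\<^sup>2)
        \<le> ennreal (2 / pi) * ennreal (pi * (real n + 1) * (cmod (c (Suc n)))\<^sup>2)"
      by (subst ennreal_mult[symmetric]) (auto intro: ennreal_leI)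
  qed
  then show ?thesis
    unfolding area_energy[OF assms] ennreal_suminf_cmult[symmetric]
    unfolding dsum1_def by (subst suminf_ennreal_head) (simp add: add_left_mono)
qed

lemma slice_coeff_0: "slice_coeff a 0 = (\<lambda>m. a (m, 0))"
  unfolding slice_coeff_def by (simp add: fun_eq_iff)

text \<open>
  The index set splits into its first row, its first column and the rest, where
  \<open>(m + 2) (n + 2) \<le> 4 (m + 1) (n + 1)\<close>.
\<close>

lemma dsum2_le:
  "dsum2 a \<le> dsum1 (\<lambda>m. a (m, 0)) + dsum1 (\<lambda>n. a (0, n))
    + ennreal 4 * (\<Sum>m. \<Sum>n. ennreal ((real m + 1) * (real n + 1) * (cmod (a (Suc m, Suc n)))\<^sup>2))"
proof -
  define t where "t m n = ennreal ((cmod (a (m, n)))\<^sup>2 * (real m + 1) * (real n + 1))" for m n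
  have row0: "(\<Sum>n. t 0 n) = dsum1 (\<lambda>n. a (0, n))"
    by (simp add: t_def dsum1_def mult.commute)
  have "(\<Sum>m. t (Suc m) 0) \<le> (\<Sum>m. t m 0)" by (rule suminf_ennreal_tail_le)
  also have "\<dots> = dsum1 (\<lambda>m. a (m, 0))" by (simp add: t_def dsum1_def mult.commute)
  finally have col0: "(\<Sum>m. t (Suc m) 0) \<le> dsum1 (\<lambda>m. a (m, 0))" .
  have "(\<Sum>m. \<Sum>n. t (Suc m) (Suc n))
      \<le> (\<Sum>m. \<Sum>n. ennreal 4 * ennreal ((real m + 1) * (real n + 1) * (cmod (a (Suc m, Suc n)))\<^sup>2))"
  proof (intro suminf_le summableI)
    fix m n
    have "(real (Suc m) + 1) * (real (Suc n) + 1) \<le> (2 * (real m + 1)) * (2 * (real n + 1))"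
      by (intro mult_mono) auto
    then have "(real (Suc m) + 1) * (real (Suc n) + 1) * (cmod (a (Suc m, Suc n)))\<^sup>2
        \<le> (2 * (real m + 1)) * (2 * (real n + 1)) * (cmod (a (Suc m, Suc n)))\<^sup>2"
      by (rule mult_right_mono) simp
    then have "(cmod (a (Suc m, Suc n)))\<^sup>2 * (real (Suc m) + 1) * (real (Suc n) + 1)
        \<le> 4 * ((real m + 1) * (real n + 1) * (cmod (a (Suc m, Suc n)))\<^sup>2)"
      by (simp add: algebra_simps)
    then show "t (Suc m) (Suc n) \<le> ennreal 4 * ennreal ((real m + 1) * (real n + 1) * (cmod (a (Suc m, Suc n)))\<^sup>2)"
      unfolding t_def by (subst ennreal_mult[symmetric]) (auto intro: ennreal_leI)
  qed
  then have inner: "(\<Sum>m. \<Sum>n. t (Suc m) (Suc n))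
      \<le> ennreal 4 * (\<Sum>m. \<Sum>n. ennreal ((real m + 1) * (real n + 1) * (cmod (a (Suc m, Suc n)))\<^sup>2))"
    unfolding ennreal_suminf_cmult .
  have "dsum2 a = (\<Sum>m. \<Sum>n. t m n)" by (simp add: dsum2_def t_def)
  also have "\<dots> = (\<Sum>n. t 0 n) + (\<Sum>m. t (Suc m) 0 + (\<Sum>n. t (Suc m) (Suc n)))"
    by (subst suminf_ennreal_head) (subst suminf_ennreal_head[of "t (Suc m)" for m], simp)
  also have "\<dots> = (\<Sum>n. t 0 n) + ((\<Sum>m. t (Suc m) 0) + (\<Sum>m. \<Sum>n. t (Suc m) (Suc n)))"
    by (simp add: suminf_add[OF summableI summableI])
  also have "\<dots> \<le> dsum1 (\<lambda>n. a (0, n)) + (dsum1 (\<lambda>m. a (m, 0))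
    + ennreal 4 * (\<Sum>m. \<Sum>n. ennreal ((real m + 1) * (real n + 1) * (cmod (a (Suc m, Suc n)))\<^sup>2)))"
    by (intro add_mono inner col0) (simp add: row0)
  finally show ?thesis by (simp add: ac_simps)
qed

lemma dsum1_col0_le: "dsum1 (\<lambda>m. a (m, 0)) \<le> dsum2 a"
  unfolding dsum1_def dsum2_def
proof (intro suminf_le summableI)
  fix m
  show "ennreal ((real m + 1) * (cmod (a (m, 0)))\<^sup>2) \<le> (\<Sum>n. ennreal ((cmod (a (m, n)))\<^sup>2 * (real m + 1) * (real n + 1)))"
    unfolding suminf_ennreal_head[of "\<lambda>n. ennreal ((cmod (a (m, n)))\<^sup>2 * (real m + 1) * (real n + 1))"]
    by (simp add: mult.commute)
qed

lemma dsum1_row0_le: "dsum1 (\<lambda>n. a (0, n)) \<le> dsum2 a"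
  using dsum1_col0_le[of "a \<circ> prod.swap"] by (simp add: dsum2_swap)

lemma slice_coeff_measurable:
  "pseries2 a f \<Longrightarrow> (\<lambda>w. slice_coeff a w m) \<in> borel_measurable area_disc"
  by (rule pseries1_measurable[OF pseries1_slice_coeff])

text \<open>
  Parseval in \<open>w\<close> for all slice coefficients at once. The weights \<open>k\<close> leave the norm in the first variable
  free: constant multiples of \<open>1 / (m + 1)\<close> give an area integral over the bidisc, \<open>m + 1\<close> gives
  the average of the Dirichlet norms of the slices.
\<close>

lemma area_Parseval_slices:
  assumes f: "pseries2 a f" and k: "\<And>m. 0 \<le> k m"
  shows "(\<integral>\<^sup>+w. (\<Sum>m. ennreal (k m * (cmod (slice_coeff a w m))\<^sup>2)) \<partial>area_disc)
    = (\<Sum>m. \<Sum>n. ennreal (k m * (pi * (cmod (a (m, n)))\<^sup>2 / (real n + 1))))"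
proof -
  note [measurable] = slice_coeff_measurable[OF f]
  have "(\<integral>\<^sup>+w. (\<Sum>m. ennreal (k m * (cmod (slice_coeff a w m))\<^sup>2)) \<partial>area_disc)
      = (\<Sum>m. \<integral>\<^sup>+w. ennreal (k m * (cmod (slice_coeff a w m))\<^sup>2) \<partial>area_disc)"
    by (rule nn_integral_suminf) measurable
  also have "\<dots> = (\<Sum>m. \<Sum>n. ennreal (k m * (pi * (cmod (a (m, n)))\<^sup>2 / (real n + 1))))"
  proof (rule suminf_cong)
    fix m
    have "(\<integral>\<^sup>+w. ennreal (k m * (cmod (slice_coeff a w m))\<^sup>2) \<partial>area_disc)
        = ennreal (k m) * (\<integral>\<^sup>+w. ennreal ((cmod (slice_coeff a w m))\<^sup>2) \<partial>area_disc)"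
      by (subst nn_integral_cmult[symmetric]) (auto simp: ennreal_mult k)
    also have "\<dots> = ennreal (k m) * (\<Sum>n. ennreal (pi * (cmod (a (m, n)))\<^sup>2 / (real n + 1)))"
      by (subst area_Parseval[OF pseries1_slice_coeff[OF f]]) simp
    also have "\<dots> = (\<Sum>n. ennreal (k m * (pi * (cmod (a (m, n)))\<^sup>2 / (real n + 1))))"
      unfolding ennreal_suminf_cmult[symmetric] by (subst ennreal_mult) (auto simp: k)
    finally show "(\<integral>\<^sup>+w. ennreal (k m * (cmod (slice_coeff a w m))\<^sup>2) \<partial>area_disc)
        = (\<Sum>n. ennreal (k m * (pi * (cmod (a (m, n)))\<^sup>2 / (real n + 1))))" .
  qed
  finally show ?thesis .
qed

abbreviation area_bidisc :: "(complex \<times> complex) measure" where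
  "area_bidisc \<equiv> area_disc \<Otimes>\<^sub>M area_disc"

lemma space_area_bidisc: "space area_bidisc = bidisc"
  by (simp add: space_pair_measure)

lemma pseries2_measurable:
  assumes f: "pseries2 a f"
  shows "f \<in> borel_measurable area_bidisc"
proof (rule borel_measurable_LIMSEQ_metric)
  have id: "(\<lambda>z. z) \<in> borel_measurable area_disc" by (rule measurable_area_disc) simp
  note [measurable] = measurable_compose[OF measurable_snd slice_coeff_measurable[OF f]]
    measurable_compose[OF measurable_fst id]
  show "(\<lambda>p. \<Sum>m<N. slice_coeff a (snd p) m * fst p ^ m) \<in> borel_measurable area_bidisc" for N
    by measurable
  show "(\<lambda>N. \<Sum>m<N. slice_coeff a (snd p) m * fst p ^ m) \<longlonglongrightarrow> f p" if "p \<in> space area_bidisc" for p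
  proof -
    have "(\<lambda>m. slice_coeff a (snd p) m * fst p ^ m) sums f (fst p, snd p)"
      using that by (intro pseries1_sums[OF pseries1_slice_z[OF f]]) (auto simp: space_area_bidisc)
    then show ?thesis by (simp add: sums_def)
  qed
qed

lemma area_Parseval2:
  assumes f: "pseries2 a f"
  shows "(\<integral>\<^sup>+p. ennreal ((cmod (f p))\<^sup>2) \<partial>area_bidisc)
    = (\<Sum>m. \<Sum>n. ennreal (pi\<^sup>2 * (cmod (a (m, n)))\<^sup>2 / ((real m + 1) * (real n + 1))))"
proof -
  note [measurable] = pseries2_measurable[OF f]
  have "(\<integral>\<^sup>+p. ennreal ((cmod (f p))\<^sup>2) \<partial>area_bidisc)
      = (\<integral>\<^sup>+w. \<integral>\<^sup>+z. ennreal ((cmod (f (z, w)))\<^sup>2) \<partial>area_disc \<partial>area_disc)"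
    by (rule area_pair.nn_integral_snd[symmetric]) measurable
  also have "\<dots> = (\<integral>\<^sup>+w. (\<Sum>m. ennreal (pi / (real m + 1) * (cmod (slice_coeff a w m))\<^sup>2)) \<partial>area_disc)"
    by (intro nn_integral_cong) (simp add: area_Parseval[OF pseries1_slice_z[OF f]])
  also have "\<dots> = (\<Sum>m. \<Sum>n. ennreal (pi / (real m + 1) * (pi * (cmod (a (m, n)))\<^sup>2 / (real n + 1))))"
    by (rule area_Parseval_slices[OF f]) simp
  finally show ?thesis by (simp add: power2_eq_square mult.assoc)
qed

lemma area_energy2:
  assumes f: "pseries2 a f"
  shows "(\<integral>\<^sup>+p. ennreal ((cmod (partial_zw f p))\<^sup>2) \<partial>area_bidisc)
    = ennreal (pi\<^sup>2) * (\<Sum>m. \<Sum>n. ennreal ((real m + 1) * (real n + 1) * (cmod (a (Suc m, Suc n)))\<^sup>2))"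
proof -
  have eq: "pi\<^sup>2 * (cmod (of_nat (Suc m) * of_nat (Suc n) * a (Suc m, Suc n)))\<^sup>2 / ((real m + 1) * (real n + 1))
      = pi\<^sup>2 * ((real m + 1) * (real n + 1) * (cmod (a (Suc m, Suc n)))\<^sup>2)" for m n
  proof -
    have "cmod (of_nat (Suc m) * of_nat (Suc n) * a (Suc m, Suc n))
        = ((real m + 1) * (real n + 1)) * cmod (a (Suc m, Suc n))"
      by (simp only: norm_mult cmod_of_nat_Suc)
    then have "(cmod (of_nat (Suc m) * of_nat (Suc n) * a (Suc m, Suc n)))\<^sup>2
        = ((real m + 1) * (real n + 1)) * (((real m + 1) * (real n + 1)) * (cmod (a (Suc m, Suc n)))\<^sup>2)"
      by (simp add: power2_eq_square)
    moreover have "p * (x * (x * y)) / x = p * (x * y)" if "x \<noteq> 0" for p x y :: real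
      using that by simp
    moreover have "(real m + 1) * (real n + 1) \<noteq> 0" by simp
    ultimately show ?thesis by presburger
  qed
  show ?thesis
    unfolding area_Parseval2[OF pseries2_partial_zw[OF f]] prod.case eq ennreal_suminf_cmult[symmetric]
    by (subst ennreal_mult[symmetric]) auto
qed

lemma area_energy2_le_dsum2:
  assumes f: "pseries2 a f"
  shows "(\<integral>\<^sup>+p. ennreal ((cmod (partial_zw f p))\<^sup>2) \<partial>area_bidisc) \<le> ennreal (pi\<^sup>2) * dsum2 a"
proof -
  define t where "t m n = ennreal ((cmod (a (m, n)))\<^sup>2 * (real m + 1) * (real n + 1))" for m n
  have "(\<Sum>m. \<Sum>n. ennreal ((real m + 1) * (real n + 1) * (cmod (a (Suc m, Suc n)))\<^sup>2)) \<le> (\<Sum>m. \<Sum>n. t (Suc m) (Suc n))"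
  proof (intro suminf_le summableI)
    fix m n
    have "(real m + 1) * (real n + 1) \<le> (real (Suc m) + 1) * (real (Suc n) + 1)"
      by (intro mult_mono) auto
    then have "(real m + 1) * (real n + 1) * (cmod (a (Suc m, Suc n)))\<^sup>2
        \<le> (real (Suc m) + 1) * (real (Suc n) + 1) * (cmod (a (Suc m, Suc n)))\<^sup>2"
      by (rule mult_right_mono) simp
    then show "ennreal ((real m + 1) * (real n + 1) * (cmod (a (Suc m, Suc n)))\<^sup>2) \<le> t (Suc m) (Suc n)"
      unfolding t_def by (intro ennreal_leI) (simp only: mult.commute mult.left_commute)
  qed
  also have "\<dots> \<le> (\<Sum>m. \<Sum>n. t (Suc m) n)"
    by (intro suminf_le summableI suminf_ennreal_tail_le)
  also have "\<dots> \<le> (\<Sum>m. \<Sum>n. t m n)"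
    by (rule suminf_ennreal_tail_le)
  finally show ?thesis
    unfolding area_energy2[OF f] dsum2_def t_def by (intro mult_left_mono) simp_all
qed

lemma dsum2_le_area_energy2:
  assumes f: "pseries2 a f"
  shows "dsum2 a \<le> dsum1 (\<lambda>m. a (m, 0)) + dsum1 (\<lambda>n. a (0, n))
    + ennreal (4 / pi\<^sup>2) * (\<integral>\<^sup>+p. ennreal ((cmod (partial_zw f p))\<^sup>2) \<partial>area_bidisc)"
proof -
  have "ennreal (4 / pi\<^sup>2) * (ennreal (pi\<^sup>2) * X) = ennreal 4 * X" for X
    by (simp add: mult.assoc[symmetric] ennreal_mult[symmetric])
  then show ?thesis unfolding area_energy2[OF f] using dsum2_le[of a] by simp
qed

section \<open>Multiplication in one variable\<close>

lemma cmod_add_square_le: "(cmod (x + y))\<^sup>2 \<le> 2 * (cmod x)\<^sup>2 + 2 * (cmod y)\<^sup>2"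
proof -
  have "(cmod (x + y))\<^sup>2 \<le> (cmod x + cmod y)\<^sup>2" by (intro power_mono norm_triangle_ineq) auto
  also have "\<dots> \<le> 2 * (cmod x)\<^sup>2 + 2 * (cmod y)\<^sup>2"
    using sum_squares_bound[of "cmod x" "cmod y"] by (simp add: power2_sum)
  finally show ?thesis .
qed

lemma cmod_add4_square_le:
  "(cmod (x + y + u + v))\<^sup>2 \<le> 4 * ((cmod x)\<^sup>2 + (cmod y)\<^sup>2 + (cmod u)\<^sup>2 + (cmod v)\<^sup>2)"
  using cmod_add_square_le[of "x + y" "u + v"] cmod_add_square_le[of x y] cmod_add_square_le[of u v]
  by (simp add: add.assoc)

lemma pseries1_deriv_mult:
  assumes "pseries1 d \<phi>" "pseries1 c g" "z \<in> disc"
  shows "deriv (\<lambda>z. \<phi> z * g z) z = \<phi> z * deriv g z + deriv \<phi> z * g z"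
proof -
  have "\<phi> field_differentiable at z" "g field_differentiable at z"
    using pseries1_has_deriv[OF assms(1), of z] pseries1_has_deriv[OF assms(2), of z] assms(3)
    by (auto simp: field_differentiable_def)
  then show ?thesis by (rule deriv_mult)
qed

lemma dsum1_head_le: "ennreal ((cmod (c 0))\<^sup>2) \<le> dsum1 c"
  unfolding dsum1_def by (subst suminf_ennreal_head) simp

lemma ennreal_mult_add_distrib:
  "0 \<le> a \<Longrightarrow> 0 \<le> b \<Longrightarrow> ennreal a * x + ennreal b * x = ennreal (a + b) * x"
  by (simp add: distrib_right)

lemma ennreal_scale:
  "0 \<le> a \<Longrightarrow> 0 \<le> b \<Longrightarrow> ennreal a * (ennreal b * x) = ennreal (a * b) * x"
  by (simp add: ennreal_mult mult.assoc)

lemma ennreal_linear_combination: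
  "0 \<le> a \<Longrightarrow> 0 \<le> b \<Longrightarrow> 0 \<le> x \<Longrightarrow> 0 \<le> y \<Longrightarrow>
    ennreal a * ennreal x + ennreal b * ennreal y = ennreal (a * x + b * y)"
  by (simp add: ennreal_mult)

text \<open>
  Multiplication by \<open>\<phi>\<close> in one variable: the derivative of \<open>\<phi> g\<close> is \<open>\<phi> g' + \<phi>' g\<close>, where the first term
  is bounded by \<open>bound\<close> and the second one by the Carleson condition \<open>I\<close>.
\<close>

lemma dsum1_mult_le:
  assumes \<phi>: "pseries1 d \<phi>" and g: "pseries1 c g" and e: "pseries1 e (\<lambda>z. \<phi> z * g z)"
    and S: "0 \<le> S" and bound: "\<And>z. z \<in> disc \<Longrightarrow> (cmod (\<phi> z))\<^sup>2 \<le> S"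
    and I: "(\<integral>\<^sup>+z. ennreal ((cmod (deriv \<phi> z))\<^sup>2 * (cmod (g z))\<^sup>2) \<partial>area_disc) \<le> ennreal S * dsum1 c"
  shows "dsum1 e \<le> ennreal (10 * S) * dsum1 c"
proof -
  note [measurable] = pseries1_measurable[OF g] pseries1_measurable[OF pseries1_deriv[OF g]]
    pseries1_measurable[OF pseries1_deriv[OF \<phi>]]
  have "(\<integral>\<^sup>+z. ennreal ((cmod (deriv (\<lambda>z. \<phi> z * g z) z))\<^sup>2) \<partial>area_disc)
      \<le> (\<integral>\<^sup>+z. ennreal (2 * S) * ennreal ((cmod (deriv g z))\<^sup>2)
            + ennreal 2 * ennreal ((cmod (deriv \<phi> z))\<^sup>2 * (cmod (g z))\<^sup>2) \<partial>area_disc)"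
  proof (rule nn_integral_mono)
    fix z assume "z \<in> space area_disc"
    then have z: "z \<in> disc" by simp
    have "(cmod (deriv (\<lambda>z. \<phi> z * g z) z))\<^sup>2
        \<le> 2 * ((cmod (\<phi> z))\<^sup>2 * (cmod (deriv g z))\<^sup>2) + 2 * ((cmod (deriv \<phi> z))\<^sup>2 * (cmod (g z))\<^sup>2)"
      using cmod_add_square_le[of "\<phi> z * deriv g z" "deriv \<phi> z * g z"]
      by (simp add: pseries1_deriv_mult[OF \<phi> g z] norm_mult power_mult_distrib)
    also have "\<dots> \<le> 2 * (S * (cmod (deriv g z))\<^sup>2) + 2 * ((cmod (deriv \<phi> z))\<^sup>2 * (cmod (g z))\<^sup>2)"
      by (intro add_mono mult_left_mono mult_right_mono bound z) auto
    finally show "ennreal ((cmod (deriv (\<lambda>z. \<phi> z * g z) z))\<^sup>2) \<le> ennreal (2 * S) * ennreal ((cmod (deriv g z))\<^sup>2)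
            + ennreal 2 * ennreal ((cmod (deriv \<phi> z))\<^sup>2 * (cmod (g z))\<^sup>2)"
      using S by (subst ennreal_linear_combination) (auto intro!: ennreal_leI simp: mult.assoc simp del: ennreal_plus)
  qed
  also have "\<dots> = ennreal (2 * S) * (\<integral>\<^sup>+z. ennreal ((cmod (deriv g z))\<^sup>2) \<partial>area_disc)
      + ennreal 2 * (\<integral>\<^sup>+z. ennreal ((cmod (deriv \<phi> z))\<^sup>2 * (cmod (g z))\<^sup>2) \<partial>area_disc)"
    by (subst nn_integral_add) (simp_all add: nn_integral_cmult)
  also have "\<dots> \<le> ennreal (2 * S) * (ennreal pi * dsum1 c) + ennreal 2 * (ennreal S * dsum1 c)"
    by (intro add_mono mult_left_mono I area_energy_le_dsum1[OF g]) auto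
  also have "\<dots> = ennreal (2 * S * pi + 2 * S) * dsum1 c"
    using S by (simp add: ennreal_scale ennreal_mult_add_distrib del: ennreal_plus ennreal_numeral)
  finally have D: "(\<integral>\<^sup>+z. ennreal ((cmod (deriv (\<lambda>z. \<phi> z * g z) z))\<^sup>2) \<partial>area_disc) \<le> ennreal (2 * S * pi + 2 * S) * dsum1 c" .
  have "e 0 = \<phi> 0 * c 0" using pseries1_at_0[OF e] pseries1_at_0[OF g] by simp
  then have "(cmod (e 0))\<^sup>2 \<le> S * (cmod (c 0))\<^sup>2"
    using bound[of 0] by (simp add: norm_mult power_mult_distrib mult_right_mono)
  then have "ennreal ((cmod (e 0))\<^sup>2) \<le> ennreal S * ennreal ((cmod (c 0))\<^sup>2)"
    using S by (simp add: ennreal_mult'[symmetric] ennreal_leI)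
  also have "\<dots> \<le> ennreal S * dsum1 c" by (intro mult_left_mono dsum1_head_le) simp
  finally have e0: "ennreal ((cmod (e 0))\<^sup>2) \<le> ennreal S * dsum1 c" .
  have "dsum1 e \<le> ennreal S * dsum1 c + ennreal (2 / pi) * (ennreal (2 * S * pi + 2 * S) * dsum1 c)"
    by (rule order.trans[OF dsum1_le_area_energy[OF e]]) (intro add_mono e0 mult_left_mono D zero_le)
  also have "\<dots> = ennreal (S + 2 / pi * (2 * S * pi + 2 * S)) * dsum1 c"
    using S by (simp add: ennreal_scale ennreal_mult_add_distrib del: ennreal_plus ennreal_numeral)
  also have "\<dots> \<le> ennreal (10 * S) * dsum1 c"
  proof (intro mult_right_mono ennreal_leI)
    \<comment> \<open>It suffices that \<open>\<pi> \<ge> 1\<close>; the sum is then at most \<open>9 S\<close>.\<close>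
    have "2 * S \<le> 2 * S * pi" using S pi_gt3 by (simp add: mult_le_cancel_left1)
    then have "2 / pi * (2 * S * pi + 2 * S) \<le> 2 / pi * (4 * S * pi)"
      by (intro mult_left_mono) auto
    then show "S + 2 / pi * (2 * S * pi + 2 * S) \<le> 10 * S" using S by simp
  qed simp
  finally show ?thesis .
qed

text \<open>
  Conversely, if the norm of \<open>\<phi> g\<close> is controlled by that of \<open>g\<close>, then \<open>\<phi>' g = (\<phi> g)' - \<phi> g'\<close> is a
  difference of two controlled terms.
\<close>

lemma nn_integral_deriv_mult_le:
  assumes \<phi>: "pseries1 d \<phi>" and g: "pseries1 c g" and e: "pseries1 e (\<lambda>z. \<phi> z * g z)"
    and S: "0 \<le> S" and bound: "\<And>z. z \<in> disc \<Longrightarrow> (cmod (\<phi> z))\<^sup>2 \<le> S"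
    and I: "dsum1 e \<le> ennreal S * dsum1 c"
  shows "(\<integral>\<^sup>+z. ennreal ((cmod (deriv \<phi> z))\<^sup>2 * (cmod (g z))\<^sup>2) \<partial>area_disc) \<le> ennreal (4 * pi * S) * dsum1 c"
proof -
  note [measurable] = pseries1_measurable[OF g] pseries1_measurable[OF pseries1_deriv[OF g]]
    pseries1_measurable[OF pseries1_deriv[OF e]]
  have "(\<integral>\<^sup>+z. ennreal ((cmod (deriv \<phi> z))\<^sup>2 * (cmod (g z))\<^sup>2) \<partial>area_disc)
      \<le> (\<integral>\<^sup>+z. ennreal 2 * ennreal ((cmod (deriv (\<lambda>z. \<phi> z * g z) z))\<^sup>2)
            + ennreal (2 * S) * ennreal ((cmod (deriv g z))\<^sup>2) \<partial>area_disc)"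
  proof (rule nn_integral_mono)
    fix z assume "z \<in> space area_disc"
    then have z: "z \<in> disc" by simp
    have "(cmod (deriv \<phi> z))\<^sup>2 * (cmod (g z))\<^sup>2
        = (cmod (deriv (\<lambda>z. \<phi> z * g z) z + - (\<phi> z * deriv g z)))\<^sup>2"
      by (simp add: pseries1_deriv_mult[OF \<phi> g z] norm_mult power_mult_distrib)
    also have "\<dots> \<le> 2 * (cmod (deriv (\<lambda>z. \<phi> z * g z) z))\<^sup>2 + 2 * ((cmod (\<phi> z))\<^sup>2 * (cmod (deriv g z))\<^sup>2)"
      by (rule order.trans[OF cmod_add_square_le]) (simp add: norm_mult power_mult_distrib)
    also have "\<dots> \<le> 2 * (cmod (deriv (\<lambda>z. \<phi> z * g z) z))\<^sup>2 + 2 * (S * (cmod (deriv g z))\<^sup>2)"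
      by (intro add_mono mult_left_mono mult_right_mono bound z) auto
    finally show "ennreal ((cmod (deriv \<phi> z))\<^sup>2 * (cmod (g z))\<^sup>2) \<le> ennreal 2 * ennreal ((cmod (deriv (\<lambda>z. \<phi> z * g z) z))\<^sup>2)
            + ennreal (2 * S) * ennreal ((cmod (deriv g z))\<^sup>2)"
      using S by (subst ennreal_linear_combination) (auto intro!: ennreal_leI simp: mult.assoc simp del: ennreal_plus)
  qed
  also have "\<dots> = ennreal 2 * (\<integral>\<^sup>+z. ennreal ((cmod (deriv (\<lambda>z. \<phi> z * g z) z))\<^sup>2) \<partial>area_disc)
      + ennreal (2 * S) * (\<integral>\<^sup>+z. ennreal ((cmod (deriv g z))\<^sup>2) \<partial>area_disc)"
    by (subst nn_integral_add) (simp_all add: nn_integral_cmult)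
  also have "\<dots> \<le> ennreal 2 * (ennreal pi * (ennreal S * dsum1 c)) + ennreal (2 * S) * (ennreal pi * dsum1 c)"
    by (intro add_mono mult_left_mono area_energy_le_dsum1[OF g]
        order.trans[OF area_energy_le_dsum1[OF e]] I) auto
  also have "\<dots> = ennreal (2 * pi * S + 2 * S * pi) * dsum1 c"
    using S by (simp add: ennreal_scale ennreal_mult_add_distrib del: ennreal_plus ennreal_numeral)
  finally show ?thesis by (simp add: ac_simps)
qed

section \<open>Carleson constants of densities\<close>

text \<open>
  A strict bound on the Carleson constant yields an admissible constant below \<open>S\<close> without an
  argument that the infimum is attained. It also forces \<open>S > 0\<close>, so that the estimate holds for
  functions of infinite norm as well.
\<close>

lemma CM1_density_less:
  assumes h: "h \<in> borel_measurable area_disc"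
    and less: "CM1 (density area_disc (\<lambda>z. ennreal ((cmod (h z))\<^sup>2))) < ennreal S"
    and g: "pseries1 c g"
  shows "(\<integral>\<^sup>+z. ennreal ((cmod (h z))\<^sup>2 * (cmod (g z))\<^sup>2) \<partial>area_disc) \<le> ennreal S * dsum1 c"
proof (cases "dsum1 c = top")
  case True
  have "ennreal S \<noteq> 0" using less by auto
  then show ?thesis using True by (simp add: ennreal_mult_top)
next
  case False
  note [measurable] = h pseries1_measurable[OF g]
  obtain C where C: "C < ennreal S" "\<forall>f\<in>dirichlet1.
     (\<integral>\<^sup>+z. ennreal ((cmod (f z))\<^sup>2) \<partial>density area_disc (\<lambda>z. ennreal ((cmod (h z))\<^sup>2))) \<le> C * ennreal ((dirichlet1_norm f)\<^sup>2)"
    using less unfolding CM1_def Inf_less_iff by blast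
  have "(\<integral>\<^sup>+z. ennreal ((cmod (h z))\<^sup>2 * (cmod (g z))\<^sup>2) \<partial>area_disc)
      = (\<integral>\<^sup>+z. ennreal ((cmod (g z))\<^sup>2) \<partial>density area_disc (\<lambda>z. ennreal ((cmod (h z))\<^sup>2)))"
    by (subst nn_integral_density) (simp_all add: ennreal_mult)
  also have "\<dots> \<le> C * dsum1 c"
    using C(2) dirichlet1_iff[OF g] dirichlet1_norm_dsum1[OF g] False by force
  also have "\<dots> \<le> ennreal S * dsum1 c" using C(1) by (intro mult_right_mono) auto
  finally show ?thesis .
qed

lemma CM1_density_le:
  assumes h: "h \<in> borel_measurable area_disc"
    and le: "\<And>c g. pseries1 c g \<Longrightarrow> (\<integral>\<^sup>+z. ennreal ((cmod (h z))\<^sup>2 * (cmod (g z))\<^sup>2) \<partial>area_disc) \<le> S * dsum1 c"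
  shows "CM1 (density area_disc (\<lambda>z. ennreal ((cmod (h z))\<^sup>2))) \<le> S"
  unfolding CM1_def
proof (intro Inf_lower CollectI ballI)
  fix g assume g: "g \<in> dirichlet1"
  then obtain c where c: "pseries1 c g" using pseries1_exists unfolding dirichlet1_def by blast
  note [measurable] = h pseries1_measurable[OF c]
  have "(\<integral>\<^sup>+z. ennreal ((cmod (g z))\<^sup>2) \<partial>density area_disc (\<lambda>z. ennreal ((cmod (h z))\<^sup>2)))
      = (\<integral>\<^sup>+z. ennreal ((cmod (h z))\<^sup>2 * (cmod (g z))\<^sup>2) \<partial>area_disc)"
    by (subst nn_integral_density) (simp_all add: ennreal_mult)
  also have "\<dots> \<le> S * dsum1 c" by (rule le[OF c])
  finally show "(\<integral>\<^sup>+z. ennreal ((cmod (g z))\<^sup>2) \<partial>density area_disc (\<lambda>z. ennreal ((cmod (h z))\<^sup>2)))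
      \<le> S * ennreal ((dirichlet1_norm g)\<^sup>2)"
    using dirichlet1_norm_dsum1[OF c] dirichlet1_iff[OF c] g by simp
qed

lemma CM2_density_less:
  assumes h: "h \<in> borel_measurable area_bidisc"
    and less: "CM2 (density area_bidisc (\<lambda>p. ennreal ((cmod (h p))\<^sup>2))) < ennreal S"
    and f: "pseries2 a f" "f holomorphic2_on bidisc"
  shows "(\<integral>\<^sup>+p. ennreal ((cmod (h p))\<^sup>2 * (cmod (f p))\<^sup>2) \<partial>area_bidisc) \<le> ennreal S * dsum2 a"
proof (cases "dsum2 a = top")
  case True
  have "ennreal S \<noteq> 0" using less by auto
  then show ?thesis using True by (simp add: ennreal_mult_top)
next
  case False
  note [measurable] = h pseries2_measurable[OF f(1)]
  obtain C where C: "C < ennreal S" "\<forall>f\<in>dirichlet2.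
     (\<integral>\<^sup>+p. ennreal ((cmod (f p))\<^sup>2) \<partial>density area_bidisc (\<lambda>p. ennreal ((cmod (h p))\<^sup>2))) \<le> C * ennreal ((dirichlet2_norm f)\<^sup>2)"
    using less unfolding CM2_def Inf_less_iff by blast
  have "(\<integral>\<^sup>+p. ennreal ((cmod (h p))\<^sup>2 * (cmod (f p))\<^sup>2) \<partial>area_bidisc)
      = (\<integral>\<^sup>+p. ennreal ((cmod (f p))\<^sup>2) \<partial>density area_bidisc (\<lambda>p. ennreal ((cmod (h p))\<^sup>2)))"
    by (subst nn_integral_density) (simp_all add: ennreal_mult)
  also have "\<dots> \<le> C * dsum2 a"
    using C(2) dirichlet2_iff[OF f] dirichlet2_norm_dsum2[OF f(1)] False by force
  also have "\<dots> \<le> ennreal S * dsum2 a" using C(1) by (intro mult_right_mono) auto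
  finally show ?thesis .
qed

lemma CM2_density_le:
  assumes h: "h \<in> borel_measurable area_bidisc"
    and le: "\<And>a f. pseries2 a f \<Longrightarrow> f holomorphic2_on bidisc \<Longrightarrow>
      (\<integral>\<^sup>+p. ennreal ((cmod (h p))\<^sup>2 * (cmod (f p))\<^sup>2) \<partial>area_bidisc) \<le> S * dsum2 a"
  shows "CM2 (density area_bidisc (\<lambda>p. ennreal ((cmod (h p))\<^sup>2))) \<le> S"
  unfolding CM2_def
proof (intro Inf_lower CollectI ballI)
  fix f assume f: "f \<in> dirichlet2"
  then have hol: "f holomorphic2_on bidisc" by (simp add: dirichlet2_def)
  then obtain a where a: "pseries2 a f" using holomorphic2_imp_pseries2 by blast
  note [measurable] = h pseries2_measurable[OF a]
  have "(\<integral>\<^sup>+p. ennreal ((cmod (f p))\<^sup>2) \<partial>density area_bidisc (\<lambda>p. ennreal ((cmod (h p))\<^sup>2)))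
      = (\<integral>\<^sup>+p. ennreal ((cmod (h p))\<^sup>2 * (cmod (f p))\<^sup>2) \<partial>area_bidisc)"
    by (subst nn_integral_density) (simp_all add: ennreal_mult)
  also have "\<dots> \<le> S * dsum2 a" by (rule le[OF a hol])
  finally show "(\<integral>\<^sup>+p. ennreal ((cmod (f p))\<^sup>2) \<partial>density area_bidisc (\<lambda>p. ennreal ((cmod (h p))\<^sup>2)))
      \<le> S * ennreal ((dirichlet2_norm f)\<^sup>2)"
    using dirichlet2_norm_dsum2[OF a] dirichlet2_iff[OF a hol] f by simp
qed

section \<open>The terms of the Leibniz rule\<close>

lemma partial_zw_mult:
  assumes b: "pseries2 d b" and f: "pseries2 a f" and p: "p \<in> bidisc"
  shows "partial_zw (\<lambda>p. b p * f p) p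
    = b p * partial_zw f p + partial_z b p * partial_w f p
      + partial_w b p * partial_z f p + partial_zw b p * f p"
proof -
  obtain z w where zw: "p = (z, w)" "z \<in> disc" "w \<in> disc" using p by auto
  have w1: "cmod w < 1" using zw by simp
  have pw: "partial_w (\<lambda>p. b p * f p) (u, w) = b (u, w) * partial_w f (u, w) + partial_w b (u, w) * f (u, w)"
    if "u \<in> disc" for u
    using pseries1_deriv_mult[OF pseries1_slice_w[OF b, of u] pseries1_slice_w[OF f, of u] zw(3)] that
    by (simp add: partial_w_def)
  have fd: "(\<lambda>u. h (u, w)) field_differentiable at z" if "pseries2 e h" for e h
    using pseries1_has_deriv[OF pseries1_slice_z[OF that w1], of z] zw by (auto simp: field_differentiable_def)
  note fds = fd[OF b] fd[OF f] fd[OF pseries2_partial_w[OF b]] fd[OF pseries2_partial_w[OF f]]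
  have "partial_zw (\<lambda>p. b p * f p) p = deriv (\<lambda>u. partial_w (\<lambda>p. b p * f p) (u, w)) z"
    by (simp add: partial_zw_def partial_z_def zw)
  also have "\<dots> = deriv (\<lambda>u. b (u, w) * partial_w f (u, w) + partial_w b (u, w) * f (u, w)) z"
  proof (rule deriv_cong_ev)
    have "eventually (\<lambda>u. u \<in> disc) (nhds z)" using zw by (intro eventually_nhds_in_open) auto
    then show "\<forall>\<^sub>F u in nhds z. partial_w (\<lambda>p. b p * f p) (u, w)
        = b (u, w) * partial_w f (u, w) + partial_w b (u, w) * f (u, w)"
      by eventually_elim (rule pw)
  qed simp
  also have "\<dots> = (b (z, w) * deriv (\<lambda>u. partial_w f (u, w)) z + deriv (\<lambda>u. b (u, w)) z * partial_w f (z, w))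
      + (partial_w b (z, w) * deriv (\<lambda>u. f (u, w)) z + deriv (\<lambda>u. partial_w b (u, w)) z * f (z, w))"
    using fds by (simp add: field_differentiable_mult)
  finally show ?thesis
    by (simp add: zw partial_zw_def partial_z_def add.assoc)
qed

lemma nn_integral_area_bidisc_swap:
  assumes F[measurable]: "F \<in> borel_measurable area_bidisc"
  shows "(\<integral>\<^sup>+p. F (prod.swap p) \<partial>area_bidisc) = (\<integral>\<^sup>+p. F p \<partial>area_bidisc)"
proof -
  have "(\<integral>\<^sup>+p. F (prod.swap p) \<partial>area_bidisc) = (\<integral>\<^sup>+x. \<integral>\<^sup>+y. F (y, x) \<partial>area_disc \<partial>area_disc)"
    by (subst area_disc.nn_integral_fst[symmetric]) (simp_all add: prod.swap_def)
  also have "\<dots> = (\<integral>\<^sup>+p. F p \<partial>area_bidisc)"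
    by (rule area_pair.nn_integral_snd) measurable
  finally show ?thesis .
qed

text \<open>
  For fixed \<open>w\<close> the hypothesis bounds the integral over \<open>z\<close> by the squared Dirichlet norm of
  \<open>\<partial>\<^sub>w f(\<cdot>, w)\<close>. Integrated over \<open>w\<close>, Parseval in \<open>w\<close> turns the coefficients \<open>(n + 1) a\<^sub>m\<^sub>,\<^sub>n\<^sub>+\<^sub>1\<close> of
  \<open>\<partial>\<^sub>w f\<close> into the weights \<open>\<pi> (m + 1) (n + 1)\<close>, which are below those of the norm of \<open>f\<close>.
\<close>

lemma mixed_term_w_le:
  assumes H: "H \<in> borel_measurable area_bidisc" and K: "0 \<le> K"
    and slice: "\<And>w c g. w \<in> disc \<Longrightarrow> pseries1 c g \<Longrightarrow>
      (\<integral>\<^sup>+z. ennreal ((cmod (H (z, w)))\<^sup>2 * (cmod (g z))\<^sup>2) \<partial>area_disc) \<le> ennreal K * dsum1 c"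
    and f: "pseries2 a f"
  shows "(\<integral>\<^sup>+p. ennreal ((cmod (H p))\<^sup>2 * (cmod (partial_w f p))\<^sup>2) \<partial>area_bidisc) \<le> ennreal (K * pi) * dsum2 a"
proof -
  define a' where "a' = (\<lambda>(m, n). of_nat (Suc n) * a (m, Suc n))"
  have f': "pseries2 a' (partial_w f)" unfolding a'_def by (rule pseries2_partial_w[OF f])
  note [measurable] = H pseries2_measurable[OF f'] slice_coeff_measurable[OF f']
  have "(\<integral>\<^sup>+p. ennreal ((cmod (H p))\<^sup>2 * (cmod (partial_w f p))\<^sup>2) \<partial>area_bidisc)
      = (\<integral>\<^sup>+w. \<integral>\<^sup>+z. ennreal ((cmod (H (z, w)))\<^sup>2 * (cmod (partial_w f (z, w)))\<^sup>2) \<partial>area_disc \<partial>area_disc)"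
    by (rule area_pair.nn_integral_snd[symmetric]) measurable
  also have "\<dots> \<le> (\<integral>\<^sup>+w. ennreal K * dsum1 (slice_coeff a' w) \<partial>area_disc)"
    by (intro nn_integral_mono slice pseries1_slice_z[OF f']) auto
  also have "\<dots> = ennreal K * (\<integral>\<^sup>+w. dsum1 (slice_coeff a' w) \<partial>area_disc)"
    unfolding dsum1_def by (rule nn_integral_cmult) measurable
  also have "(\<integral>\<^sup>+w. dsum1 (slice_coeff a' w) \<partial>area_disc)
      = (\<Sum>m. \<Sum>n. ennreal ((real m + 1) * (pi * (cmod (a' (m, n)))\<^sup>2 / (real n + 1))))"
    unfolding dsum1_def by (rule area_Parseval_slices[OF f']) simp
  also have "\<dots> \<le> (\<Sum>m. \<Sum>n. ennreal pi * ennreal ((cmod (a (m, Suc n)))\<^sup>2 * (real m + 1) * (real (Suc n) + 1)))"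
  proof (intro suminf_le summableI)
    fix m n
    have "cmod (a' (m, n)) = (real n + 1) * cmod (a (m, Suc n))"
      by (simp only: a'_def prod.case norm_mult cmod_of_nat_Suc)
    then have "(real m + 1) * (pi * (cmod (a' (m, n)))\<^sup>2 / (real n + 1))
        = pi * (real m + 1) * (cmod (a (m, Suc n)))\<^sup>2 * (real n + 1)"
      by (simp add: power2_eq_square)
    also have "\<dots> \<le> pi * (real m + 1) * (cmod (a (m, Suc n)))\<^sup>2 * (real (Suc n) + 1)"
      by (intro mult_left_mono) auto
    finally show "ennreal ((real m + 1) * (pi * (cmod (a' (m, n)))\<^sup>2 / (real n + 1)))
        \<le> ennreal pi * ennreal ((cmod (a (m, Suc n)))\<^sup>2 * (real m + 1) * (real (Suc n) + 1))"
      by (subst ennreal_mult[symmetric]) (auto intro!: ennreal_leI simp: ac_simps)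
  qed
  also have "\<dots> \<le> ennreal pi * dsum2 a"
    unfolding ennreal_suminf_cmult dsum2_def
    by (intro mult_left_mono suminf_le summableI suminf_ennreal_tail_le[where f = "\<lambda>n. ennreal ((cmod (a (m, n)))\<^sup>2 * (real m + 1) * (real n + 1))" for m]) simp
  finally show ?thesis
    using K by (simp add: ennreal_mult mult.assoc mult_left_mono)
qed

lemma mixed_term_z_le:
  assumes H: "H \<in> borel_measurable area_bidisc" and K: "0 \<le> K"
    and slice: "\<And>z c g. z \<in> disc \<Longrightarrow> pseries1 c g \<Longrightarrow>
      (\<integral>\<^sup>+w. ennreal ((cmod (H (z, w)))\<^sup>2 * (cmod (g w))\<^sup>2) \<partial>area_disc) \<le> ennreal K * dsum1 c"
    and f: "pseries2 a f"
  shows "(\<integral>\<^sup>+p. ennreal ((cmod (H p))\<^sup>2 * (cmod (partial_z f p))\<^sup>2) \<partial>area_bidisc) \<le> ennreal (K * pi) * dsum2 a"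
proof -
  note [measurable] = H pseries2_measurable[OF pseries2_partial_z[OF f]]
  have pw: "partial_w (f \<circ> prod.swap) p = partial_z f (prod.swap p)" for p
    by (cases p) (simp add: partial_w_def partial_z_def)
  have H': "H \<circ> prod.swap \<in> borel_measurable area_bidisc"
    unfolding prod.swap_def comp_def by measurable
  have "(\<integral>\<^sup>+p. ennreal ((cmod (H p))\<^sup>2 * (cmod (partial_z f p))\<^sup>2) \<partial>area_bidisc)
      = (\<integral>\<^sup>+p. ennreal ((cmod ((H \<circ> prod.swap) p))\<^sup>2 * (cmod (partial_w (f \<circ> prod.swap) p))\<^sup>2) \<partial>area_bidisc)"
    unfolding pw unfolding comp_def by (rule nn_integral_area_bidisc_swap[symmetric]) measurable
  also have "\<dots> \<le> ennreal (K * pi) * dsum2 (a \<circ> prod.swap)"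
    by (rule mixed_term_w_le[OF H' K _ pseries2_swap[OF f]]) (simp add: slice)
  finally show ?thesis by (simp add: dsum2_swap)
qed

section \<open>Carleson bounds give a multiplier\<close>

text \<open>
  Multiplication by \<open>b\<close> has squared norm at most \<open>Q\<close>, stated for coefficient sums that may be infinite.
\<close>

definition multiplier_bound :: "(complex \<times> complex \<Rightarrow> complex) \<Rightarrow> real \<Rightarrow> bool" where
  "multiplier_bound b Q \<longleftrightarrow> (\<forall>a f e. f holomorphic2_on bidisc \<longrightarrow> pseries2 a f \<longrightarrow>
     pseries2 e (\<lambda>p. b p * f p) \<longrightarrow> dsum2 e \<le> ennreal Q * dsum2 a)"

text \<open>
  The Carleson conditions on the slice measures, uniformly in the other variable.
\<close>

definition slice_bound_z :: "(complex \<times> complex \<Rightarrow> complex) \<Rightarrow> real \<Rightarrow> bool" where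
  "slice_bound_z b K \<longleftrightarrow> (\<forall>w\<in>disc. \<forall>c g. pseries1 c g \<longrightarrow>
     (\<integral>\<^sup>+z. ennreal ((cmod (partial_z b (z, w)))\<^sup>2 * (cmod (g z))\<^sup>2) \<partial>area_disc) \<le> ennreal K * dsum1 c)"

definition slice_bound_w :: "(complex \<times> complex \<Rightarrow> complex) \<Rightarrow> real \<Rightarrow> bool" where
  "slice_bound_w b K \<longleftrightarrow> (\<forall>z\<in>disc. \<forall>c g. pseries1 c g \<longrightarrow>
     (\<integral>\<^sup>+w. ennreal ((cmod (partial_w b (z, w)))\<^sup>2 * (cmod (g w))\<^sup>2) \<partial>area_disc) \<le> ennreal K * dsum1 c)"

text \<open>
  The three terms of the Leibniz rule for \<open>\<partial>\<^sub>z\<^sub>w (b f)\<close> that contain a derivative of \<open>f\<close>. Both directions of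
  the theorem need this estimate, and they use different relations between \<open>Q\<close> and \<open>K\<close>.
\<close>

lemma Leibniz_terms_le:
  assumes b: "pseries2 d b" and f: "pseries2 a f"
    and Q: "0 \<le> Q" and bound: "\<And>p. p \<in> bidisc \<Longrightarrow> (cmod (b p))\<^sup>2 \<le> Q"
    and K: "0 \<le> K" and z: "slice_bound_z b K" and w: "slice_bound_w b K"
  shows "(\<integral>\<^sup>+p. ennreal ((cmod (b p))\<^sup>2 * (cmod (partial_zw f p))\<^sup>2 + (cmod (partial_z b p))\<^sup>2 * (cmod (partial_w f p))\<^sup>2
      + (cmod (partial_w b p))\<^sup>2 * (cmod (partial_z f p))\<^sup>2) \<partial>area_bidisc)
    \<le> ennreal (Q * pi\<^sup>2 + K * pi + K * pi) * dsum2 a"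
proof -
  note [measurable] = pseries2_measurable[OF b] pseries2_measurable[OF pseries2_partial_zw[OF f]]
    pseries2_measurable[OF pseries2_partial_z[OF f]] pseries2_measurable[OF pseries2_partial_w[OF f]]
    pseries2_measurable[OF pseries2_partial_z[OF b]] pseries2_measurable[OF pseries2_partial_w[OF b]]
  have "(\<integral>\<^sup>+p. ennreal ((cmod (b p))\<^sup>2 * (cmod (partial_zw f p))\<^sup>2) \<partial>area_bidisc)
      \<le> (\<integral>\<^sup>+p. ennreal Q * ennreal ((cmod (partial_zw f p))\<^sup>2) \<partial>area_bidisc)"
  proof (rule nn_integral_mono)
    fix p assume "p \<in> space area_bidisc"
    then have "(cmod (b p))\<^sup>2 * (cmod (partial_zw f p))\<^sup>2 \<le> Q * (cmod (partial_zw f p))\<^sup>2"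
      unfolding space_area_bidisc by (intro mult_right_mono bound) auto
    then show "ennreal ((cmod (b p))\<^sup>2 * (cmod (partial_zw f p))\<^sup>2) \<le> ennreal Q * ennreal ((cmod (partial_zw f p))\<^sup>2)"
      using Q by (subst ennreal_mult[symmetric]) (auto intro: ennreal_leI)
  qed
  also have "\<dots> = ennreal Q * (\<integral>\<^sup>+p. ennreal ((cmod (partial_zw f p))\<^sup>2) \<partial>area_bidisc)"
    by (rule nn_integral_cmult) measurable
  also have "\<dots> \<le> ennreal Q * (ennreal (pi\<^sup>2) * dsum2 a)"
    by (intro mult_left_mono area_energy2_le_dsum2[OF f]) simp
  also have "\<dots> = ennreal (Q * pi\<^sup>2) * dsum2 a"
    using Q by (simp add: ennreal_mult mult.assoc)
  finally have T1: "(\<integral>\<^sup>+p. ennreal ((cmod (b p))\<^sup>2 * (cmod (partial_zw f p))\<^sup>2) \<partial>area_bidisc)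
    \<le> ennreal (Q * pi\<^sup>2) * dsum2 a" .
  have T2: "(\<integral>\<^sup>+p. ennreal ((cmod (partial_z b p))\<^sup>2 * (cmod (partial_w f p))\<^sup>2) \<partial>area_bidisc)
      \<le> ennreal (K * pi) * dsum2 a"
    by (rule mixed_term_w_le[OF _ K _ f]) (use z in \<open>simp_all add: slice_bound_z_def\<close>)
  have T3: "(\<integral>\<^sup>+p. ennreal ((cmod (partial_w b p))\<^sup>2 * (cmod (partial_z f p))\<^sup>2) \<partial>area_bidisc)
      \<le> ennreal (K * pi) * dsum2 a"
    by (rule mixed_term_z_le[OF _ K _ f]) (use w in \<open>simp_all add: slice_bound_w_def\<close>)
  have "(\<integral>\<^sup>+p. ennreal ((cmod (b p))\<^sup>2 * (cmod (partial_zw f p))\<^sup>2 + (cmod (partial_z b p))\<^sup>2 * (cmod (partial_w f p))\<^sup>2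
      + (cmod (partial_w b p))\<^sup>2 * (cmod (partial_z f p))\<^sup>2) \<partial>area_bidisc)
    = (\<integral>\<^sup>+p. ennreal ((cmod (b p))\<^sup>2 * (cmod (partial_zw f p))\<^sup>2) \<partial>area_bidisc)
    + (\<integral>\<^sup>+p. ennreal ((cmod (partial_z b p))\<^sup>2 * (cmod (partial_w f p))\<^sup>2) \<partial>area_bidisc)
    + (\<integral>\<^sup>+p. ennreal ((cmod (partial_w b p))\<^sup>2 * (cmod (partial_z f p))\<^sup>2) \<partial>area_bidisc)"
    by (simp add: nn_integral_add)
  also have "\<dots> \<le> ennreal (Q * pi\<^sup>2) * dsum2 a + ennreal (K * pi) * dsum2 a + ennreal (K * pi) * dsum2 a"
    by (intro add_mono T1 T2 T3)
  also have "\<dots> = ennreal (Q * pi\<^sup>2 + K * pi + K * pi) * dsum2 a"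
    using Q K by (simp add: ennreal_mult_add_distrib del: ennreal_plus)
  finally show ?thesis .
qed

text \<open>
  The constant is \<open>10 + 10 + 64\<close>: the two slices through the origin are one-variable products, and
  the integral of \<open>|\<partial>\<^sub>z\<^sub>w (b f)|\<^sup>2\<close> is at most \<open>4 (\<pi> + 1)\<^sup>2 \<le> 16 \<pi>\<^sup>2\<close> times \<open>S\<close> times the squared norm
  of \<open>f\<close>.
\<close>

lemma multiplier_bound_if_bounds:
  assumes b: "b holomorphic2_on bidisc" and S: "0 \<le> S"
    and bound: "\<And>p. p \<in> bidisc \<Longrightarrow> (cmod (b p))\<^sup>2 \<le> S"
    and z: "slice_bound_z b S" and w: "slice_bound_w b S"
    and zw: "\<And>a f. pseries2 a f \<Longrightarrow> f holomorphic2_on bidisc \<Longrightarrow>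
      (\<integral>\<^sup>+p. ennreal ((cmod (partial_zw b p))\<^sup>2 * (cmod (f p))\<^sup>2) \<partial>area_bidisc) \<le> ennreal S * dsum2 a"
  shows "multiplier_bound b (84 * S)"
  unfolding multiplier_bound_def
proof (intro allI impI)
  fix a f e assume hf: "f holomorphic2_on bidisc" and f: "pseries2 a f" and e: "pseries2 e (\<lambda>p. b p * f p)"
  obtain d where d: "pseries2 d b" using holomorphic2_imp_pseries2[OF b] .
  define R where "R p = (cmod (b p))\<^sup>2 * (cmod (partial_zw f p))\<^sup>2 + (cmod (partial_z b p))\<^sup>2 * (cmod (partial_w f p))\<^sup>2
      + (cmod (partial_w b p))\<^sup>2 * (cmod (partial_z f p))\<^sup>2" for p
  note [measurable] = pseries2_measurable[OF d] pseries2_measurable[OF pseries2_partial_zw[OF f]]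
    pseries2_measurable[OF pseries2_partial_z[OF f]] pseries2_measurable[OF pseries2_partial_w[OF f]]
    pseries2_measurable[OF pseries2_partial_z[OF d]] pseries2_measurable[OF pseries2_partial_w[OF d]]
    pseries2_measurable[OF pseries2_partial_zw[OF d]] pseries2_measurable[OF f]
  have [measurable]: "R \<in> borel_measurable area_bidisc" unfolding R_def by measurable
  have R0: "0 \<le> R p" for p by (simp add: R_def)
  have "dsum1 (\<lambda>m. e (m, 0)) \<le> ennreal (10 * S) * dsum1 (\<lambda>m. a (m, 0))"
  proof (rule dsum1_mult_le[where \<phi> = "\<lambda>z. b (z, 0)" and g = "\<lambda>z. f (z, 0)"])
    show "pseries1 (slice_coeff d 0) (\<lambda>z. b (z, 0))" by (rule pseries1_slice_z[OF d]) simp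
    show "pseries1 (\<lambda>m. a (m, 0)) (\<lambda>z. f (z, 0))"
      using pseries1_slice_z[OF f, of 0] by (simp add: slice_coeff_0)
    then show "(\<integral>\<^sup>+z. ennreal ((cmod (deriv (\<lambda>z. b (z, 0)) z))\<^sup>2 * (cmod (f (z, 0)))\<^sup>2) \<partial>area_disc)
        \<le> ennreal S * dsum1 (\<lambda>m. a (m, 0))"
      using z unfolding slice_bound_z_def by (fastforce simp: partial_z_def)
    show "pseries1 (\<lambda>m. e (m, 0)) (\<lambda>z. b (z, 0) * f (z, 0))"
      using pseries1_slice_z[OF e, of 0] by (simp add: slice_coeff_0)
  qed (use S bound in auto)
  also have "\<dots> \<le> ennreal (10 * S) * dsum2 a" by (intro mult_left_mono dsum1_col0_le) simp
  finally have E1: "dsum1 (\<lambda>m. e (m, 0)) \<le> ennreal (10 * S) * dsum2 a" .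
  have "dsum1 (\<lambda>n. e (0, n)) \<le> ennreal (10 * S) * dsum1 (\<lambda>n. a (0, n))"
  proof (rule dsum1_mult_le[where \<phi> = "\<lambda>w. b (0, w)" and g = "\<lambda>w. f (0, w)"])
    show "pseries1 (slice_coeff (d \<circ> prod.swap) 0) (\<lambda>w. b (0, w))" by (rule pseries1_slice_w[OF d]) simp
    show "pseries1 (\<lambda>n. a (0, n)) (\<lambda>w. f (0, w))"
      using pseries1_slice_w[OF f, of 0] by (simp add: slice_coeff_0)
    then show "(\<integral>\<^sup>+w. ennreal ((cmod (deriv (\<lambda>w. b (0, w)) w))\<^sup>2 * (cmod (f (0, w)))\<^sup>2) \<partial>area_disc)
        \<le> ennreal S * dsum1 (\<lambda>n. a (0, n))"
      using w unfolding slice_bound_w_def by (fastforce simp: partial_w_def)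
    show "pseries1 (\<lambda>n. e (0, n)) (\<lambda>w. b (0, w) * f (0, w))"
      using pseries1_slice_w[OF e, of 0] by (simp add: slice_coeff_0)
  qed (use S bound in auto)
  also have "\<dots> \<le> ennreal (10 * S) * dsum2 a" by (intro mult_left_mono dsum1_row0_le) simp
  finally have E2: "dsum1 (\<lambda>n. e (0, n)) \<le> ennreal (10 * S) * dsum2 a" .
  have "(\<integral>\<^sup>+p. ennreal ((cmod (partial_zw (\<lambda>p. b p * f p) p))\<^sup>2) \<partial>area_bidisc)
      \<le> (\<integral>\<^sup>+p. ennreal 4 * ennreal (R p) + ennreal 4 * ennreal ((cmod (partial_zw b p))\<^sup>2 * (cmod (f p))\<^sup>2) \<partial>area_bidisc)"
  proof (rule nn_integral_mono)
    fix p assume "p \<in> space area_bidisc"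
    then have p: "p \<in> bidisc" unfolding space_area_bidisc .
    have "(cmod (partial_zw (\<lambda>p. b p * f p) p))\<^sup>2 \<le> 4 * R p + 4 * ((cmod (partial_zw b p))\<^sup>2 * (cmod (f p))\<^sup>2)"
      unfolding partial_zw_mult[OF d f p] R_def
      by (rule order.trans[OF cmod_add4_square_le]) (simp add: norm_mult power_mult_distrib)
    then show "ennreal ((cmod (partial_zw (\<lambda>p. b p * f p) p))\<^sup>2)
        \<le> ennreal 4 * ennreal (R p) + ennreal 4 * ennreal ((cmod (partial_zw b p))\<^sup>2 * (cmod (f p))\<^sup>2)"
      using R0 by (subst ennreal_linear_combination) (auto intro: ennreal_leI simp del: ennreal_plus)
  qed
  also have "\<dots> = ennreal 4 * (\<integral>\<^sup>+p. ennreal (R p) \<partial>area_bidisc)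
      + ennreal 4 * (\<integral>\<^sup>+p. ennreal ((cmod (partial_zw b p))\<^sup>2 * (cmod (f p))\<^sup>2) \<partial>area_bidisc)"
    by (subst nn_integral_add) (simp_all add: nn_integral_cmult)
  also have "\<dots> \<le> ennreal 4 * (ennreal (S * pi\<^sup>2 + S * pi + S * pi) * dsum2 a) + ennreal 4 * (ennreal S * dsum2 a)"
    unfolding R_def by (intro add_mono mult_left_mono Leibniz_terms_le[OF d f S bound S z w] zw f hf) auto
  also have "\<dots> = ennreal (4 * (S * pi\<^sup>2 + S * pi + S * pi) + 4 * S) * dsum2 a"
    using S by (simp add: ennreal_scale ennreal_mult_add_distrib del: ennreal_plus ennreal_numeral)
  also have "\<dots> \<le> ennreal (16 * pi\<^sup>2 * S) * dsum2 a"
  proof (intro mult_right_mono ennreal_leI)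
    have "1 \<le> pi" using pi_gt3 by simp
    then have "(pi + 1)\<^sup>2 \<le> (2 * pi)\<^sup>2" by (intro power_mono) auto
    then have "4 * S * (pi + 1)\<^sup>2 \<le> 4 * S * (2 * pi)\<^sup>2" using S by (intro mult_left_mono) auto
    then show "4 * (S * pi\<^sup>2 + S * pi + S * pi) + 4 * S \<le> 16 * pi\<^sup>2 * S"
      by (simp add: power2_eq_square algebra_simps)
  qed simp
  finally have E3: "(\<integral>\<^sup>+p. ennreal ((cmod (partial_zw (\<lambda>p. b p * f p) p))\<^sup>2) \<partial>area_bidisc) \<le> ennreal (16 * pi\<^sup>2 * S) * dsum2 a" .
  have "dsum2 e \<le> ennreal (10 * S) * dsum2 a + ennreal (10 * S) * dsum2 a + ennreal (4 / pi\<^sup>2) * (ennreal (16 * pi\<^sup>2 * S) * dsum2 a)"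
    by (rule order.trans[OF dsum2_le_area_energy2[OF e]]) (intro add_mono E1 E2 mult_left_mono E3 zero_le)
  also have "ennreal (4 / pi\<^sup>2) * (ennreal (16 * pi\<^sup>2 * S) * dsum2 a) = ennreal (64 * S) * dsum2 a"
    using S by (simp add: ennreal_scale)
  also have "ennreal (10 * S) * dsum2 a + ennreal (10 * S) * dsum2 a + ennreal (64 * S) * dsum2 a = ennreal (84 * S) * dsum2 a"
    using S by (simp add: ennreal_mult_add_distrib del: ennreal_plus)
  finally show "dsum2 e \<le> ennreal (84 * S) * dsum2 a" .
qed

text \<open>
  The Leibniz rule is solved for the term \<open>\<partial>\<^sub>z\<^sub>w b f\<close>. The constant is
  \<open>4 (\<pi>\<^sup>2 + \<pi>\<^sup>2 + 4 \<pi>\<^sup>2 + 4 \<pi>\<^sup>2)\<close>, with one summand for each of the other terms.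
\<close>

lemma mixed_derivative_bound_if_multiplier_bound:
  assumes b: "b holomorphic2_on bidisc" and Q: "0 \<le> Q" and M: "multiplier_bound b Q"
    and bound: "\<And>p. p \<in> bidisc \<Longrightarrow> (cmod (b p))\<^sup>2 \<le> Q"
    and z: "slice_bound_z b (4 * pi * Q)" and w: "slice_bound_w b (4 * pi * Q)"
    and f: "pseries2 a f" and hf: "f holomorphic2_on bidisc"
  shows "(\<integral>\<^sup>+p. ennreal ((cmod (partial_zw b p))\<^sup>2 * (cmod (f p))\<^sup>2) \<partial>area_bidisc) \<le> ennreal (40 * pi\<^sup>2 * Q) * dsum2 a"
proof -
  obtain d where d: "pseries2 d b" using holomorphic2_imp_pseries2[OF b] .
  obtain e where e: "pseries2 e (\<lambda>p. b p * f p)" using holomorphic2_imp_pseries2[OF holomorphic2_mult[OF b hf]] .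
  define R where "R p = (cmod (b p))\<^sup>2 * (cmod (partial_zw f p))\<^sup>2 + (cmod (partial_z b p))\<^sup>2 * (cmod (partial_w f p))\<^sup>2
      + (cmod (partial_w b p))\<^sup>2 * (cmod (partial_z f p))\<^sup>2" for p
  note [measurable] = pseries2_measurable[OF d] pseries2_measurable[OF pseries2_partial_zw[OF f]]
    pseries2_measurable[OF pseries2_partial_z[OF f]] pseries2_measurable[OF pseries2_partial_w[OF f]]
    pseries2_measurable[OF pseries2_partial_z[OF d]] pseries2_measurable[OF pseries2_partial_w[OF d]]
    pseries2_measurable[OF pseries2_partial_zw[OF e]]
  have [measurable]: "R \<in> borel_measurable area_bidisc" unfolding R_def by measurable
  have R0: "0 \<le> R p" for p by (simp add: R_def)
  have K: "0 \<le> 4 * pi * Q" using Q by simp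
  have "(\<integral>\<^sup>+p. ennreal ((cmod (partial_zw b p))\<^sup>2 * (cmod (f p))\<^sup>2) \<partial>area_bidisc)
      \<le> (\<integral>\<^sup>+p. ennreal 4 * ennreal (R p) + ennreal 4 * ennreal ((cmod (partial_zw (\<lambda>p. b p * f p) p))\<^sup>2) \<partial>area_bidisc)"
  proof (rule nn_integral_mono)
    fix p assume "p \<in> space area_bidisc"
    then have p: "p \<in> bidisc" unfolding space_area_bidisc .
    have "(cmod (partial_zw b p))\<^sup>2 * (cmod (f p))\<^sup>2 = (cmod (- (b p * partial_zw f p) + - (partial_z b p * partial_w f p)
        + - (partial_w b p * partial_z f p) + partial_zw (\<lambda>p. b p * f p) p))\<^sup>2"
      unfolding partial_zw_mult[OF d f p] by (simp add: norm_mult power_mult_distrib)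
    also have "\<dots> \<le> 4 * R p + 4 * (cmod (partial_zw (\<lambda>p. b p * f p) p))\<^sup>2"
      unfolding R_def by (rule order.trans[OF cmod_add4_square_le]) (simp add: norm_mult power_mult_distrib)
    finally show "ennreal ((cmod (partial_zw b p))\<^sup>2 * (cmod (f p))\<^sup>2)
        \<le> ennreal 4 * ennreal (R p) + ennreal 4 * ennreal ((cmod (partial_zw (\<lambda>p. b p * f p) p))\<^sup>2)"
      using R0 by (subst ennreal_linear_combination) (auto intro: ennreal_leI simp del: ennreal_plus)
  qed
  also have "\<dots> = ennreal 4 * (\<integral>\<^sup>+p. ennreal (R p) \<partial>area_bidisc)
      + ennreal 4 * (\<integral>\<^sup>+p. ennreal ((cmod (partial_zw (\<lambda>p. b p * f p) p))\<^sup>2) \<partial>area_bidisc)"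
    by (subst nn_integral_add) (simp_all add: nn_integral_cmult)
  also have "\<dots> \<le> ennreal 4 * (ennreal (Q * pi\<^sup>2 + 4 * pi * Q * pi + 4 * pi * Q * pi) * dsum2 a)
      + ennreal 4 * (ennreal (pi\<^sup>2) * (ennreal Q * dsum2 a))"
  proof (intro add_mono mult_left_mono zero_le)
    show "(\<integral>\<^sup>+p. ennreal (R p) \<partial>area_bidisc) \<le> ennreal (Q * pi\<^sup>2 + 4 * pi * Q * pi + 4 * pi * Q * pi) * dsum2 a"
      unfolding R_def by (rule Leibniz_terms_le[OF d f Q bound K z w])
    have "dsum2 e \<le> ennreal Q * dsum2 a" using M hf f e unfolding multiplier_bound_def by blast
    then show "(\<integral>\<^sup>+p. ennreal ((cmod (partial_zw (\<lambda>p. b p * f p) p))\<^sup>2) \<partial>area_bidisc) \<le> ennreal (pi\<^sup>2) * (ennreal Q * dsum2 a)"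
      by (intro order.trans[OF area_energy2_le_dsum2[OF e]] mult_left_mono) auto
  qed
  also have "\<dots> = ennreal (4 * (Q * pi\<^sup>2 + 4 * pi * Q * pi + 4 * pi * Q * pi) + 4 * (pi\<^sup>2 * Q)) * dsum2 a"
    using Q by (simp add: ennreal_scale ennreal_mult_add_distrib del: ennreal_plus ennreal_numeral)
  also have "4 * (Q * pi\<^sup>2 + 4 * pi * Q * pi + 4 * pi * Q * pi) + 4 * (pi\<^sup>2 * Q) = 40 * pi\<^sup>2 * Q"
    by (simp add: power2_eq_square)
  finally show ?thesis .
qed

section \<open>Reproducing kernels\<close>

text \<open>
  The coefficients of the reproducing kernel at \<open>w\<close> of the one-variable Dirichlet space. The sum
  \<open>kernel_diag w\<close> below is both the value of this kernel at \<open>w\<close> and its squared norm.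
\<close>

definition kernel_coeff :: "complex \<Rightarrow> nat \<Rightarrow> complex" where
  "kernel_coeff w n = cnj w ^ n / (of_nat n + 1)"

definition dirichlet_kernel :: "complex \<Rightarrow> complex \<Rightarrow> complex" where
  "dirichlet_kernel w u = (\<Sum>n. kernel_coeff w n * u ^ n)"

definition kernel_diag :: "complex \<Rightarrow> real" where
  "kernel_diag w = (\<Sum>n. cmod w ^ (2 * n) / (real n + 1))"

lemma pseries1_dirichlet_kernel:
  assumes "w \<in> disc"
  shows "pseries1 (kernel_coeff w) (dirichlet_kernel w)"
  unfolding pseries1_def
proof
  fix u :: complex assume u: "u \<in> disc"
  have "cmod (kernel_coeff w n) \<le> 1" for n
  proof -
    have "cmod (of_nat n + 1) = real n + 1" using cmod_of_nat_Suc[of n] by (simp add: add.commute)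
    moreover have "cmod w ^ n \<le> 1" using assms by (intro power_le_one) auto
    ultimately show ?thesis by (simp add: kernel_coeff_def norm_divide norm_power)
  qed
  then have "norm (kernel_coeff w n * u ^ n) \<le> cmod u ^ n" for n
    by (simp add: norm_mult norm_power mult_left_le_one_le)
  then have "summable (\<lambda>n. kernel_coeff w n * u ^ n)"
    by (intro summable_comparison_test[OF exI[of _ 0], OF _ summable_geometric[of "cmod u"]]) (use u in auto)
  then show "(\<lambda>n. kernel_coeff w n * u ^ n) sums dirichlet_kernel w u"
    unfolding dirichlet_kernel_def by (rule summable_sums)
qed

lemma summable_kernel_diag:
  assumes "w \<in> disc"
  shows "summable (\<lambda>n. cmod w ^ (2 * n) / (real n + 1))"
proof (rule summable_comparison_test[OF exI[of _ 0]])
  have "(cmod w)\<^sup>2 < 1" using assms by (intro power_less_one_iff[THEN iffD2]) auto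
  then show "summable (\<lambda>n. ((cmod w)\<^sup>2) ^ n)" by (intro summable_geometric) simp
  show "\<forall>n\<ge>0. norm (cmod w ^ (2 * n) / (real n + 1)) \<le> ((cmod w)\<^sup>2) ^ n"
    by (simp add: power_mult[symmetric] divide_le_eq mult_left_mono[where a = 1, simplified] algebra_simps)
qed

lemma kernel_diag_ge_1:
  assumes "w \<in> disc"
  shows "1 \<le> kernel_diag w"
  using sum_le_suminf[OF summable_kernel_diag[OF assms], of "{0}"] by (simp add: kernel_diag_def)

lemma dirichlet_kernel_diag:
  assumes "w \<in> disc"
  shows "dirichlet_kernel w w = of_real (kernel_diag w)"
proof -
  have "kernel_coeff w n * w ^ n = of_real (cmod w ^ (2 * n) / (real n + 1))" for n
  proof -
    have "cnj w ^ n * w ^ n = (w * cnj w) ^ n" by (simp add: power_mult_distrib mult.commute)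
    also have "\<dots> = of_real (cmod w ^ (2 * n))"
      unfolding complex_norm_square[symmetric] power_mult by simp
    finally show ?thesis by (simp add: kernel_coeff_def)
  qed
  then have "(\<lambda>n. kernel_coeff w n * w ^ n) sums of_real (kernel_diag w)"
    using sums_of_real[OF summable_sums[OF summable_kernel_diag[OF assms]], where 'a = complex]
    by (simp add: kernel_diag_def)
  moreover have "(\<lambda>n. kernel_coeff w n * w ^ n) sums dirichlet_kernel w w"
    using pseries1_sums[OF pseries1_dirichlet_kernel[OF assms]] assms by simp
  ultimately show ?thesis by (metis sums_unique2)
qed

lemma dsum1_kernel_coeff:
  assumes "w \<in> disc"
  shows "dsum1 (kernel_coeff w) = ennreal (kernel_diag w)"
proof -
  have "(real n + 1) * (cmod (kernel_coeff w n))\<^sup>2 = cmod w ^ (2 * n) / (real n + 1)" for n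
  proof -
    have "cmod (of_nat n + 1) = real n + 1" using cmod_of_nat_Suc[of n] by (simp add: add.commute)
    then show ?thesis
      by (simp add: kernel_coeff_def norm_divide norm_power power_divide power_mult[symmetric] power2_eq_square[of "real n + 1"] mult.commute)
  qed
  then show ?thesis
    unfolding dsum1_def kernel_diag_def by (simp add: suminf_ennreal2 summable_kernel_diag[OF assms])
qed

text \<open>
  Point evaluation is the inner product with the kernel, so this is the Cauchy-Schwarz inequality.
\<close>

lemma pointwise_le_dsum1:
  assumes g: "pseries1 c g" and w: "w \<in> disc"
  shows "ennreal ((cmod (g w))\<^sup>2) \<le> ennreal (kernel_diag w) * dsum1 c"
proof (cases "dsum1 c" rule: ennreal_cases)
  case top
  then show ?thesis using kernel_diag_ge_1[OF w] by (simp add: ennreal_mult_top)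
next
  case (real D)
  have D: "(\<Sum>n<N. (real n + 1) * (cmod (c n))\<^sup>2) \<le> D" for N
  proof -
    have "ennreal (\<Sum>n<N. (real n + 1) * (cmod (c n))\<^sup>2) = (\<Sum>n<N. ennreal ((real n + 1) * (cmod (c n))\<^sup>2))"
      by (rule sum_ennreal[symmetric]) auto
    also have "\<dots> \<le> ennreal D"
      unfolding real(2)[symmetric] dsum1_def by (rule sum_le_suminf[OF summableI]) auto
    finally show ?thesis using real(1) by simp
  qed
  have bnd: "(cmod (\<Sum>n<N. c n * w ^ n))\<^sup>2 \<le> kernel_diag w * D" for N
  proof -
    have "cmod (\<Sum>n<N. c n * w ^ n) \<le> (\<Sum>n<N. (sqrt (real n + 1) * cmod (c n)) * (cmod w ^ n / sqrt (real n + 1)))"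
      by (rule sum_norm_le) (simp add: norm_mult norm_power)
    then have "(cmod (\<Sum>n<N. c n * w ^ n))\<^sup>2 \<le> (\<Sum>n<N. (sqrt (real n + 1) * cmod (c n)) * (cmod w ^ n / sqrt (real n + 1)))\<^sup>2"
      by (intro power_mono) auto
    also have "\<dots> \<le> (\<Sum>n<N. (sqrt (real n + 1) * cmod (c n))\<^sup>2) * (\<Sum>n<N. (cmod w ^ n / sqrt (real n + 1))\<^sup>2)"
      by (rule Cauchy_Schwarz_ineq_sum)
    also have "\<dots> = (\<Sum>n<N. (real n + 1) * (cmod (c n))\<^sup>2) * (\<Sum>n<N. cmod w ^ (2 * n) / (real n + 1))"
      by (simp add: power_mult_distrib power_divide power_mult[symmetric] mult.commute)
    also have "\<dots> \<le> D * kernel_diag w"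
      unfolding kernel_diag_def
      by (intro mult_mono D sum_le_suminf summable_kernel_diag w real sum_nonneg) auto
    finally show ?thesis by (simp add: mult.commute)
  qed
  have "(\<lambda>N. \<Sum>n<N. c n * w ^ n) \<longlonglongrightarrow> g w" using pseries1_sums[OF g, of w] w by (simp add: sums_def)
  then have "(\<lambda>N. (cmod (\<Sum>n<N. c n * w ^ n))\<^sup>2) \<longlonglongrightarrow> (cmod (g w))\<^sup>2" by (intro tendsto_intros)
  then have "(cmod (g w))\<^sup>2 \<le> kernel_diag w * D" by (rule LIMSEQ_le_const2) (use bnd in auto)
  then show ?thesis
    using kernel_diag_ge_1[OF w] real by (simp add: ennreal_mult[symmetric] ennreal_leI)
qed

text \<open>
  Evaluation of the second variable at \<open>w\<close>, applied to each row of coefficients.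
\<close>

lemma dsum1_slice_coeff_le:
  assumes f: "pseries2 a f" and w: "w \<in> disc"
  shows "dsum1 (slice_coeff a w) \<le> ennreal (kernel_diag w) * dsum2 a"
proof -
  have "ennreal ((real m + 1) * (cmod (slice_coeff a w m))\<^sup>2)
      \<le> ennreal (kernel_diag w) * (\<Sum>n. ennreal ((cmod (a (m, n)))\<^sup>2 * (real m + 1) * (real n + 1)))" for m
  proof -
    have "ennreal ((real m + 1) * (cmod (slice_coeff a w m))\<^sup>2)
        = ennreal (real m + 1) * ennreal ((cmod (slice_coeff a w m))\<^sup>2)"
      by (rule ennreal_mult) auto
    also have "\<dots> \<le> ennreal (real m + 1) * (ennreal (kernel_diag w) * dsum1 (\<lambda>n. a (m, n)))"
      by (intro mult_left_mono pointwise_le_dsum1[OF pseries1_slice_coeff[OF f] w]) simp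
    also have "\<dots> = ennreal (kernel_diag w) * (ennreal (real m + 1) * dsum1 (\<lambda>n. a (m, n)))"
      by (rule mult.left_commute)
    also have "ennreal (real m + 1) * dsum1 (\<lambda>n. a (m, n))
        = (\<Sum>n. ennreal ((cmod (a (m, n)))\<^sup>2 * (real m + 1) * (real n + 1)))"
      unfolding dsum1_def ennreal_suminf_cmult[symmetric]
      by (subst ennreal_mult[symmetric]) (simp_all add: ac_simps)
    finally show ?thesis .
  qed
  then have "dsum1 (slice_coeff a w) \<le> (\<Sum>m. ennreal (kernel_diag w) * (\<Sum>n. ennreal ((cmod (a (m, n)))\<^sup>2 * (real m + 1) * (real n + 1))))"
    unfolding dsum1_def by (intro suminf_le summableI)
  then show ?thesis by (simp add: dsum2_def)
qed

text \<open>
  Some double power series represents the product; uniqueness of the one-variable coefficients, first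
  in \<open>z\<close> and then in \<open>w\<close>, identifies it.
\<close>

lemma pseries2_tensor:
  assumes g: "pseries1 c g" and h: "pseries1 d h"
  shows "pseries2 (\<lambda>(m, n). c m * d n) (\<lambda>p. g (fst p) * h (snd p))"
proof -
  have "(\<lambda>p. g (fst p) * h (snd p)) holomorphic2_on bidisc"
    by (intro holomorphic2_mult holomorphic2_fst holomorphic2_snd pseries1_holomorphic[OF g] pseries1_holomorphic[OF h])
  then obtain a where a: "pseries2 a (\<lambda>p. g (fst p) * h (snd p))" by (rule holomorphic2_imp_pseries2)
  have "slice_coeff a w = (\<lambda>m. c m * h w)" if "w \<in> disc" for w
  proof (rule pseries1_unique)
    show "pseries1 (slice_coeff a w) (\<lambda>z. g z * h w)"
      using pseries1_slice_z[OF a, of w] that by simp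
    show "pseries1 (\<lambda>m. c m * h w) (\<lambda>z. g z * h w)"
      using g sums_mult2[where c = "h w"] by (fastforce simp: pseries1_def ac_simps)
  qed
  then have "pseries1 (\<lambda>n. a (m, n)) (\<lambda>w. c m * h w)" for m
    using pseries1_slice_coeff[OF a, of m] by (simp add: pseries1_def)
  moreover have "pseries1 (\<lambda>n. c m * d n) (\<lambda>w. c m * h w)" for m
    using h sums_mult[where c = "c m"] by (fastforce simp: pseries1_def mult.assoc)
  ultimately have "a (m, n) = c m * d n" for m n
    by (metis pseries1_unique)
  then have "a = (\<lambda>(m, n). c m * d n)" by auto
  then show ?thesis using a by simp
qed

lemma dsum2_tensor: "dsum2 (\<lambda>(m, n). c m * d n) = dsum1 c * dsum1 d"
proof -
  have "ennreal ((cmod (c m * d n))\<^sup>2 * (real m + 1) * (real n + 1))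
      = ennreal ((real m + 1) * (cmod (c m))\<^sup>2) * ennreal ((real n + 1) * (cmod (d n))\<^sup>2)" for m n
    by (subst ennreal_mult[symmetric]) (simp_all add: norm_mult power_mult_distrib ac_simps)
  then show ?thesis by (simp add: dsum2_def dsum1_def)
qed

lemma dsum1_cmult: "dsum1 (\<lambda>m. of_real r * c m) = ennreal (r\<^sup>2) * dsum1 c"
proof -
  have "ennreal ((real n + 1) * (cmod (of_real r * c n))\<^sup>2) = ennreal (r\<^sup>2) * ennreal ((real n + 1) * (cmod (c n))\<^sup>2)" for n
    by (subst ennreal_mult[symmetric]) (simp_all add: norm_mult power_mult_distrib ac_simps)
  then show ?thesis by (simp add: dsum1_def)
qed

lemma ennreal_mult_le_cancel_left:
  assumes "0 < r" "ennreal r * x \<le> ennreal r * y"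
  shows "x \<le> y"
proof -
  have "ennreal (1 / r) * (ennreal r * x) \<le> ennreal (1 / r) * (ennreal r * y)"
    by (intro mult_left_mono assms) simp
  then show ?thesis using assms(1) by (simp add: ennreal_scale)
qed

section \<open>A multiplier satisfies the Carleson bounds\<close>

text \<open>
  Apply the bound to \<open>f(z, u) = g(z) k(u)\<close> with the kernel \<open>k\<close> at \<open>w\<close>, and put \<open>K = k(w)\<close>. The squared norm of
  \<open>f\<close> is \<open>K\<close> times that of \<open>g\<close>; evaluation at \<open>w\<close> costs another factor \<open>K\<close>; and the slice of
  \<open>b f\<close> at \<open>w\<close> is \<open>K b(\<cdot>, w) g\<close>, whose squared norm carries the factor \<open>K\<^sup>2\<close>. The factors
  cancel, and the bound \<open>Q\<close> remains unchanged.
\<close>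

lemma slice_multiplier_bound:
  assumes b: "b holomorphic2_on bidisc" and M: "multiplier_bound b Q" and Q: "0 \<le> Q"
    and w: "w \<in> disc" and g: "pseries1 c g" and e: "pseries1 e (\<lambda>z. b (z, w) * g z)"
  shows "dsum1 e \<le> ennreal Q * dsum1 c"
proof -
  define K where "K = kernel_diag w"
  have K: "K > 0" using kernel_diag_ge_1[OF w] by (simp add: K_def)
  have k: "pseries1 (kernel_coeff w) (dirichlet_kernel w)" by (rule pseries1_dirichlet_kernel[OF w])
  define f where "f p = g (fst p) * dirichlet_kernel w (snd p)" for p
  have hf: "f holomorphic2_on bidisc"
    unfolding f_def by (intro holomorphic2_mult holomorphic2_fst holomorphic2_snd pseries1_holomorphic[OF g] pseries1_holomorphic[OF k])
  have f: "pseries2 (\<lambda>(m, n). c m * kernel_coeff w n) f"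
    unfolding f_def by (rule pseries2_tensor[OF g k])
  obtain E where E: "pseries2 E (\<lambda>p. b p * f p)" using holomorphic2_imp_pseries2[OF holomorphic2_mult[OF b hf]] .
  have "slice_coeff E w = (\<lambda>m. of_real K * e m)"
  proof (rule pseries1_unique)
    have "(\<lambda>z. b (z, w) * f (z, w)) = (\<lambda>z. of_real K * (b (z, w) * g z))"
      by (simp add: f_def dirichlet_kernel_diag[OF w] K_def ac_simps)
    then show "pseries1 (slice_coeff E w) (\<lambda>z. of_real K * (b (z, w) * g z))"
      using pseries1_slice_z[OF E, of w] w by (metis dist_0_norm mem_ball)
    show "pseries1 (\<lambda>m. of_real K * e m) (\<lambda>z. of_real K * (b (z, w) * g z))"
      using e sums_mult[where c = "of_real K :: complex"] by (fastforce simp: pseries1_def mult.assoc)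
  qed
  then have "ennreal (K\<^sup>2) * dsum1 e = dsum1 (slice_coeff E w)" by (simp add: dsum1_cmult)
  also have "\<dots> \<le> ennreal K * dsum2 E" unfolding K_def by (rule dsum1_slice_coeff_le[OF E w])
  also have "\<dots> \<le> ennreal K * (ennreal Q * dsum2 (\<lambda>(m, n). c m * kernel_coeff w n))"
  proof (rule mult_left_mono)
    show "dsum2 E \<le> ennreal Q * dsum2 (\<lambda>(m, n). c m * kernel_coeff w n)"
      using M hf f E unfolding multiplier_bound_def by blast
  qed simp
  also have "\<dots> = ennreal K * (ennreal Q * (dsum1 c * ennreal K))"
    by (simp add: dsum2_tensor dsum1_kernel_coeff[OF w] K_def)
  also have "\<dots> = ennreal K * (ennreal K * (ennreal Q * dsum1 c))"
    by (simp only: mult.commute mult.left_commute)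
  also have "\<dots> = ennreal (K\<^sup>2) * (ennreal Q * dsum1 c)"
    using K by (simp add: ennreal_scale power2_eq_square del: mult_cancel_left)
  finally show ?thesis by (rule ennreal_mult_le_cancel_left[rotated]) (use K in simp)
qed

text \<open>
  The slice \<open>b(\<cdot>, w)\<close> multiplies the kernel \<open>k\<close> at \<open>z\<close> to a function of squared norm at most \<open>Q K\<close>, where
  \<open>K = k(z)\<close>. Evaluation at \<open>z\<close> gives \<open>|b(z, w)|\<^sup>2 K\<^sup>2 \<le> K (Q K)\<close>.
\<close>

lemma multiplier_bound_imp_bounded:
  assumes b: "b holomorphic2_on bidisc" and M: "multiplier_bound b Q" and Q: "0 \<le> Q" and p: "p \<in> bidisc"
  shows "(cmod (b p))\<^sup>2 \<le> Q"
proof -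
  obtain z w where zw: "p = (z, w)" "z \<in> disc" "w \<in> disc" using p by auto
  define K where "K = kernel_diag z"
  have K: "K > 0" using kernel_diag_ge_1[OF zw(2)] by (simp add: K_def)
  have k: "pseries1 (kernel_coeff z) (dirichlet_kernel z)" by (rule pseries1_dirichlet_kernel[OF zw(2)])
  have "(\<lambda>u. b (u, w) * dirichlet_kernel z u) holomorphic_on disc"
    by (intro holomorphic_on_mult holomorphic2_slice_z[OF b zw(3)] pseries1_holomorphic[OF k])
  from pseries1_exists[OF this]
  obtain e where e: "pseries1 e (\<lambda>u. b (u, w) * dirichlet_kernel z u)" by blast
  have "ennreal ((cmod (b (z, w) * dirichlet_kernel z z))\<^sup>2) \<le> ennreal K * dsum1 e"
    unfolding K_def by (rule pointwise_le_dsum1[OF e zw(2)])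
  also have "\<dots> \<le> ennreal K * (ennreal Q * dsum1 (kernel_coeff z))"
    by (intro mult_left_mono slice_multiplier_bound[OF b M Q zw(3) k e]) simp
  also have "\<dots> = ennreal (K * (Q * K))"
    using K Q by (simp add: dsum1_kernel_coeff[OF zw(2)] K_def[symmetric] ennreal_mult)
  finally have "(cmod (b (z, w) * dirichlet_kernel z z))\<^sup>2 \<le> K * (Q * K)"
    using K Q by (simp add: ennreal_le_iff)
  then have "K\<^sup>2 * (cmod (b (z, w)))\<^sup>2 \<le> K\<^sup>2 * Q"
    using K by (simp add: dirichlet_kernel_diag[OF zw(2)] K_def[symmetric] norm_mult power_mult_distrib power2_eq_square ac_simps)
  then show ?thesis using K zw by simp
qed

lemma multiplier_bound_imp_slice_bound_z:
  assumes b: "b holomorphic2_on bidisc" and M: "multiplier_bound b Q" and Q: "0 \<le> Q"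
  shows "slice_bound_z b (4 * pi * Q)"
  unfolding slice_bound_z_def
proof (intro ballI allI impI)
  fix w c g assume w: "w \<in> disc" and g: "pseries1 c g"
  obtain d where d: "pseries2 d b" using holomorphic2_imp_pseries2[OF b] .
  have "(\<lambda>z. b (z, w) * g z) holomorphic_on disc"
    by (intro holomorphic_on_mult holomorphic2_slice_z[OF b w] pseries1_holomorphic[OF g])
  from pseries1_exists[OF this]
  obtain e where e: "pseries1 e (\<lambda>z. b (z, w) * g z)" by blast
  have "(\<integral>\<^sup>+z. ennreal ((cmod (deriv (\<lambda>z. b (z, w)) z))\<^sup>2 * (cmod (g z))\<^sup>2) \<partial>area_disc) \<le> ennreal (4 * pi * Q) * dsum1 c"
  proof (rule nn_integral_deriv_mult_le[OF pseries1_slice_z[OF d] g e Q])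
    show "(cmod (b (z, w)))\<^sup>2 \<le> Q" if "z \<in> disc" for z
      using multiplier_bound_imp_bounded[OF b M Q] that w by auto
    show "dsum1 e \<le> ennreal Q * dsum1 c" by (rule slice_multiplier_bound[OF b M Q w g e])
  qed (use w in simp)
  then show "(\<integral>\<^sup>+z. ennreal ((cmod (partial_z b (z, w)))\<^sup>2 * (cmod (g z))\<^sup>2) \<partial>area_disc) \<le> ennreal (4 * pi * Q) * dsum1 c"
    by (simp add: partial_z_def)
qed

lemma multiplier_bound_swap:
  assumes "multiplier_bound b Q"
  shows "multiplier_bound (b \<circ> prod.swap) Q"
  unfolding multiplier_bound_def
proof (intro allI impI)
  fix a f e assume f: "f holomorphic2_on bidisc" "pseries2 a f" and e: "pseries2 e (\<lambda>p. (b \<circ> prod.swap) p * f p)"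
  have "pseries2 (e \<circ> prod.swap) (\<lambda>p. b p * (f \<circ> prod.swap) p)"
    using pseries2_swap[OF e] by (simp add: o_def)
  then have "dsum2 (e \<circ> prod.swap) \<le> ennreal Q * dsum2 (a \<circ> prod.swap)"
    using assms holomorphic2_swap[OF f(1)] pseries2_swap[OF f(2)] unfolding multiplier_bound_def by blast
  then show "dsum2 e \<le> ennreal Q * dsum2 a" by (simp add: dsum2_swap)
qed

lemma multiplier_bound_imp_slice_bound_w:
  assumes "b holomorphic2_on bidisc" "multiplier_bound b Q" "0 \<le> Q"
  shows "slice_bound_w b (4 * pi * Q)"
  using multiplier_bound_imp_slice_bound_z[OF holomorphic2_swap[OF assms(1)] multiplier_bound_swap[OF assms(2)] assms(3)]
  by (simp add: slice_bound_z_def slice_bound_w_def partial_z_def partial_w_def)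

section \<open>Operator norms\<close>

lemma opnorm_le_if_multiplier_bound:
  assumes b: "b holomorphic2_on bidisc" and M: "multiplier_bound b Q" and Q: "0 \<le> Q"
  shows "(dirichlet2_opnorm (mult_op b))\<^sup>2 \<le> ennreal Q"
proof -
  have "mult_op b f \<in> dirichlet2 \<and> dirichlet2_norm (mult_op b f) \<le> sqrt Q * dirichlet2_norm f"
    if f: "f \<in> dirichlet2" for f
  proof -
    have hf: "f holomorphic2_on bidisc" using f by (simp add: dirichlet2_def)
    obtain a where a: "pseries2 a f" using holomorphic2_imp_pseries2[OF hf] .
    have hbf: "(\<lambda>p. b p * f p) holomorphic2_on bidisc" by (rule holomorphic2_mult[OF b hf])
    obtain e where e: "pseries2 e (\<lambda>p. b p * f p)" using holomorphic2_imp_pseries2[OF hbf] .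
    have a_fin: "dsum2 a \<noteq> top" using dirichlet2_iff[OF a hf] f by simp
    have le: "dsum2 e \<le> ennreal Q * dsum2 a" using M hf a e unfolding multiplier_bound_def by blast
    then have e_fin: "dsum2 e \<noteq> top" using a_fin by (auto simp: top_unique ennreal_mult_eq_top_iff)
    have mem: "mult_op b f \<in> dirichlet2" using dirichlet2_iff[OF e hbf] e_fin by (simp add: mult_op_def)
    have "ennreal ((dirichlet2_norm (mult_op b f))\<^sup>2) \<le> ennreal Q * ennreal ((dirichlet2_norm f)\<^sup>2)"
      using le dirichlet2_norm_dsum2[OF a a_fin] dirichlet2_norm_dsum2[OF e e_fin] by (simp add: mult_op_def)
    then have "(dirichlet2_norm (mult_op b f))\<^sup>2 \<le> Q * (dirichlet2_norm f)\<^sup>2"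
      using Q by (simp add: ennreal_mult[symmetric])
    also have "\<dots> = (sqrt Q * dirichlet2_norm f)\<^sup>2" using Q by (simp add: power_mult_distrib)
    finally have "dirichlet2_norm (mult_op b f) \<le> sqrt Q * dirichlet2_norm f"
      by (rule power2_le_imp_le) (use Q dirichlet2_norm_nonneg[of f] in simp)
    with mem show ?thesis ..
  qed
  then have "dirichlet2_opnorm (mult_op b) \<le> ennreal (sqrt Q)"
    unfolding dirichlet2_opnorm_def using Q by (intro Inf_lower) auto
  then have "(dirichlet2_opnorm (mult_op b))\<^sup>2 \<le> (ennreal (sqrt Q))\<^sup>2" by (intro power_mono) auto
  then show ?thesis using Q by (simp add: ennreal_power)
qed

lemma multiplier_bound_if_opnorm_less:
  assumes b: "b holomorphic2_on bidisc" and less: "dirichlet2_opnorm (mult_op b) < ennreal M"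
  shows "multiplier_bound b (M\<^sup>2)"
  unfolding multiplier_bound_def
proof (intro allI impI)
  fix a f e assume hf: "f holomorphic2_on bidisc" and a: "pseries2 a f" and e: "pseries2 e (\<lambda>p. b p * f p)"
  have M: "M > 0" using less by (metis ennreal_eq_0_iff not_le not_less_zero)
  show "dsum2 e \<le> ennreal (M\<^sup>2) * dsum2 a"
  proof (cases "dsum2 a = top")
    case True
    then show ?thesis using M by (simp add: ennreal_mult_top)
  next
    case False
    obtain C where C: "ennreal C < ennreal M" "0 \<le> C" and
      bnd: "\<forall>f\<in>dirichlet2. mult_op b f \<in> dirichlet2 \<and> dirichlet2_norm (mult_op b f) \<le> C * dirichlet2_norm f"
      using less unfolding dirichlet2_opnorm_def Inf_less_iff by blast
    have CM: "C \<le> M" using C M by (simp add: ennreal_less_iff)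
    have f: "f \<in> dirichlet2" using dirichlet2_iff[OF a hf] False by simp
    have hbf: "(\<lambda>p. b p * f p) holomorphic2_on bidisc" by (rule holomorphic2_mult[OF b hf])
    have "(\<lambda>p. b p * f p) \<in> dirichlet2" and le: "dirichlet2_norm (\<lambda>p. b p * f p) \<le> C * dirichlet2_norm f"
      using bnd f by (auto simp: mult_op_def)
    then have e_fin: "dsum2 e \<noteq> top" using dirichlet2_iff[OF e hbf] by simp
    have "dirichlet2_norm (\<lambda>p. b p * f p) \<le> M * dirichlet2_norm f"
      using le CM dirichlet2_norm_nonneg[of f] by (meson mult_right_mono order.trans)
    then have "(dirichlet2_norm (\<lambda>p. b p * f p))\<^sup>2 \<le> M\<^sup>2 * (dirichlet2_norm f)\<^sup>2"
      using dirichlet2_norm_nonneg by (simp add: power_mult_distrib[symmetric] power_mono)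
    then have "ennreal ((dirichlet2_norm (\<lambda>p. b p * f p))\<^sup>2) \<le> ennreal (M\<^sup>2) * ennreal ((dirichlet2_norm f)\<^sup>2)"
      by (simp add: ennreal_mult[symmetric] ennreal_leI)
    then show ?thesis
      unfolding dirichlet2_norm_dsum2[OF a False] dirichlet2_norm_dsum2[OF e e_fin] .
  qed
qed

lemma opnorm_le_multiplier_quantity:
  assumes b: "b holomorphic2_on bidisc" and less: "multiplier_quantity b < ennreal S"
  shows "(dirichlet2_opnorm (mult_op b))\<^sup>2 \<le> ennreal (84 * S)"
proof (rule opnorm_le_if_multiplier_bound[OF b])
  have S: "0 < S" using less by (metis ennreal_eq_0_iff not_le not_less_zero)
  then show "0 \<le> 84 * S" by simp
  obtain d where d: "pseries2 d b" using holomorphic2_imp_pseries2[OF b] .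
  define A where "A = CM2 (mixed_measure b)"
  define B where "B = (Hinf_norm b)\<^sup>2"
  define C where "C = (SUP w\<in>disc. CM1 (slice_measure_z b w))"
  define D where "D = (SUP z\<in>disc. CM1 (slice_measure_w b z))"
  have sum_less: "A + B + C + D < ennreal S"
    using less unfolding multiplier_quantity_def A_def B_def C_def D_def .
  have *: "A < ennreal S" "B < ennreal S" "C < ennreal S" "D < ennreal S"
    by (rule le_less_trans[OF _ sum_less], auto simp: add.assoc intro: add_increasing add_increasing2)+
  show "multiplier_bound b (84 * S)"
  proof (rule multiplier_bound_if_bounds[OF b])
    fix p assume "p \<in> bidisc"
    then have "ennreal (cmod (b p)) \<le> Hinf_norm b" unfolding Hinf_norm_def by (rule SUP_upper)
    then have "(ennreal (cmod (b p)))\<^sup>2 \<le> B" unfolding B_def by (intro power_mono) auto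
    also have "\<dots> < ennreal S" by (rule *)
    finally show "(cmod (b p))\<^sup>2 \<le> S" using S by (simp add: ennreal_power ennreal_less_iff)
  next
    show "slice_bound_z b S" unfolding slice_bound_z_def
    proof (intro ballI allI impI)
      fix w c g assume w: "w \<in> disc" and g: "pseries1 c g"
      have m: "(\<lambda>z. partial_z b (z, w)) \<in> borel_measurable area_disc"
        using pseries1_slice_z[OF pseries2_partial_z[OF d], of w] w by (intro pseries1_measurable) auto
      have "CM1 (slice_measure_z b w) \<le> C" unfolding C_def by (rule SUP_upper[OF w])
      then have "CM1 (density area_disc (\<lambda>z. ennreal ((cmod (partial_z b (z, w)))\<^sup>2))) < ennreal S"
        using * unfolding slice_measure_z_def by auto
      from CM1_density_less[OF m this g]
      show "(\<integral>\<^sup>+z. ennreal ((cmod (partial_z b (z, w)))\<^sup>2 * (cmod (g z))\<^sup>2) \<partial>area_disc) \<le> ennreal S * dsum1 c" .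
    qed
  next
    show "slice_bound_w b S" unfolding slice_bound_w_def
    proof (intro ballI allI impI)
      fix z c g assume z: "z \<in> disc" and g: "pseries1 c g"
      have m: "(\<lambda>w. partial_w b (z, w)) \<in> borel_measurable area_disc"
        using pseries1_slice_w[OF pseries2_partial_w[OF d], of z] z by (intro pseries1_measurable) auto
      have "CM1 (slice_measure_w b z) \<le> D" unfolding D_def by (rule SUP_upper[OF z])
      then have "CM1 (density area_disc (\<lambda>w. ennreal ((cmod (partial_w b (z, w)))\<^sup>2))) < ennreal S"
        using * unfolding slice_measure_w_def by auto
      from CM1_density_less[OF m this g]
      show "(\<integral>\<^sup>+w. ennreal ((cmod (partial_w b (z, w)))\<^sup>2 * (cmod (g w))\<^sup>2) \<partial>area_disc) \<le> ennreal S * dsum1 c" .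
    qed
  next
    fix a f assume "pseries2 a f" "f holomorphic2_on bidisc"
    then show "(\<integral>\<^sup>+p. ennreal ((cmod (partial_zw b p))\<^sup>2 * (cmod (f p))\<^sup>2) \<partial>area_bidisc) \<le> ennreal S * dsum2 a"
      using *(1) unfolding A_def mixed_measure_def
      by (intro CM2_density_less pseries2_measurable[OF pseries2_partial_zw[OF d]])
  qed (use S in simp)
qed

lemma multiplier_quantity_le:
  assumes b: "b holomorphic2_on bidisc" and M: "multiplier_bound b Q" and Q: "0 \<le> Q"
  shows "multiplier_quantity b \<le> ennreal ((40 * pi\<^sup>2 + 1 + 8 * pi) * Q)"
proof -
  obtain d where d: "pseries2 d b" using holomorphic2_imp_pseries2[OF b] .
  note bounded = multiplier_bound_imp_bounded[OF b M Q]
  note z = multiplier_bound_imp_slice_bound_z[OF b M Q]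
  note w = multiplier_bound_imp_slice_bound_w[OF b M Q]
  have 1: "CM2 (mixed_measure b) \<le> ennreal (40 * pi\<^sup>2 * Q)"
    unfolding mixed_measure_def
    by (intro CM2_density_le pseries2_measurable[OF pseries2_partial_zw[OF d]]
        mixed_derivative_bound_if_multiplier_bound[OF b Q M bounded z w])
  have "Hinf_norm b \<le> ennreal (sqrt Q)"
    unfolding Hinf_norm_def using bounded by (intro SUP_least ennreal_leI real_le_rsqrt)
  then have "(Hinf_norm b)\<^sup>2 \<le> (ennreal (sqrt Q))\<^sup>2" by (intro power_mono) auto
  then have 2: "(Hinf_norm b)\<^sup>2 \<le> ennreal Q" using Q by (simp add: ennreal_power)
  have 3: "(SUP w\<in>disc. CM1 (slice_measure_z b w)) \<le> ennreal (4 * pi * Q)"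
  proof (rule SUP_least)
    fix w :: complex assume w: "w \<in> disc"
    have "(\<lambda>z. partial_z b (z, w)) \<in> borel_measurable area_disc"
      using pseries1_slice_z[OF pseries2_partial_z[OF d], of w] w by (intro pseries1_measurable) auto
    then show "CM1 (slice_measure_z b w) \<le> ennreal (4 * pi * Q)"
      unfolding slice_measure_z_def using z w unfolding slice_bound_z_def by (intro CM1_density_le) blast+
  qed
  have 4: "(SUP z\<in>disc. CM1 (slice_measure_w b z)) \<le> ennreal (4 * pi * Q)"
  proof (rule SUP_least)
    fix z :: complex assume z: "z \<in> disc"
    have "(\<lambda>w. partial_w b (z, w)) \<in> borel_measurable area_disc"
      using pseries1_slice_w[OF pseries2_partial_w[OF d], of z] z by (intro pseries1_measurable) auto
    then show "CM1 (slice_measure_w b z) \<le> ennreal (4 * pi * Q)"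
      unfolding slice_measure_w_def using w z unfolding slice_bound_w_def by (intro CM1_density_le) blast+
  qed
  have "multiplier_quantity b \<le> ennreal (40 * pi\<^sup>2 * Q) + ennreal Q + ennreal (4 * pi * Q) + ennreal (4 * pi * Q)"
    unfolding multiplier_quantity_def by (intro add_mono 1 2 3 4)
  also have "\<dots> = ennreal (40 * pi\<^sup>2 * Q + Q + 4 * pi * Q + 4 * pi * Q)"
    using Q by (simp add: ennreal_plus[symmetric] del: ennreal_plus)
  also have "40 * pi\<^sup>2 * Q + Q + 4 * pi * Q + 4 * pi * Q = (40 * pi\<^sup>2 + 1 + 8 * pi) * Q"
    by (simp add: algebra_simps)
  finally show ?thesis .
qed

text \<open>
  Both halves of the theorem are proved with strict upper bounds in place of the possibly infinite
  quantities; this removes the slack.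
\<close>

lemma ennreal_le_mult_if_all_greater:
  assumes C: "0 < C" and le: "\<And>S. x < ennreal S \<Longrightarrow> y \<le> ennreal (C * S)"
  shows "y \<le> ennreal C * x"
proof (cases x rule: ennreal_cases)
  case top
  then show ?thesis using C by (simp add: ennreal_mult_top)
next
  case (real r)
  have eps: "y \<le> ennreal (C * r) + ennreal \<epsilon>" if "\<epsilon> > 0" for \<epsilon>
  proof -
    have "y \<le> ennreal (C * (r + \<epsilon> / C))"
      using real that C by (intro le) (simp add: ennreal_less_iff)
    also have "C * (r + \<epsilon> / C) = C * r + \<epsilon>" using C by (simp add: field_simps)
    also have "ennreal (C * r + \<epsilon>) = ennreal (C * r) + ennreal \<epsilon>" using C real that by simp
    finally show ?thesis .
  qed
  have "y \<le> ennreal (C * r)" by (rule ennreal_le_epsilon) (rule eps)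
  then show ?thesis
    unfolding real(2) ennreal_mult[OF less_imp_le[OF C] real(1)] .
qed

theorem theorem1p2:
  "\<exists>C1 C2 :: real. 0 < C1 \<and> 0 < C2 \<and>
     (\<forall>b :: complex \<times> complex \<Rightarrow> complex. b holomorphic2_on bidisc \<longrightarrow>
        ennreal C1 * multiplier_quantity b \<le> (dirichlet2_opnorm (mult_op b))\<^sup>2 \<and>
        (dirichlet2_opnorm (mult_op b))\<^sup>2 \<le> ennreal C2 * multiplier_quantity b)"
proof -
  define L where "L = 40 * pi\<^sup>2 + 1 + 8 * pi"
  have L: "L > 0" unfolding L_def by (intro add_pos_pos) auto
  show ?thesis
  proof (rule exI[of _ "1 / L"], rule exI[of _ 84], intro conjI allI impI)
    fix b :: "complex \<times> complex \<Rightarrow> complex" assume b: "b holomorphic2_on bidisc"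
    show "(dirichlet2_opnorm (mult_op b))\<^sup>2 \<le> ennreal 84 * multiplier_quantity b"
      by (rule ennreal_le_mult_if_all_greater[OF _ opnorm_le_multiplier_quantity[OF b]]) auto
    have "multiplier_quantity b \<le> ennreal L * (dirichlet2_opnorm (mult_op b))\<^sup>2"
    proof (rule ennreal_le_mult_if_all_greater[OF L])
      fix S assume less: "(dirichlet2_opnorm (mult_op b))\<^sup>2 < ennreal S"
      have S: "0 < S" using less by (metis ennreal_eq_0_iff not_le not_less_zero)
      have "dirichlet2_opnorm (mult_op b) < ennreal (sqrt S)"
      proof (rule ccontr)
        assume "\<not> dirichlet2_opnorm (mult_op b) < ennreal (sqrt S)"
        then have "(ennreal (sqrt S))\<^sup>2 \<le> (dirichlet2_opnorm (mult_op b))\<^sup>2" by (intro power_mono) auto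
        then show False using less S by (simp add: ennreal_power)
      qed
      from multiplier_bound_if_opnorm_less[OF b this]
      have "multiplier_bound b S" using S by simp
      from multiplier_quantity_le[OF b this] show "multiplier_quantity b \<le> ennreal (L * S)"
        using S by (simp add: L_def)
    qed
    then have "ennreal (1 / L) * multiplier_quantity b
        \<le> ennreal (1 / L) * (ennreal L * (dirichlet2_opnorm (mult_op b))\<^sup>2)"
      by (intro mult_left_mono) auto
    then show "ennreal (1 / L) * multiplier_quantity b \<le> (dirichlet2_opnorm (mult_op b))\<^sup>2"
      using L by (simp add: ennreal_scale)
  qed (use L in auto)
qed

end
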